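(* Let $\Omega$ be a bounded domain with smooth boundary in $\mathbb{R}^n$ and let $g\in C(\mathbb{R},\mathbb{R})$ satisfy $g(\sigma)\ge0$ for $\sigma\ge0$. Let $u$ be a smooth positive solution of $$-\frac1n\,\mathrm{div}\left(\nabla_\xi[F^n](\nabla u)\right)=g(u)\ \text{ in }\Omega,\qquad u=0\ \text{ on }\partial\Omega.$$ Then $$\left(\int_\Omega g(u)\,dx\right)^{\frac n{n-1}}\ge\frac{n^{\frac{2n-1}{n-1}}\kappa_n^{\frac1{n-1}}}{n-1}\int_\Omega G(u)\,dx,$$ where $G(u)=\int_0^u g(s)\,ds$.
   Context: $F:\mathbb{R}^n\to[0,+\infty)$ is a convex function of class $C^1(\mathbb{R}^n\setminus\{0\})$ which is even and positively homogeneous of degree 1 ($F(tx)=|t|F(x)$), and there are constants $0<a\le c$ with $a|\xi|\le F(\xi)\le c|\xi|$ for all $\xi$. $\nabla_\xi[F^n]$ is the gradient of $\xi\mapsto F(\xi)^n$, evaluated at $\xi=\nabla u$. $\kappa_n$ is the Lebesgue measure of $K^o=\{x\in\mathbb{R}^n:\sup_{z\neq0}\frac{\langle x,z\rangle}{F(z)}\le1\}$. *)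

theory Defs
  imports "HOL-Analysis.Analysis"
begin

text \<open>C^k functions on a set S (meant for open S): continuous for k = 0; for k+1,
  Frechet differentiable at every point of S with all directional derivatives
  (x \<mapsto> f' x v) of class C^k on S.\<close>
fun Ck_on :: "nat \<Rightarrow> 'a::euclidean_space set \<Rightarrow> ('a \<Rightarrow> 'b::euclidean_space) \<Rightarrow> bool" where
  "Ck_on 0 S f = continuous_on S f"
| "Ck_on (Suc k) S f =
     (\<exists>f'. (\<forall>x\<in>S. (f has_derivative f' x) (at x)) \<and> (\<forall>v. Ck_on k S (\<lambda>x. f' x v)))"

definition smooth_on :: "'a::euclidean_space set \<Rightarrow> ('a \<Rightarrow> 'b::euclidean_space) \<Rightarrow> bool" where
  "smooth_on S f \<longleftrightarrow> (\<forall>k. Ck_on k S f)"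

definition grad :: "('a::euclidean_space \<Rightarrow> real) \<Rightarrow> 'a \<Rightarrow> 'a" where
  "grad f x = (SOME w. (f has_derivative (\<lambda>h. w \<bullet> h)) (at x))"

definition divergence :: "('a::euclidean_space \<Rightarrow> 'a) \<Rightarrow> 'a \<Rightarrow> real" where
  "divergence V x = (\<Sum>i\<in>Basis. frechet_derivative V (at x) i \<bullet> i)"

definition smooth_boundary :: "'a::euclidean_space set \<Rightarrow> bool" where
  "smooth_boundary \<Omega> \<longleftrightarrow>
     (\<exists>\<rho>::'a \<Rightarrow> real. smooth_on UNIV \<rho> \<and> \<Omega> = {x. \<rho> x < 0} \<and>
        (\<forall>x. \<rho> x = 0 \<longrightarrow> grad \<rho> x \<noteq> 0))"

definition polar_body :: "('a::euclidean_space \<Rightarrow> real) \<Rightarrow> 'a set" where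
  "polar_body F = {x. \<forall>z. z \<noteq> 0 \<longrightarrow> (x \<bullet> z) / F z \<le> 1}"

end

theory Submission
  imports Defs
begin

text \<open>Extend \<open>u\<close> by zero to \<open>v\<close>, and for \<open>s > 0\<close> let \<open>\<mu>(s)\<close> be the volume of \<open>{v \<ge> s}\<close> and \<open>I(s)\<close> the
  integral of \<open>g(v)\<close> over it. Testing the equation with a function of \<open>v\<close> bounds the integral of
  \<open>F(\<nabla>v)\<^sup>n\<close> over \<open>{s \<le> v < t}\<close> by \<open>(t - s) I(s)\<close>. The anisotropic isoperimetric inequality
  bounds the integral of \<open>F(\<nabla>v)\<close> over the same set from below by \<open>n \<kappa>\<^sup>1\<^sup>/\<^sup>n (t - s)\<close> times
  \<open>\<mu>(t)\<^sup>1\<^sup>-\<^sup>1\<^sup>/\<^sup>n\<close>; this comes from the Brunn-Minkowski inequality for \<open>{v > \<tau>} + \<epsilon> K\<close>, with \<open>K\<close> the polar body,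
  because \<open>v(x + \<epsilon> z)\<close> exceeds \<open>v(x)\<close> by at most \<open>\<epsilon> F(\<nabla>v(x))\<close> up to a small error. By
  Jensen's inequality \<open>C (t - s) \<mu>(t) \<le> I(s)\<^sup>q (\<mu>(s) - \<mu>(t))\<close> with \<open>q = 1/(n-1)\<close> and \<open>C = (n\<^sup>n \<kappa>)\<^sup>q\<close>. As \<open>I(s) - I(t)\<close> is
  about \<open>g(t) (\<mu>(s) - \<mu>(t))\<close>, the function \<open>I\<^sup>q\<^sup>+\<^sup>1/(q+1)\<close> decreases at least at the rate \<open>C g \<mu>\<close>. Integrating over
  all levels gives the claim, since the integral of \<open>g \<mu>\<close> is that of \<open>G(u)\<close>.\<close>

section \<open>The Brunn-Minkowski inequality for open sets\<close>

text \<open>The obstacle is regularity. A proof by the coarea formula would differentiate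
  \<open>\<mu>\<close> and integrate over level surfaces, and the field grad(F^n)(grad u) is only
  assumed differentiable at each point. Every estimate is therefore stated for a layer
  \<open>s \<le> v < t\<close> of positive thickness: volume integrals replace surface integrals,
  and the divergence theorem is derived from differentiability and a continuous divergence alone.
  The exponents come from one cancellation. Let A and B be the integrals of F(grad v) and F(grad
  v)^n over the layer. Jensen gives A^n \<le> (\<mu>(s) - \<mu>(t))^(n-1) B. Inserting the lower
  bound for A and the upper bound for B and dividing by t - s leaves n^n \<kappa> (\<mu>(t) (t -
  s))^(n-1) \<le> I(s) (\<mu>(s) - \<mu>(t))^(n-1), whose root of order n - 1 yields
  \<open>C\<close> and \<open>q\<close>. Euler's identity grad(F^n)(\<xi>) \<bullet> \<xi> = n
  F(\<xi>)^n absorbs the factor 1/n of the equation. One degenerate case needs separate care: if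
  I(t) = 0, the level t may still carry positive volume, and then g(t) must vanish.\<close>

lemma open_set_plus: "open (A + B)" if "open A" for A B :: "'a::euclidean_space set"
proof -
  have "A + B = (\<Union>x\<in>A. \<Union>y\<in>B. {x + y})" by (auto simp: set_plus_def)
  then show ?thesis using open_sums[of A B] that by simp
qed

lemma bounded_set_plus: "bounded (A + B)" if "bounded A" "bounded B" for A B :: "'a::euclidean_space set"
proof -
  have "A + B = (\<Union>x\<in>A. \<Union>y\<in>B. {x + y})" by (auto simp: set_plus_def)
  then show ?thesis using bounded_sums[OF that] by simp
qed

section \<open>Brunn-Minkowski for two boxes, from the inequality of means\<close>

lemma measure_lebesgue_box:
  "measure lebesgue (box a b) = (\<Prod>i\<in>Basis. max 0 ((b - a) \<bullet> i))" for a b :: "'a::euclidean_space"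
proof -
  have "measure lebesgue (box a b) = measure lborel (box a b)" by simp
  also have "\<dots> = (\<Prod>i\<in>Basis. max 0 ((b - a) \<bullet> i))"
  proof (cases "\<forall>i\<in>Basis. a \<bullet> i \<le> b \<bullet> i")
    case True
    then have "measure lborel (box a b) = (\<Prod>i\<in>Basis. (b - a) \<bullet> i)"
      unfolding measure_lborel_box_eq by (rule if_P)
    also have "\<dots> = (\<Prod>i\<in>Basis. max 0 ((b - a) \<bullet> i))"
      by (rule prod.cong) (use True in \<open>auto simp: inner_diff\<close>)
    finally show ?thesis .
  next
    case False
    then obtain i where "i \<in> Basis" "b \<bullet> i < a \<bullet> i" by (meson not_le)
    then have "(\<Prod>i\<in>Basis. max 0 ((b - a) \<bullet> i)) = 0"
      by (intro prod_zero bexI[of _ i]) (auto simp: inner_diff)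
    moreover have "box a b = {}"
      using \<open>i \<in> Basis\<close> \<open>b \<bullet> i < a \<bullet> i\<close> by (metis box_eq_empty(1) less_imp_le)
    ultimately show ?thesis by simp
  qed
  finally show ?thesis .
qed

lemma root_AM_GM:
  fixes x :: "'i \<Rightarrow> real"
  assumes "finite S" "S \<noteq> {}" "\<And>i. i \<in> S \<Longrightarrow> x i \<ge> 0"
  shows "root (card S) (\<Prod>i\<in>S. x i) \<le> (\<Sum>i\<in>S. x i) / card S"
proof -
  have "card S > 0" using assms by (simp add: card_gt_0_iff)
  then have "root (card S) (\<Prod>i\<in>S. x i) = (\<Prod>i\<in>S. x i) powr (1 / card S)"
    using prod_nonneg[of S x] assms(3)
    by (cases "(\<Prod>i\<in>S. x i) = 0") (auto simp: root_powr_inverse order_le_less)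
  then show ?thesis using arith_geom_mean[OF assms] by (simp add: sum_divide_distrib)
qed

text \<open>After division by the root on the right, the inequality of means applies to the ratios
  \<open>a i / (a i + b i)\<close> and to \<open>b i / (a i + b i)\<close>. The two ratios add up to
  1 for each \<open>i\<close>, hence so do the two averages. With side lengths for \<open>a\<close>
  and \<open>b\<close> this is Brunn-Minkowski for boxes.\<close>

lemma root_prod_add:
  fixes a b :: "'i \<Rightarrow> real"
  assumes S: "finite S" "S \<noteq> {}" and a: "\<And>i. i \<in> S \<Longrightarrow> a i > 0" and b: "\<And>i. i \<in> S \<Longrightarrow> b i > 0"
  shows "root (card S) (prod a S) + root (card S) (prod b S) \<le> root (card S) (\<Prod>i\<in>S. a i + b i)"
proof -
  let ?n = "card S" let ?P = "\<Prod>i\<in>S. a i + b i"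
  have n: "?n > 0" using S by (simp add: card_gt_0_iff)
  have P: "?P > 0" by (intro prod_pos) (simp add: a b add_pos_pos)
  have ne: "a i + b i \<noteq> 0" if "i \<in> S" for i using a[OF that] b[OF that] by simp
  have "root ?n (prod a S) / root ?n ?P + root ?n (prod b S) / root ?n ?P
    = root ?n (\<Prod>i\<in>S. a i / (a i + b i)) + root ?n (\<Prod>i\<in>S. b i / (a i + b i))"
    by (simp add: real_root_divide prod_dividef)
  also have "\<dots> \<le> (\<Sum>i\<in>S. a i / (a i + b i)) / ?n + (\<Sum>i\<in>S. b i / (a i + b i)) / ?n"
    by (intro add_mono root_AM_GM S) (auto intro!: divide_nonneg_nonneg simp: a b less_imp_le add_nonneg_nonneg)
  also have "\<dots> = (\<Sum>i\<in>S. a i / (a i + b i) + b i / (a i + b i)) / ?n"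
    by (simp add: sum.distrib add_divide_distrib)
  also have "(\<Sum>i\<in>S. a i / (a i + b i) + b i / (a i + b i)) = (\<Sum>i\<in>S. 1)"
    by (intro sum.cong) (use ne in \<open>auto simp: add_divide_distrib[symmetric]\<close>)
  also have "\<dots> / ?n = 1" using n by simp
  finally have "(root ?n (prod a S) + root ?n (prod b S)) / root ?n ?P \<le> 1"
    by (simp add: add_divide_distrib)
  then show ?thesis using P n by (simp add: divide_le_eq)
qed

text \<open>In each coordinate the point is divided in the ratio \<open>l i\<close> in which it cuts
  the sum interval, and the same ratio is used in both summands.\<close>

lemma box_plus_box:
  fixes a b c d :: "'a::euclidean_space"
  assumes "box a b \<noteq> {}" "box c d \<noteq> {}"
  shows "box (a + c) (b + d) \<subseteq> box a b + box c d"
proof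
  fix x assume x: "x \<in> box (a + c) (b + d)"
  have ab: "a \<bullet> i < b \<bullet> i" "c \<bullet> i < d \<bullet> i" if "i \<in> Basis" for i
    using assms that by (auto simp: box_ne_empty)
  define l where "l i = (x \<bullet> i - a \<bullet> i - c \<bullet> i) / (b \<bullet> i + d \<bullet> i - a \<bullet> i - c \<bullet> i)" for i
  have l: "0 < l i" "l i < 1" if "i \<in> Basis" for i
    using x ab[OF that] that by (auto simp: mem_box l_def inner_add divide_simps)
  define y where "y = (\<Sum>i\<in>Basis. (a \<bullet> i + l i * (b \<bullet> i - a \<bullet> i)) *\<^sub>R i)"
  have y: "y \<bullet> i = a \<bullet> i + l i * (b \<bullet> i - a \<bullet> i)" if "i \<in> Basis" for i
    using that by (simp add: y_def)
  have z: "(x - y) \<bullet> i = c \<bullet> i + l i * (d \<bullet> i - c \<bullet> i)" if "i \<in> Basis" for i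
  proof -
    have "l i * (b \<bullet> i + d \<bullet> i - a \<bullet> i - c \<bullet> i) = x \<bullet> i - a \<bullet> i - c \<bullet> i"
      using ab[OF that] by (simp add: l_def)
    then show ?thesis by (simp add: inner_diff y[OF that] algebra_simps)
  qed
  have conv: "p < p + t * (q - p)" "p + t * (q - p) < q" if "p < q" "0 < t" "t < 1" for p q t :: real
  proof -
    show "p < p + t * (q - p)" using that by simp
    have "t * (q - p) < 1 * (q - p)" using that by (intro mult_strict_right_mono) auto
    then show "p + t * (q - p) < q" by simp
  qed
  have "y \<in> box a b" using conv[OF ab(1) l] by (auto simp: mem_box y)
  moreover have "x - y \<in> box c d" using conv[OF ab(2) l] by (auto simp: mem_box z)
  ultimately have "y + (x - y) \<in> box a b + box c d" by (rule set_plus_intro)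
  then show "x \<in> box a b + box c d" by simp
qed

lemma brunn_minkowski_box:
  fixes a b c d :: "'a::euclidean_space"
  assumes "box a b \<noteq> {}" "box c d \<noteq> {}"
  shows "(root DIM('a) (measure lebesgue (box a b)) + root DIM('a) (measure lebesgue (box c d))) ^ DIM('a)
         \<le> measure lebesgue (box a b + box c d)"
proof -
  have ab: "a \<bullet> i < b \<bullet> i" "c \<bullet> i < d \<bullet> i" if "i \<in> Basis" for i
    using assms that by (auto simp: box_ne_empty)
  let ?r = "root DIM('a)"
  have "?r (\<Prod>i\<in>Basis. (b - a) \<bullet> i) + ?r (\<Prod>i\<in>Basis. (d - c) \<bullet> i)
      \<le> ?r (\<Prod>i\<in>(Basis::'a set). (b - a) \<bullet> i + (d - c) \<bullet> i)"
    using ab by (intro root_prod_add) (auto simp: inner_diff)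
  also have "(\<Prod>i\<in>(Basis::'a set). (b - a) \<bullet> i + (d - c) \<bullet> i) = measure lebesgue (box (a + c) (b + d))"
    unfolding measure_lebesgue_box using ab
    by (intro prod.cong refl) (simp add: inner_diff inner_add max_def less_imp_le not_le add_mono)
  also have "(\<Prod>i\<in>Basis. (b - a) \<bullet> i) = measure lebesgue (box a b)"
    unfolding measure_lebesgue_box using ab
    by (intro prod.cong refl) (simp add: inner_diff inner_add max_def less_imp_le not_le add_mono)
  also have "(\<Prod>i\<in>Basis. (d - c) \<bullet> i) = measure lebesgue (box c d)"
    unfolding measure_lebesgue_box using ab
    by (intro prod.cong refl) (simp add: inner_diff inner_add max_def less_imp_le not_le add_mono)
  finally have "(?r (measure lebesgue (box a b)) + ?r (measure lebesgue (box c d))) ^ DIM('a)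
     \<le> ?r (measure lebesgue (box (a + c) (b + d))) ^ DIM('a)"
    by (intro power_mono) (auto simp: real_root_ge_zero)
  also have "\<dots> = measure lebesgue (box (a + c) (b + d))" by simp
  also have "\<dots> \<le> measure lebesgue (box a b + box c d)"
    by (intro measure_mono_fmeasurable box_plus_box assms)
       (auto intro!: lmeasurable_open bounded_set_plus open_set_plus bounded_box)
  finally show ?thesis .
qed

section \<open>Cutting finite families of boxes by coordinate hyperplanes\<close>

lemma box_Int_halfspace_lt:
  fixes a b :: "'a::euclidean_space"
  assumes i: "i \<in> Basis"
  shows "box a b \<inter> {x. x \<bullet> i < t} = box a (\<Sum>j\<in>Basis. (if j = i then min (b \<bullet> i) t else b \<bullet> j) *\<^sub>R j)"
proof -
  have "x \<in> box a b \<and> x \<bullet> i < t \<longleftrightarrow>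
    (\<forall>j\<in>Basis. a \<bullet> j < x \<bullet> j \<and> x \<bullet> j < (if j = i then min (b \<bullet> i) t else b \<bullet> j))" for x
    unfolding mem_box if_distrib[of "\<lambda>v. _ < v"] min_less_iff_conj using i by (auto split: if_splits)
  then show ?thesis by (intro set_eqI) (simp add: mem_box)
qed

lemma box_Int_halfspace_gt:
  fixes a b :: "'a::euclidean_space"
  assumes i: "i \<in> Basis"
  shows "box a b \<inter> {x. t < x \<bullet> i} = box (\<Sum>j\<in>Basis. (if j = i then max (a \<bullet> i) t else a \<bullet> j) *\<^sub>R j) b"
proof -
  have "x \<in> box a b \<and> t < x \<bullet> i \<longleftrightarrow>
    (\<forall>j\<in>Basis. (if j = i then max (a \<bullet> i) t else a \<bullet> j) < x \<bullet> j \<and> x \<bullet> j < b \<bullet> j)" for x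
    unfolding mem_box if_distribR if_distrib[of "\<lambda>v. v < _"] max_less_iff_conj using i by (auto split: if_splits)
  then show ?thesis by (intro set_eqI) (simp add: mem_box)
qed

lemma open_halfspaces:
  "open {x. x \<bullet> i < t}" "open {x. t < x \<bullet> i}" for i :: "'a::euclidean_space"
  by (intro open_Collect_less continuous_intros)+

lemma measure_halfspace_split:
  fixes A :: "'a::euclidean_space set"
  assumes A: "open A" "bounded A" and i: "i \<in> Basis"
  shows "measure lebesgue A = measure lebesgue (A \<inter> {x. x \<bullet> i < t}) + measure lebesgue (A \<inter> {x. t < x \<bullet> i})"
proof -
  let ?L = "A \<inter> {x. x \<bullet> i < t}" and ?R = "A \<inter> {x. t < x \<bullet> i}"
  have m: "?L \<in> lmeasurable" "?R \<in> lmeasurable"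
    using A by (auto intro!: lmeasurable_open open_Int open_halfspaces bounded_Int)
  have "negligible {x::'a. x \<bullet> i = t}" using i by (rule negligible_standard_hyperplane)
  then have "negligible (A - (?L \<union> ?R) \<union> ((?L \<union> ?R) - A))"
    by (rule negligible_subset) auto
  moreover have "A \<in> lmeasurable" using A by (simp add: lmeasurable_open)
  ultimately have "measure lebesgue A = measure lebesgue (?L \<union> ?R)"
    using measure_negligible_symdiff by metis
  also have "\<dots> = measure lebesgue ?L + measure lebesgue ?R"
    by (intro measure_Un_AE AE_I2) (use m in auto)
  finally show ?thesis .
qed

lemma continuous_measure_box_halfspace:
  fixes a b :: "'a::euclidean_space"
  assumes "i \<in> Basis"
  shows "continuous_on UNIV (\<lambda>t. measure lebesgue (box a b \<inter> {x. x \<bullet> i < t}))"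
proof -
  have "continuous_on UNIV (\<lambda>t. if j = i then min (b \<bullet> i) t else b \<bullet> j)" for j
    by (cases "j = i") (auto intro!: continuous_intros)
  then have "continuous_on UNIV (\<lambda>t. \<Prod>j\<in>Basis. max 0 ((if j = i then min (b \<bullet> i) t else b \<bullet> j) - a \<bullet> j))"
    by (intro continuous_intros) auto
  also have "(\<lambda>t. \<Prod>j\<in>Basis. max 0 ((if j = i then min (b \<bullet> i) t else b \<bullet> j) - a \<bullet> j)) =
      (\<lambda>t. measure lebesgue (box a b \<inter> {x. x \<bullet> i < t}))"
    unfolding box_Int_halfspace_lt[OF assms] measure_lebesgue_box
    by (intro ext prod.cong refl) (simp add: inner_diff)
  finally show ?thesis .
qed

text \<open>Open boxes are used because an open half-space cuts an open box in an open box again, so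
  families are stable under cutting and only a null set on the hyperplane is lost. Nonemptiness
  makes the volume positive and the number of boxes a sensible induction measure.\<close>

definition box_family :: "'a::euclidean_space set set \<Rightarrow> bool" where
  "box_family \<D> \<longleftrightarrow> finite \<D> \<and> pairwise disjnt \<D> \<and> (\<forall>D\<in>\<D>. D \<noteq> {} \<and> (\<exists>a b. D = box a b))"

lemma box_family_Union:
  assumes "box_family \<D>"
  shows "open (\<Union>\<D>)" "bounded (\<Union>\<D>)"
proof -
  have "open D" "bounded D" if "D \<in> \<D>" for D
    using assms that unfolding box_family_def by (metis open_box bounded_box)+
  then show "open (\<Union>\<D>)" "bounded (\<Union>\<D>)"
    using assms by (auto simp: box_family_def)
qed

lemma box_family_pos:
  assumes "box_family \<D>" "\<D> \<noteq> {}"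
  shows "measure lebesgue (\<Union>\<D>) > 0"
proof -
  obtain D where D: "D \<in> \<D>" "D \<noteq> {}" using assms by (auto simp: box_family_def)
  have "open (\<Union>\<D>)" "bounded (\<Union>\<D>)" using box_family_Union assms by auto
  then have "\<not> negligible (\<Union>\<D>)" using D open_not_negligible by blast
  then show ?thesis
    using \<open>open (\<Union>\<D>)\<close> \<open>bounded (\<Union>\<D>)\<close>
    by (metis lmeasurable_open measure_nonneg negligible_iff_measure order_le_less)
qed

text \<open>The last claim drives the later induction: a box that misses \<open>H\<close>
  disappears, and no box is ever split into two members of the same family.\<close>

lemma box_family_cut:
  assumes "box_family \<D>" and H: "\<And>a b. \<exists>c d. box a b \<inter> H = box c d"
  defines "\<E> \<equiv> (\<lambda>D. D \<inter> H) ` {D\<in>\<D>. D \<inter> H \<noteq> {}}"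
  shows "box_family \<E>" "\<Union>\<E> = \<Union>\<D> \<inter> H" "card \<E> \<le> card \<D>" "\<exists>D\<in>\<D>. D \<inter> H = {} \<Longrightarrow> card \<E> < card \<D>"
proof -
  have fin: "finite \<D>" using assms by (simp add: box_family_def)
  show "\<Union>\<E> = \<Union>\<D> \<inter> H" by (auto simp: \<E>_def)
  show "box_family \<E>"
    unfolding box_family_def
  proof (intro conjI ballI)
    show "finite \<E>" using fin by (simp add: \<E>_def)
    show "pairwise disjnt \<E>"
      using assms(1) unfolding box_family_def pairwise_def disjnt_def \<E>_def by blast
    fix E assume "E \<in> \<E>"
    then obtain D where D: "D \<in> \<D>" "D \<inter> H \<noteq> {}" "E = D \<inter> H" by (auto simp: \<E>_def)
    show "E \<noteq> {}" using D by simp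
    show "\<exists>a b. E = box a b" using D H assms(1) unfolding box_family_def by metis
  qed
  have c: "card \<E> \<le> card {D\<in>\<D>. D \<inter> H \<noteq> {}}"
    unfolding \<E>_def by (intro card_image_le) (use fin in auto)
  also have "\<dots> \<le> card \<D>" by (intro card_mono) (use fin in auto)
  finally show "card \<E> \<le> card \<D>" .
  assume "\<exists>D\<in>\<D>. D \<inter> H = {}"
  then have "{D\<in>\<D>. D \<inter> H \<noteq> {}} \<subset> \<D>" by blast
  then show "card \<E> < card \<D>" using le_less_trans[OF c psubset_card_mono[OF fin]] by simp
qed

text \<open>The volume to the left of the hyperplane depends continuously on its position and grows
  from 0 to the total volume, so the intermediate value theorem applies.\<close>

lemma measure_box_family_cut_onto:
  fixes \<D> :: "'a::euclidean_space set set"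
  assumes \<D>: "box_family \<D>" and i: "i \<in> Basis" and l: "0 < l" "l < 1"
  obtains t where "measure lebesgue (\<Union>\<D> \<inter> {x. x \<bullet> i < t}) = l * measure lebesgue (\<Union>\<D>)"
proof -
  define f where "f t = measure lebesgue (\<Union>\<D> \<inter> {x. x \<bullet> i < t})" for t
  have f: "f t = (\<Sum>D\<in>\<D>. measure lebesgue (D \<inter> {x. x \<bullet> i < t}))" for t
  proof -
    have eq: "\<Union>\<D> \<inter> {x. x \<bullet> i < t} = (\<Union>D\<in>\<D>. D \<inter> {x. x \<bullet> i < t})" by auto
    show ?thesis
      unfolding f_def eq
    proof (rule measure_negligible_finite_Union_image)
      show "finite \<D>" using \<D> by (simp add: box_family_def)
      fix D assume "D \<in> \<D>"
      then obtain a b where "D = box a b" using \<D> unfolding box_family_def by meson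
      then show "D \<inter> {x. x \<bullet> i < t} \<in> lmeasurable"
        by (intro lmeasurable_open open_Int open_halfspaces bounded_Int) auto
    next
      have "D \<inter> {x. x \<bullet> i < t} \<inter> (E \<inter> {x. x \<bullet> i < t}) = {}" if "D \<in> \<D>" "E \<in> \<D>" "D \<noteq> E" for D E
        using \<D> that unfolding box_family_def pairwise_def disjnt_def by blast
      then show "pairwise (\<lambda>D E. negligible (D \<inter> {x. x \<bullet> i < t} \<inter> (E \<inter> {x. x \<bullet> i < t}))) \<D>"
        unfolding pairwise_def by simp
    qed
  qed
  have cont: "continuous_on {p..q} f" for p q
  proof -
    have "continuous_on UNIV (\<lambda>t. \<Sum>D\<in>\<D>. measure lebesgue (D \<inter> {x. x \<bullet> i < t}))"
    proof (intro continuous_on_sum)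
      fix D assume "D \<in> \<D>"
      then obtain a b where "D = box a b" using \<D> unfolding box_family_def by meson
      then show "continuous_on UNIV (\<lambda>t. measure lebesgue (D \<inter> {x. x \<bullet> i < t}))"
        using continuous_measure_box_halfspace[OF i] by simp
    qed
    then have "continuous_on UNIV f" by (simp add: f[abs_def])
    then show ?thesis by (rule continuous_on_subset) simp
  qed
  have "bounded (\<Union>\<D>)" using box_family_Union \<D> by auto
  then obtain M where M: "\<And>x. x \<in> \<Union>\<D> \<Longrightarrow> norm x \<le> M" by (auto simp: bounded_iff)
  have xi: "\<bar>x \<bullet> i\<bar> \<le> M" if "x \<in> \<Union>\<D>" for x
    using M[OF that] Basis_le_norm[OF i, of x] by linarith
  have "\<Union>\<D> \<inter> {x. x \<bullet> i < - \<bar>M\<bar> - 1} = {}" using xi by fastforce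
  then have f0: "f (- \<bar>M\<bar> - 1) = 0" by (simp only: f_def measure_empty)
  have "\<Union>\<D> \<inter> {x. x \<bullet> i < \<bar>M\<bar> + 1} = \<Union>\<D>" using xi by fastforce
  then have f1: "f (\<bar>M\<bar> + 1) = measure lebesgue (\<Union>\<D>)" by (simp only: f_def)
  have "\<exists>t. - \<bar>M\<bar> - 1 \<le> t \<and> t \<le> \<bar>M\<bar> + 1 \<and> f t = l * measure lebesgue (\<Union>\<D>)"
  proof (rule IVT')
    show "f (- \<bar>M\<bar> - 1) \<le> l * measure lebesgue (\<Union>\<D>)" using f0 l by simp
    show "l * measure lebesgue (\<Union>\<D>) \<le> f (\<bar>M\<bar> + 1)" using f1 l by (simp add: mult_left_le_one_le)
  qed (auto simp: cont)
  then show ?thesis using that by (auto simp: f_def)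
qed

text \<open>The second family is cut by a parallel hyperplane in the same volume ratio as the first. The
  sums of the left and of the right parts are then separated by a hyperplane, and since the ratios
  agree the two inequalities add up to the desired one.\<close>

lemma brunn_minkowski_family_cut:
  fixes \<A> \<B> :: "'a::euclidean_space set set"
  assumes \<A>: "box_family \<A>" and \<B>: "box_family \<B>" "\<B> \<noteq> {}"
    and i: "i \<in> Basis" and D: "D1 \<in> \<A>" "D1 \<subseteq> {x. x \<bullet> i < t}" "D2 \<in> \<A>" "D2 \<subseteq> {x. t < x \<bullet> i}"
    and IH: "\<And>\<A>' \<B>' :: 'a set set. box_family \<A>' \<Longrightarrow> \<A>' \<noteq> {} \<Longrightarrow> box_family \<B>' \<Longrightarrow> \<B>' \<noteq> {} \<Longrightarrow>
      card \<A>' + card \<B>' < card \<A> + card \<B> \<Longrightarrow>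
      (root DIM('a) (measure lebesgue (\<Union>\<A>')) + root DIM('a) (measure lebesgue (\<Union>\<B>'))) ^ DIM('a)
        \<le> measure lebesgue (\<Union>\<A>' + \<Union>\<B>')"
  shows "(root DIM('a) (measure lebesgue (\<Union>\<A>)) + root DIM('a) (measure lebesgue (\<Union>\<B>))) ^ DIM('a)
      \<le> measure lebesgue (\<Union>\<A> + \<Union>\<B>)"
proof -
  let ?n = "DIM('a)" let ?r = "root ?n"
  define L R where "L s = {x::'a. x \<bullet> i < s}" and "R s = {x::'a. s < x \<bullet> i}" for s
  have LR: "\<exists>c d. box a b \<inter> L s = box c d" "\<exists>c d. box a b \<inter> R s = box c d" for a b s
    unfolding L_def R_def box_Int_halfspace_lt[OF i] box_Int_halfspace_gt[OF i] by blast+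
  have DLR: "D1 \<inter> L t = D1" "D2 \<inter> R t = D2" "D1 \<inter> R t = {}" "D2 \<inter> L t = {}"
    using D by (auto simp: L_def R_def)
  have Dne: "D1 \<noteq> {}" "D2 \<noteq> {}" using \<A> D by (auto simp: box_family_def)
  define cut where "cut \<D> H = (\<lambda>D. D \<inter> H) ` {D\<in>\<D>. D \<inter> H \<noteq> {}}" for \<D> :: "'a set set" and H
  have cutL: "box_family (cut \<D> (L s))" "\<Union>(cut \<D> (L s)) = \<Union>\<D> \<inter> L s"
    "card (cut \<D> (L s)) \<le> card \<D>" "\<exists>D\<in>\<D>. D \<inter> L s = {} \<Longrightarrow> card (cut \<D> (L s)) < card \<D>"
    if "box_family \<D>" for \<D> s
    using box_family_cut[of \<D> "L s", OF that LR(1)] unfolding cut_def by auto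
  have cutR: "box_family (cut \<D> (R s))" "\<Union>(cut \<D> (R s)) = \<Union>\<D> \<inter> R s"
    "card (cut \<D> (R s)) \<le> card \<D>" "\<exists>D\<in>\<D>. D \<inter> R s = {} \<Longrightarrow> card (cut \<D> (R s)) < card \<D>"
    if "box_family \<D>" for \<D> s
    using box_family_cut[of \<D> "R s", OF that LR(2)] unfolding cut_def by auto
  have ne: "cut \<A> (L t) \<noteq> {}" "cut \<A> (R t) \<noteq> {}"
    using D DLR Dne unfolding cut_def by auto
  define a where "a = measure lebesgue (\<Union>\<A>)"
  define b where "b = measure lebesgue (\<Union>\<B>)"
  have pos: "a > 0" "b > 0" using box_family_pos[OF \<A>] box_family_pos[OF \<B>] D by (auto simp: a_def b_def)
  define l where "l = measure lebesgue (\<Union>\<A> \<inter> L t) / a"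
  have aL: "measure lebesgue (\<Union>\<A> \<inter> L t) = l * a" using pos by (simp add: l_def)
  have split: "measure lebesgue (\<Union>\<D>) = measure lebesgue (\<Union>\<D> \<inter> L s) + measure lebesgue (\<Union>\<D> \<inter> R s)"
    if "box_family \<D>" for \<D> s
    unfolding L_def R_def using box_family_Union[OF that] i by (rule measure_halfspace_split)
  have aR: "measure lebesgue (\<Union>\<A> \<inter> R t) = (1 - l) * a"
    using split[OF \<A>, of t] aL by (simp add: a_def algebra_simps)
  have "0 < l * a" "0 < (1 - l) * a"
    using box_family_pos[OF cutL(1)[OF \<A>] ne(1)] box_family_pos[OF cutR(1)[OF \<A>] ne(2)]
    by (simp_all add: cutL(2)[OF \<A>] cutR(2)[OF \<A>] aL aR)
  then have l: "0 < l" "l < 1" using pos by (simp_all add: zero_less_mult_iff)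
  obtain s where bL: "measure lebesgue (\<Union>\<B> \<inter> L s) = l * b"
    unfolding L_def b_def using measure_box_family_cut_onto[OF \<B>(1) i l] .
  have bR: "measure lebesgue (\<Union>\<B> \<inter> R s) = (1 - l) * b"
    using split[OF \<B>(1), of s] bL by (simp add: b_def algebra_simps)
  have ne': "cut \<B> (L s) \<noteq> {}" "cut \<B> (R s) \<noteq> {}"
  proof -
    have "measure lebesgue (\<Union>(cut \<B> (L s))) \<noteq> 0" "measure lebesgue (\<Union>(cut \<B> (R s))) \<noteq> 0"
      using l pos by (simp_all add: cutL(2)[OF \<B>(1)] cutR(2)[OF \<B>(1)] bL bR)
    then show "cut \<B> (L s) \<noteq> {}" "cut \<B> (R s) \<noteq> {}" by auto
  qed
  have scale: "(?r (m * a) + ?r (m * b)) ^ ?n = m * (?r a + ?r b) ^ ?n" if "m \<ge> 0" for m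
  proof -
    have "?r (m * a) + ?r (m * b) = ?r m * (?r a + ?r b)"
      by (simp add: real_root_mult algebra_simps)
    then show ?thesis using that by (simp add: power_mult_distrib)
  qed
  let ?S1 = "\<Union>\<A> \<inter> L t + \<Union>\<B> \<inter> L s" and ?S2 = "\<Union>\<A> \<inter> R t + \<Union>\<B> \<inter> R s"
  \<comment> \<open>The induction measure drops through \<open>\<A>\<close> alone: the left part
    loses \<open>D2\<close> and the right part loses \<open>D1\<close>, while the cuts of
    \<open>\<B>\<close> have at most \<open>card \<B>\<close> members.\<close>
  have "card (cut \<A> (L t)) < card \<A>" "card (cut \<A> (R t)) < card \<A>"
    using cutL(4)[OF \<A>] cutR(4)[OF \<A>] D DLR by blast+
  then have "card (cut \<A> (L t)) + card (cut \<B> (L s)) < card \<A> + card \<B>"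
    "card (cut \<A> (R t)) + card (cut \<B> (R s)) < card \<A> + card \<B>"
    using cutL(3)[OF \<B>(1), of s] cutR(3)[OF \<B>(1), of s] by linarith+
  note IH1 = IH[OF cutL(1)[where s = t, OF \<A>] ne(1) cutL(1)[where s = s, OF \<B>(1)] ne'(1) this(1)]
   and IH2 = IH[OF cutR(1)[where s = t, OF \<A>] ne(2) cutR(1)[where s = s, OF \<B>(1)] ne'(2) this(2)]
  have S1: "l * (?r a + ?r b) ^ ?n \<le> measure lebesgue ?S1"
    using IH1 l scale[of l] by (simp add: cutL(2)[OF \<A>] cutL(2)[OF \<B>(1)] aL bL)
  have S2: "(1 - l) * (?r a + ?r b) ^ ?n \<le> measure lebesgue ?S2"
    using IH2 l scale[of "1 - l"] by (simp add: cutR(2)[OF \<A>] cutR(2)[OF \<B>(1)] aR bR)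
  have op: "open (L s)" "open (R s)" for s unfolding L_def R_def by (rule open_halfspaces)+
  note U = box_family_Union[OF \<A>] box_family_Union[OF \<B>(1)]
  have lm: "?S1 \<in> lmeasurable" "?S2 \<in> lmeasurable" "\<Union>\<A> + \<Union>\<B> \<in> lmeasurable"
    by (intro lmeasurable_open bounded_set_plus open_set_plus open_Int op U bounded_Int disjI1)+
  have disj: "?S1 \<inter> ?S2 = {}"
  proof -
    have "x \<bullet> i < t + s" if "x \<in> ?S1" for x
      using that by (auto simp: L_def set_plus_def inner_add)
    moreover have "x \<bullet> i > t + s" if "x \<in> ?S2" for x
      using that by (auto simp: R_def set_plus_def inner_add)
    ultimately show ?thesis by (meson disjoint_iff less_asym)
  qed
  have "(?r a + ?r b) ^ ?n = l * (?r a + ?r b) ^ ?n + (1 - l) * (?r a + ?r b) ^ ?n"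
    by (simp add: algebra_simps)
  also have "\<dots> \<le> measure lebesgue ?S1 + measure lebesgue ?S2" using S1 S2 by simp
  also have "\<dots> = measure lebesgue (?S1 \<union> ?S2)"
    using measure_Un3[OF lm(1,2)] disj by simp
  also have "\<dots> \<le> measure lebesgue (\<Union>\<A> + \<Union>\<B>)"
    using lm by (intro measure_mono_fmeasurable) (auto simp: set_plus_def)
  finally show ?thesis by (simp add: a_def b_def)
qed

text \<open>Products of intervals can be disjoint only if the intervals are disjoint in some
  coordinate; an endpoint then serves as \<open>t\<close>.\<close>

lemma disjoint_boxes_separated:
  fixes D E :: "'a::euclidean_space set"
  assumes "D = box a b" "E = box c d" "D \<noteq> {}" "E \<noteq> {}" "D \<inter> E = {}"
  obtains i t where "i \<in> Basis" "D \<subseteq> {x. x \<bullet> i < t} \<and> E \<subseteq> {x. t < x \<bullet> i} \<or> E \<subseteq> {x. x \<bullet> i < t} \<and> D \<subseteq> {x. t < x \<bullet> i}"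
proof -
  obtain i where i: "i \<in> Basis" and "b \<bullet> i \<le> a \<bullet> i \<or> d \<bullet> i \<le> c \<bullet> i \<or> b \<bullet> i \<le> c \<bullet> i \<or> d \<bullet> i \<le> a \<bullet> i"
    using assms disjoint_interval(4)[of a b c d] by blast
  moreover have "a \<bullet> i < b \<bullet> i" "c \<bullet> i < d \<bullet> i" using assms i by (auto simp: box_ne_empty)
  ultimately consider "b \<bullet> i \<le> c \<bullet> i" | "d \<bullet> i \<le> a \<bullet> i" by linarith
  then show ?thesis
  proof cases
    case 1
    then have "D \<subseteq> {x. x \<bullet> i < b \<bullet> i}" "E \<subseteq> {x. b \<bullet> i < x \<bullet> i}" using i assms by (force simp: mem_box)+
    then show ?thesis using that i by blast
  next
    case 2
    then have "E \<subseteq> {x. x \<bullet> i < d \<bullet> i}" "D \<subseteq> {x. d \<bullet> i < x \<bullet> i}" using i assms by (force simp: mem_box)+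
    then show ?thesis using that i by blast
  qed
qed

lemma brunn_minkowski_family_step:
  fixes \<A> \<B> :: "'a::euclidean_space set set"
  assumes \<A>: "box_family \<A>" "card \<A> \<ge> 2" and \<B>: "box_family \<B>" "\<B> \<noteq> {}"
    and IH: "\<And>\<A>' \<B>' :: 'a set set. box_family \<A>' \<Longrightarrow> \<A>' \<noteq> {} \<Longrightarrow> box_family \<B>' \<Longrightarrow> \<B>' \<noteq> {} \<Longrightarrow>
      card \<A>' + card \<B>' < card \<A> + card \<B> \<Longrightarrow>
      (root DIM('a) (measure lebesgue (\<Union>\<A>')) + root DIM('a) (measure lebesgue (\<Union>\<B>'))) ^ DIM('a)
        \<le> measure lebesgue (\<Union>\<A>' + \<Union>\<B>')"
  shows "(root DIM('a) (measure lebesgue (\<Union>\<A>)) + root DIM('a) (measure lebesgue (\<Union>\<B>))) ^ DIM('a)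
      \<le> measure lebesgue (\<Union>\<A> + \<Union>\<B>)"
proof -
  obtain D E where DE: "D \<in> \<A>" "E \<in> \<A>" "D \<noteq> E"
    using \<A>(2) by (metis card_le_Suc0_iff_eq card.infinite not_less_eq_eq numeral_2_eq_2 zero_le not_numeral_le_zero)
  then obtain a b c d where "D = box a b" "E = box c d" "D \<noteq> {}" "E \<noteq> {}" "D \<inter> E = {}"
    using \<A>(1) unfolding box_family_def pairwise_def disjnt_def by metis
  then obtain i t where i: "i \<in> Basis"
    and *: "D \<subseteq> {x. x \<bullet> i < t} \<and> E \<subseteq> {x. t < x \<bullet> i} \<or> E \<subseteq> {x. x \<bullet> i < t} \<and> D \<subseteq> {x. t < x \<bullet> i}"
    by (rule disjoint_boxes_separated)
  from * show ?thesis
  proof (elim disjE conjE)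
    assume "D \<subseteq> {x. x \<bullet> i < t}" "E \<subseteq> {x. t < x \<bullet> i}"
    then show ?thesis using brunn_minkowski_family_cut[OF \<A>(1) \<B> i DE(1) _ DE(2) _ IH] by blast
  next
    assume "E \<subseteq> {x. x \<bullet> i < t}" "D \<subseteq> {x. t < x \<bullet> i}"
    then show ?thesis using brunn_minkowski_family_cut[OF \<A>(1) \<B> i DE(2) _ DE(1) _ IH] by blast
  qed
qed

text \<open>This is the Hadwiger-Ohmann argument: induction on the total number of boxes, cutting
  whichever family has at least two. The sum of sets is commutative, so one cutting step serves both
  families, and two single boxes are the base case.\<close>

lemma brunn_minkowski_family:
  fixes \<A> \<B> :: "'a::euclidean_space set set"
  assumes "box_family \<A>" "\<A> \<noteq> {}" "box_family \<B>" "\<B> \<noteq> {}"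
  shows "(root DIM('a) (measure lebesgue (\<Union>\<A>)) + root DIM('a) (measure lebesgue (\<Union>\<B>))) ^ DIM('a)
      \<le> measure lebesgue (\<Union>\<A> + \<Union>\<B>)"
  using assms
proof (induction "card \<A> + card \<B>" arbitrary: \<A> \<B> rule: less_induct)
  case less
  have fin: "finite \<A>" "finite \<B>" using less.prems by (auto simp: box_family_def)
  then have c: "card \<A> \<ge> 1" "card \<B> \<ge> 1" using less.prems by (simp_all add: Suc_le_eq card_gt_0_iff)
  consider "card \<A> \<ge> 2" | "card \<B> \<ge> 2" | "card \<A> = 1" "card \<B> = 1" using c by linarith
  then show ?case
  proof cases
    case 1
    show ?thesis
      by (rule brunn_minkowski_family_step[OF less.prems(1) 1 less.prems(3,4)], rule less.hyps)
  next
    case 2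
    have "(root DIM('a) (measure lebesgue (\<Union>\<B>)) + root DIM('a) (measure lebesgue (\<Union>\<A>))) ^ DIM('a)
      \<le> measure lebesgue (\<Union>\<B> + \<Union>\<A>)"
    proof (rule brunn_minkowski_family_step[OF less.prems(3) 2 less.prems(1,2)])
      fix \<B>' \<A>' :: "'a set set"
      assume "box_family \<B>'" "\<B>' \<noteq> {}" "box_family \<A>'" "\<A>' \<noteq> {}" "card \<B>' + card \<A>' < card \<B> + card \<A>"
      then show "(root DIM('a) (measure lebesgue (\<Union>\<B>')) + root DIM('a) (measure lebesgue (\<Union>\<A>'))) ^ DIM('a)
        \<le> measure lebesgue (\<Union>\<B>' + \<Union>\<A>')"
        using less.hyps[of \<A>' \<B>'] by (simp add: add.commute)
    qed
    then show ?thesis by (simp add: add.commute)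
  next
    case 3
    obtain A where A: "\<A> = {A}" using card_1_singletonE[OF 3(1)] .
    obtain B where B: "\<B> = {B}" using card_1_singletonE[OF 3(2)] .
    have ne: "A \<noteq> {}" "B \<noteq> {}" using less.prems unfolding box_family_def A B by auto
    obtain a b where a: "A = box a b" using less.prems(1) unfolding box_family_def A by auto
    obtain c d where c: "B = box c d" using less.prems(3) unfolding box_family_def B by auto
    show ?thesis using brunn_minkowski_box[of a b c d] ne by (simp add: A B a c)
  qed
qed

text \<open>An open set is a countable union of nonoverlapping closed boxes, and by continuity from
  below finitely many of them already carry almost all of its volume.\<close>

lemma open_box_family_approx:
  fixes U :: "'a::euclidean_space set"
  assumes U: "open U" "bounded U" "U \<noteq> {}" and e: "e > 0"
  obtains \<D> where "box_family \<D>" "\<D> \<noteq> {}" "\<Union>\<D> \<subseteq> U" "measure lebesgue U - e < measure lebesgue (\<Union>\<D>)"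
proof -
  obtain a b where ab: "U \<subseteq> cbox a b" using bounded_subset_cbox_symmetric[OF U(2)] by blast
  have "interior U \<subseteq> interior (cbox a b)" using ab by (rule interior_mono)
  then have ne: "box a b \<noteq> {}" using U by (auto simp: interior_open interior_cbox)
  \<comment> \<open>Each tile of the covering lemma lies in \<open>g x\<close> for some
    \<open>x\<close> in \<open>U\<close>, so this gauge forces every tile to lie inside
    \<open>U\<close>.\<close>
  define g where "g x = (if x \<in> U then U else UNIV)" for x
  have "gauge g" using U by (auto simp: gauge_def g_def)
  from covering_lemma[OF ab ne this] obtain \<D> where \<D>: "countable \<D>" "\<Union>\<D> \<subseteq> cbox a b"
    "\<And>K. K \<in> \<D> \<Longrightarrow> interior K \<noteq> {} \<and> (\<exists>c d. K = cbox c d)"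
    "pairwise (\<lambda>A B. interior A \<inter> interior B = {}) \<D>"
    "\<And>K. K \<in> \<D> \<Longrightarrow> \<exists>x\<in>U \<inter> K. K \<subseteq> g x" "U \<subseteq> \<Union>\<D>" by metis
  have "K \<subseteq> U" if "K \<in> \<D>" for K using \<D>(5)[OF that] by (auto simp: g_def)
  then have UD: "U = \<Union>\<D>" using \<D>(6) by blast
  have Dne: "\<D> \<noteq> {}" using UD U by auto
  define f where "f = from_nat_into \<D>"
  have rf: "range f = \<D>" unfolding f_def using range_from_nat_into[OF Dne \<D>(1)] .
  define W where "W k = \<Union>(f ` {..k})" for k :: nat
  have fm: "f k \<in> lmeasurable" for k
  proof -
    have "f k \<in> \<D>" using rf by blast
    then show ?thesis using \<D>(3) by (metis lmeasurable_cbox)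
  qed
  have WU: "(\<Union>k. W k) = U" unfolding UD rf[symmetric] W_def by auto
  have "(\<lambda>k. measure lebesgue (W k)) \<longlonglongrightarrow> measure lebesgue (\<Union>k. W k)"
  proof (rule Lim_measure_incseq)
    show "range W \<subseteq> sets lebesgue" unfolding W_def using fm by auto
    show "incseq W" unfolding W_def incseq_def by fastforce
    show "emeasure lebesgue (\<Union>k. W k) \<noteq> \<infinity>"
      unfolding WU using lmeasurable_open[OF U(2,1)] by (auto simp: fmeasurable_def)
  qed
  then have "eventually (\<lambda>k. measure lebesgue U - e < measure lebesgue (W k)) sequentially"
    unfolding WU using e by (intro order_tendstoD(1)) auto
  then obtain k where k: "measure lebesgue U - e < measure lebesgue (W k)"
    by (auto simp: eventually_sequentially)
  \<comment> \<open>Interiors turn the nonoverlapping tiles into disjoint open boxes; only their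
    null frontiers are given up.\<close>
  define \<E> where "\<E> = interior ` f ` {..k}"
  have f\<D>: "f j \<in> \<D>" for j using rf by blast
  have "box_family \<E>"
    unfolding box_family_def
  proof (intro conjI ballI)
    show "finite \<E>" by (simp add: \<E>_def)
    show "pairwise disjnt \<E>"
      using \<D>(4) f\<D> unfolding \<E>_def pairwise_def disjnt_def by (metis imageE)
    fix D assume "D \<in> \<E>"
    then obtain j where j: "D = interior (f j)" by (auto simp: \<E>_def)
    show "D \<noteq> {}" using \<D>(3)[OF f\<D>] j by blast
    show "\<exists>a b. D = box a b" using \<D>(3)[OF f\<D>, of j] j by (metis interior_cbox)
  qed
  moreover have "\<E> \<noteq> {}" by (auto simp: \<E>_def)
  moreover have "\<Union>\<E> \<subseteq> U" unfolding \<E>_def UD using f\<D> interior_subset by fastforce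
  moreover have "measure lebesgue (\<Union>\<E>) = measure lebesgue (W k)"
  proof -
    have "negligible (f j - interior (f j))" for j
      using \<D>(3)[OF f\<D>, of j] by (metis Diff_subset frontier_cbox negligible_frontier_interval interior_cbox)
    then have "negligible (\<Union>j\<in>{..k}. f j - interior (f j))" by (intro negligible_Union) auto
    then have "negligible (W k - \<Union>\<E> \<union> (\<Union>\<E> - W k))"
      by (rule negligible_subset) (use interior_subset in \<open>fastforce simp: W_def \<E>_def\<close>)
    moreover have "W k \<in> lmeasurable" unfolding W_def using fm by (intro fmeasurable.finite_UN) auto
    ultimately show ?thesis using measure_negligible_symdiff by blast
  qed
  ultimately show ?thesis using that k by metis
qed

proposition brunn_minkowski_open:
  fixes A B :: "'a::euclidean_space set"
  assumes A: "open A" "bounded A" "A \<noteq> {}" and B: "open B" "bounded B" "B \<noteq> {}"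
  shows "(root DIM('a) (measure lebesgue A) + root DIM('a) (measure lebesgue B)) ^ DIM('a)
      \<le> measure lebesgue (A + B)"
proof -
  let ?n = "DIM('a)" let ?r = "root ?n"
  define e where "e k = 1 / real (Suc k)" for k
  have e: "e k > 0" for k by (simp add: e_def)
  have e0: "e \<longlonglongrightarrow> 0" unfolding e_def[abs_def] using LIMSEQ_inverse_real_of_nat by (simp add: inverse_eq_divide)
  \<comment> \<open>The truncation at 0 keeps the roots nonnegative, as monotonicity of the power
    requires, and disappears in the limit.\<close>
  have "(?r (max 0 (measure lebesgue A - e k)) + ?r (max 0 (measure lebesgue B - e k))) ^ ?n
    \<le> measure lebesgue (A + B)" for k
  proof -
    obtain \<D> where D: "box_family \<D>" "\<D> \<noteq> {}" "\<Union>\<D> \<subseteq> A" "measure lebesgue A - e k < measure lebesgue (\<Union>\<D>)"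
      using open_box_family_approx[OF A e] by metis
    obtain \<E> where E: "box_family \<E>" "\<E> \<noteq> {}" "\<Union>\<E> \<subseteq> B" "measure lebesgue B - e k < measure lebesgue (\<Union>\<E>)"
      using open_box_family_approx[OF B e] by metis
    have "(?r (max 0 (measure lebesgue A - e k)) + ?r (max 0 (measure lebesgue B - e k))) ^ ?n
      \<le> (?r (measure lebesgue (\<Union>\<D>)) + ?r (measure lebesgue (\<Union>\<E>))) ^ ?n"
      using D E by (intro power_mono add_mono real_root_le_mono add_nonneg_nonneg real_root_ge_zero) auto
    also have "\<dots> \<le> measure lebesgue (\<Union>\<D> + \<Union>\<E>)" using D E by (intro brunn_minkowski_family)
    also have "\<dots> \<le> measure lebesgue (A + B)"
    proof (rule measure_mono_fmeasurable)
      show "\<Union>\<D> + \<Union>\<E> \<subseteq> A + B" using D E by (intro set_plus_mono2)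
      show "\<Union>\<D> + \<Union>\<E> \<in> sets lebesgue" by (intro fmeasurableD lmeasurable_open bounded_set_plus open_set_plus box_family_Union D(1) E(1))
      show "A + B \<in> lmeasurable" using A B by (intro lmeasurable_open bounded_set_plus open_set_plus)
    qed
    finally show ?thesis .
  qed
  moreover have "(\<lambda>k. (?r (max 0 (measure lebesgue A - e k)) + ?r (max 0 (measure lebesgue B - e k))) ^ ?n)
    \<longlonglongrightarrow> (?r (max 0 (measure lebesgue A - 0)) + ?r (max 0 (measure lebesgue B - 0))) ^ ?n"
    by (intro tendsto_intros e0)
  ultimately show ?thesis
    by (intro LIMSEQ_le_const2) (auto simp: max_absorb2)
qed

section \<open>The divergence theorem for differentiable fields\<close>

text \<open>Coordinates are halved one at a time, so that additivity of \<open>P\<close> across a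
  single hyperplane is all that is used. \<open>B\<close> collects the coordinates already halved;
  at each stage a half on which \<open>P\<close> fails is kept.\<close>

lemma cube_halve_coordinates:
  fixes P :: "'a::euclidean_space set \<Rightarrow> bool"
  assumes split: "\<And>a b k c. k \<in> Basis \<Longrightarrow> P (cbox a b \<inter> {x. x \<bullet> k \<le> c}) \<Longrightarrow>
      P (cbox a b \<inter> {x. c \<le> x \<bullet> k}) \<Longrightarrow> P (cbox a b)"
    and "h > 0" and "\<not> P (cbox p (p + h *\<^sub>R One))"
    and "finite B" "B \<subseteq> Basis"
  shows "\<exists>a. \<not> P (cbox a (a + (\<Sum>i\<in>Basis. (if i \<in> B then h / 2 else h) *\<^sub>R i))) \<and>
      cbox a (a + (\<Sum>i\<in>Basis. (if i \<in> B then h / 2 else h) *\<^sub>R i)) \<subseteq> cbox p (p + h *\<^sub>R One)"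
  using assms(4,5)
proof (induction B rule: finite_induct)
  case empty
  have "(\<Sum>i\<in>Basis. h *\<^sub>R i) = h *\<^sub>R (One::'a)" by (simp add: scaleR_sum_right)
  then show ?case using assms(3) by auto
next
  case (insert k B)
  then have k: "k \<in> Basis" by simp
  define s where "s B = (\<Sum>i\<in>Basis. (if i \<in> B then h / 2 else h) *\<^sub>R i)" for B :: "'a set"
  have s: "s B \<bullet> i = (if i \<in> B then h / 2 else h)" if "i \<in> Basis" for i B
    using that by (simp add: s_def)
  from insert obtain a where a: "\<not> P (cbox a (a + s B))" "cbox a (a + s B) \<subseteq> cbox p (p + h *\<^sub>R One)"
    by (auto simp: s_def)
  let ?c = "a \<bullet> k + h / 2"
  have 1: "cbox a (a + s B) \<inter> {x. x \<bullet> k \<le> ?c} = cbox a (a + s (insert k B))"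
  proof (intro set_eqI)
    fix x
    have "(\<forall>i\<in>Basis. a \<bullet> i \<le> x \<bullet> i \<and> x \<bullet> i \<le> (a + s B) \<bullet> i) \<and> x \<bullet> k \<le> ?c \<longleftrightarrow>
       (\<forall>i\<in>Basis. a \<bullet> i \<le> x \<bullet> i \<and> x \<bullet> i \<le> (a + s (insert k B)) \<bullet> i)" (is "?l \<longleftrightarrow> ?r")
    proof
      assume ?l
      then show ?r using k insert(2) \<open>h > 0\<close> by (auto simp: inner_add s)
    next
      assume r: ?r
      have "x \<bullet> k \<le> ?c" using r[THEN bspec, OF k] k by (simp add: inner_add s)
      moreover have "x \<bullet> i \<le> (a + s B) \<bullet> i" if "i \<in> Basis" for i
        using r[THEN bspec, OF that] that \<open>h > 0\<close> by (auto simp: inner_add s split: if_splits)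
      ultimately show ?l using r by blast
    qed
    then show "x \<in> cbox a (a + s B) \<inter> {x. x \<bullet> k \<le> ?c} \<longleftrightarrow> x \<in> cbox a (a + s (insert k B))"
      by (simp add: mem_box)
  qed
  have 2: "cbox a (a + s B) \<inter> {x. ?c \<le> x \<bullet> k} = cbox (a + (h / 2) *\<^sub>R k) (a + (h / 2) *\<^sub>R k + s (insert k B))"
  proof (intro set_eqI)
    fix x
    have "(\<forall>i\<in>Basis. a \<bullet> i \<le> x \<bullet> i \<and> x \<bullet> i \<le> (a + s B) \<bullet> i) \<and> ?c \<le> x \<bullet> k \<longleftrightarrow>
       (\<forall>i\<in>Basis. (a + (h / 2) *\<^sub>R k) \<bullet> i \<le> x \<bullet> i \<and> x \<bullet> i \<le> (a + (h / 2) *\<^sub>R k + s (insert k B)) \<bullet> i)" (is "?l \<longleftrightarrow> ?r")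
    proof
      assume l: ?l
      show ?r
      proof
        fix i :: 'a assume i: "i \<in> Basis"
        show "(a + (h / 2) *\<^sub>R k) \<bullet> i \<le> x \<bullet> i \<and> x \<bullet> i \<le> (a + (h / 2) *\<^sub>R k + s (insert k B)) \<bullet> i"
          using l[THEN conjunct1, THEN bspec, OF i] l i k insert(2)
          by (cases "i = k") (auto simp: inner_add s inner_Basis)
      qed
    next
      assume r: ?r
      have "a \<bullet> i \<le> x \<bullet> i \<and> x \<bullet> i \<le> (a + s B) \<bullet> i" if i: "i \<in> Basis" for i
        using r[THEN bspec, OF i] i k insert(2) \<open>h > 0\<close>
        by (cases "i = k") (auto simp: inner_add s inner_Basis)
      moreover have "?c \<le> x \<bullet> k" using r[THEN bspec, OF k] k by (simp add: inner_add)
      ultimately show ?l by blast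
    qed
    then show "x \<in> cbox a (a + s B) \<inter> {x. ?c \<le> x \<bullet> k} \<longleftrightarrow>
        x \<in> cbox (a + (h / 2) *\<^sub>R k) (a + (h / 2) *\<^sub>R k + s (insert k B))"
      by (simp add: mem_box)
  qed
  have "\<not> P (cbox a (a + s (insert k B))) \<or> \<not> P (cbox (a + (h / 2) *\<^sub>R k) (a + (h / 2) *\<^sub>R k + s (insert k B)))"
    using split[OF k, of a "a + s B" ?c] a(1) unfolding 1 2 by blast
  then show ?case
    unfolding s_def[symmetric] using a(2) 1 2 by blast
qed

text \<open>If \<open>P\<close> failed on the cube, halving all sides repeatedly would give nested
  cubes on which it fails. They have a common point \<open>x\<close>, and once their side is below
  the radius belonging to \<open>x\<close> the local hypothesis is contradicted.\<close>

lemma cube_bisection: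
  fixes P :: "'a::euclidean_space set \<Rightarrow> bool"
  assumes split: "\<And>a b k c. k \<in> Basis \<Longrightarrow> P (cbox a b \<inter> {x. x \<bullet> k \<le> c}) \<Longrightarrow>
      P (cbox a b \<inter> {x. c \<le> x \<bullet> k}) \<Longrightarrow> P (cbox a b)"
    and loc: "\<And>x. \<exists>r>0. \<forall>p h. 0 < h \<and> h < r \<and> x \<in> cbox p (p + h *\<^sub>R One) \<longrightarrow> P (cbox p (p + h *\<^sub>R One))"
    and h: "h > 0"
  shows "P (cbox p (p + h *\<^sub>R One))"
proof (rule ccontr)
  assume nP: "\<not> P (cbox p (p + h *\<^sub>R One))"
  define Q where "Q n q = cbox q (q + (h / 2 ^ n) *\<^sub>R One)" for n and q :: 'a
  have "\<exists>f. \<forall>n. \<not> P (Q n (f n)) \<and> Q (Suc n) (f (Suc n)) \<subseteq> Q n (f n)"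
  proof (rule dependent_nat_choice)
    show "\<exists>q. \<not> P (Q 0 q)" using nP by (auto simp: Q_def)
    fix q n assume "\<not> P (Q n q)"
    then have "\<exists>a. \<not> P (cbox a (a + (\<Sum>i\<in>Basis. (if i \<in> Basis then h / 2 ^ n / 2 else h / 2 ^ n) *\<^sub>R i))) \<and>
      cbox a (a + (\<Sum>i\<in>Basis. (if i \<in> Basis then h / 2 ^ n / 2 else h / 2 ^ n) *\<^sub>R i)) \<subseteq> cbox q (q + (h / 2 ^ n) *\<^sub>R One)"
      unfolding Q_def using h by (intro cube_halve_coordinates split) auto
    moreover have "(\<Sum>i\<in>Basis. (if i \<in> Basis then h / 2 ^ n / 2 else h / 2 ^ n) *\<^sub>R i) = (h / 2 ^ Suc n) *\<^sub>R (One::'a)"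
      by (simp add: scaleR_sum_right mult.commute)
    ultimately show "\<exists>y. \<not> P (Q (Suc n) y) \<and> Q (Suc n) y \<subseteq> Q n q"
      unfolding Q_def by simp
  qed
  then obtain f where f: "\<And>n. \<not> P (Q n (f n))" "\<And>n. Q (Suc n) (f (Suc n)) \<subseteq> Q n (f n)" by blast
  have "\<Inter>(range (\<lambda>n. Q n (f n))) \<noteq> {}"
  proof (rule compact_nest)
    show "Q n (f n) \<noteq> {}" for n using h by (simp add: Q_def box_ne_empty inner_add)
    show "Q n (f n) \<subseteq> Q m (f m)" if "m \<le> n" for m n
      using lift_Suc_antimono_le[of "\<lambda>n. Q n (f n)"] f(2) that by auto
  qed (simp add: Q_def)
  then obtain x where x: "\<And>n. x \<in> Q n (f n)" by auto
  obtain r where r: "r > 0" "\<And>p h. 0 < h \<Longrightarrow> h < r \<Longrightarrow> x \<in> cbox p (p + h *\<^sub>R One) \<Longrightarrow> P (cbox p (p + h *\<^sub>R One))"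
    using loc[of x] by blast
  have "(\<lambda>n. h * (1 / 2) ^ n) \<longlonglongrightarrow> h * 0" by (intro tendsto_intros LIMSEQ_power_zero) auto
  then have "eventually (\<lambda>n. h * (1 / 2) ^ n < r) sequentially" using r(1) by (intro order_tendstoD(2)) auto
  then obtain n where "h / 2 ^ n < r" by (auto simp: eventually_sequentially power_divide)
  then have "P (Q n (f n))" using r(2)[of "h / 2 ^ n" "f n"] x[of n] h by (simp add: Q_def)
  then show False using f(1) by blast
qed

section \<open>Local comparison of the divergence with difference quotients\<close>

lemma content_slab:
  fixes p q :: "'a::euclidean_space"
  assumes i: "i \<in> Basis" and h: "h > 0" "d > 0"
    and q: "q = p + h *\<^sub>R One + (d - h) *\<^sub>R i"
  shows "measure lborel (cbox p q) = d * h ^ (DIM('a) - 1)"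
proof -
  have qp: "(q - p) \<bullet> j = (if j = i then d else h)" if "j \<in> Basis" for j
    using that i by (auto simp: q inner_diff inner_add inner_Basis)
  have "\<forall>j\<in>Basis. p \<bullet> j \<le> q \<bullet> j"
    using qp h by (metis diff_ge_0_iff_ge inner_diff_left less_imp_le)
  then have "measure lborel (cbox p q) = (\<Prod>j\<in>Basis. (q - p) \<bullet> j)" by (simp add: content_cbox inner_diff)
  also have "\<dots> = (\<Prod>j\<in>Basis. if j = i then d else h)" using qp by (intro prod.cong) auto
  also have "\<dots> = d * h ^ (DIM('a) - 1)"
    using i by (subst prod.remove[of _ i]) (auto simp: card_Diff_singleton)
  finally show ?thesis .
qed

text \<open>Translation by \<open>d\<close> along \<open>i\<close> cancels everything except two end
  slabs of thickness \<open>d\<close>. The bound is thus proportional to \<open>d\<close>, so it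
  survives division by \<open>d\<close> uniformly, with no derivative of \<open>f\<close>
  involved.\<close>

lemma integral_cube_shift_diff:
  fixes f :: "'a::euclidean_space \<Rightarrow> real"
  assumes f: "continuous_on UNIV f" and i: "i \<in> Basis" and d: "0 < d" "d \<le> h"
    and M: "\<And>y. y \<in> cbox p (p + h *\<^sub>R One + d *\<^sub>R i) \<Longrightarrow> \<bar>f y\<bar> \<le> M"
  shows "\<bar>integral (cbox p (p + h *\<^sub>R One)) (\<lambda>y. f (y + d *\<^sub>R i) - f y)\<bar> \<le> 2 * M * d * h ^ (DIM('a) - 1)"
proof -
  let ?q = "p + h *\<^sub>R One :: 'a"
  let ?Q = "cbox p (?q + d *\<^sub>R i)"
  have int: "f integrable_on cbox a b" for a b
    by (intro integrable_continuous continuous_on_subset[OF f]) simp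
  have int': "(\<lambda>y. f (y + d *\<^sub>R i)) integrable_on cbox a b" for a b
    by (intro integrable_continuous continuous_on_compose2[OF f]) (auto intro!: continuous_intros)
  \<comment> \<open>The elongated box is decomposed twice: at the far face of the cube (1, 2) and at
    the near face of its translate (3, 4). Equating the two decompositions leaves the slabs.\<close>
  have 1: "?Q \<inter> {x. x \<bullet> i \<le> ?q \<bullet> i} = cbox p ?q"
  proof (intro set_eqI)
    fix x
    have "x \<bullet> j \<le> (?q + d *\<^sub>R i) \<bullet> j" if "x \<bullet> j \<le> ?q \<bullet> j" "j \<in> Basis" for j
      using that d i by (auto simp: inner_add inner_Basis)
    moreover have "x \<bullet> j \<le> ?q \<bullet> j" if "x \<bullet> j \<le> (?q + d *\<^sub>R i) \<bullet> j" "j \<in> Basis" "x \<bullet> i \<le> ?q \<bullet> i" for j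
      using that d i by (cases "j = i") (auto simp: inner_add inner_Basis)
    ultimately show "x \<in> ?Q \<inter> {x. x \<bullet> i \<le> ?q \<bullet> i} \<longleftrightarrow> x \<in> cbox p ?q"
      unfolding Int_iff mem_box mem_Collect_eq using i by meson
  qed
  have 2: "?Q \<inter> {x. ?q \<bullet> i \<le> x \<bullet> i} = cbox (p + h *\<^sub>R i) (?q + d *\<^sub>R i)"
  proof (intro set_eqI)
    fix x
    have "(p + h *\<^sub>R i) \<bullet> j = (if j = i then ?q \<bullet> i else p \<bullet> j)" if "j \<in> Basis" for j
      using that i by (auto simp: inner_add inner_Basis)
    moreover have "p \<bullet> i \<le> ?q \<bullet> i" using d i by (simp add: inner_add)
    ultimately show "x \<in> ?Q \<inter> {x. ?q \<bullet> i \<le> x \<bullet> i} \<longleftrightarrow> x \<in> cbox (p + h *\<^sub>R i) (?q + d *\<^sub>R i)"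
      unfolding Int_iff mem_box mem_Collect_eq using i by (smt (verit))
  qed
  have 3: "?Q \<inter> {x. x \<bullet> i \<le> p \<bullet> i + d} = cbox p (?q + (d - h) *\<^sub>R i)"
  proof (intro set_eqI)
    fix x
    have "(?q + (d - h) *\<^sub>R i) \<bullet> j = (if j = i then p \<bullet> i + d else ?q \<bullet> j)"
      "(?q + d *\<^sub>R i) \<bullet> j = (if j = i then ?q \<bullet> i + d else ?q \<bullet> j)" if "j \<in> Basis" for j
      using that i by (auto simp: inner_add inner_Basis)
    moreover have "p \<bullet> i \<le> ?q \<bullet> i" using d i by (simp add: inner_add)
    ultimately show "x \<in> ?Q \<inter> {x. x \<bullet> i \<le> p \<bullet> i + d} \<longleftrightarrow> x \<in> cbox p (?q + (d - h) *\<^sub>R i)"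
      unfolding Int_iff mem_box mem_Collect_eq using i by (smt (verit))
  qed
  have 4: "?Q \<inter> {x. p \<bullet> i + d \<le> x \<bullet> i} = cbox (p + d *\<^sub>R i) (?q + d *\<^sub>R i)"
  proof (intro set_eqI)
    fix x
    have "(p + d *\<^sub>R i) \<bullet> j = (if j = i then p \<bullet> i + d else p \<bullet> j)" if "j \<in> Basis" for j
      using that i by (auto simp: inner_add inner_Basis)
    then show "x \<in> ?Q \<inter> {x. p \<bullet> i + d \<le> x \<bullet> i} \<longleftrightarrow> x \<in> cbox (p + d *\<^sub>R i) (?q + d *\<^sub>R i)"
      unfolding Int_iff mem_box mem_Collect_eq using i d by (smt (verit))
  qed
  have split: "integral ?Q f = integral (?Q \<inter> {x. x \<bullet> i \<le> c}) f + integral (?Q \<inter> {x. c \<le> x \<bullet> i}) f" for c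
    using has_integral_split[OF _ _ i, of f "integral (?Q \<inter> {x. x \<bullet> i \<le> c}) f" p "?q + d *\<^sub>R i" c
        "integral (?Q \<inter> {x. c \<le> x \<bullet> i}) f"] int i
    by (metis integrable_integral integrable_split integral_unique)
  have slab1: "\<bar>integral (cbox (p + h *\<^sub>R i) (?q + d *\<^sub>R i)) f\<bar> \<le> M * (d * h ^ (DIM('a) - 1))"
  proof -
    have "norm (integral (cbox (p + h *\<^sub>R i) (?q + d *\<^sub>R i)) f) \<le> M * measure lborel (cbox (p + h *\<^sub>R i) (?q + d *\<^sub>R i))"
    proof (rule integrable_bound[OF _ int])
      show "norm (f x) \<le> M" if "x \<in> cbox (p + h *\<^sub>R i) (?q + d *\<^sub>R i)" for x
        using M[of x] that 2 by auto
      show "0 \<le> M" using M[of p] d i by (auto simp: mem_box inner_add inner_Basis)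
    qed
    also have "measure lborel (cbox (p + h *\<^sub>R i) (?q + d *\<^sub>R i)) = d * h ^ (DIM('a) - 1)"
      by (rule content_slab[OF i]) (use d in \<open>auto simp: algebra_simps\<close>)
    finally show ?thesis by simp
  qed
  have slab2: "\<bar>integral (cbox p (?q + (d - h) *\<^sub>R i)) f\<bar> \<le> M * (d * h ^ (DIM('a) - 1))"
  proof -
    have "norm (integral (cbox p (?q + (d - h) *\<^sub>R i)) f) \<le> M * measure lborel (cbox p (?q + (d - h) *\<^sub>R i))"
    proof (rule integrable_bound[OF _ int])
      show "norm (f x) \<le> M" if "x \<in> cbox p (?q + (d - h) *\<^sub>R i)" for x
        using M[of x] that 3 by auto
      show "0 \<le> M" using M[of p] d i by (auto simp: mem_box inner_add inner_Basis)
    qed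
    also have "measure lborel (cbox p (?q + (d - h) *\<^sub>R i)) = d * h ^ (DIM('a) - 1)"
      by (rule content_slab[OF i]) (use d in \<open>auto simp: algebra_simps\<close>)
    finally show ?thesis by simp
  qed
  have "integral (cbox p ?q) (\<lambda>y. f (y + d *\<^sub>R i) - f y)
      = integral (cbox p ?q) (\<lambda>y. f (y + d *\<^sub>R i)) - integral (cbox p ?q) f"
    by (intro integral_diff int int')
  also have "integral (cbox p ?q) (\<lambda>y. f (y + d *\<^sub>R i)) = integral (cbox (p + d *\<^sub>R i) (?q + d *\<^sub>R i)) f"
    using integral_shift_cbox[of "p + d *\<^sub>R i" "d *\<^sub>R i" "?q + d *\<^sub>R i" f] by simp
  also have "\<dots> - integral (cbox p ?q) f
     = integral (cbox (p + h *\<^sub>R i) (?q + d *\<^sub>R i)) f - integral (cbox p (?q + (d - h) *\<^sub>R i)) f"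
    using split[of "?q \<bullet> i"] split[of "p \<bullet> i + d"] unfolding 1 2 3 4 by linarith
  finally show ?thesis using slab1 slab2 by linarith
qed

lemma cube_mem_norm:
  fixes p x y :: "'a::euclidean_space"
  assumes "x \<in> cbox p (p + h *\<^sub>R One)" "y \<in> cbox p (p + h *\<^sub>R One + d *\<^sub>R i)" "i \<in> Basis" "0 \<le> d" "d \<le> h"
  shows "norm (y - x) \<le> (real DIM('a) + 1) * h"
proof -
  have xi: "p \<bullet> j \<le> x \<bullet> j" "x \<bullet> j \<le> p \<bullet> j + h" if "j \<in> Basis" for j
    using assms(1) that by (auto simp: mem_box inner_add)
  have yi: "p \<bullet> j \<le> y \<bullet> j" "y \<bullet> j \<le> p \<bullet> j + h + (if j = i then d else 0)" if "j \<in> Basis" for j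
    using assms(2,3) that by (auto simp: mem_box inner_add inner_Basis)
  have "norm (y - x) \<le> (\<Sum>j\<in>Basis. \<bar>(y - x) \<bullet> j\<bar>)" by (rule norm_le_l1)
  also have "\<dots> \<le> (\<Sum>j\<in>Basis. h + (if j = i then d else 0))"
  proof (rule sum_mono)
    fix j :: 'a assume j: "j \<in> Basis"
    show "\<bar>(y - x) \<bullet> j\<bar> \<le> h + (if j = i then d else 0)"
      using xi[OF j] yi[OF j] assms(4,5) by (auto simp: inner_diff abs_le_iff)
  qed
  also have "\<dots> = DIM('a) * h + d" using assms(3) by (simp add: sum.distrib)
  finally show ?thesis using assms(5) by (simp add: algebra_simps)
qed

text \<open>The field is only assumed differentiable with continuous divergence, so its partial derivatives
  need not be integrable. As in Goursat's lemma one bisects cubes. Fluxes through faces are avoided: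
  the divergence is compared with the difference quotient \<open>dq d\<close>, whose integral over the whole space
  vanishes by translation invariance.\<close>

context
  fixes W :: "'a::euclidean_space \<Rightarrow> 'a" and W' :: "'a \<Rightarrow> 'a \<Rightarrow> 'a"
  assumes W': "\<And>x. (W has_derivative W' x) (at x)"
    and div_cont: "continuous_on UNIV (\<lambda>x. \<Sum>i\<in>Basis. W' x i \<bullet> i)"
begin

definition dq :: "real \<Rightarrow> 'a \<Rightarrow> real" where
  "dq d x = (\<Sum>i\<in>Basis. (W (x + d *\<^sub>R i) - W x) \<bullet> i / d)"

lemma continuous_W: "continuous_on S W"
  using W' by (meson continuous_at_imp_continuous_on has_derivative_continuous)

lemma continuous_dq: "continuous_on S (dq d)" if "d > 0"
  unfolding dq_def using that
  by (intro continuous_intros continuous_on_compose2[OF continuous_W[of UNIV]] continuous_W) auto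

text \<open>The point is uniformity in \<open>d \<le> h\<close>: differentiability at the single
  point \<open>x\<close> makes the remainder \<open>R\<close> of order \<open>e' * h\<close> on a
  cube of side \<open>h\<close>, and the slab estimate turns this into an error of order
  \<open>e' * h ^ DIM('a)\<close> whatever \<open>d\<close> is.\<close>

lemma dq_integral_local:
  assumes e: "e > 0"
  obtains r where "r > 0"
    "\<And>p h d. 0 < d \<Longrightarrow> d \<le> h \<Longrightarrow> h < r \<Longrightarrow> x \<in> cbox p (p + h *\<^sub>R One) \<Longrightarrow>
      \<bar>integral (cbox p (p + h *\<^sub>R One)) (\<lambda>y. dq d y - (\<Sum>i\<in>Basis. W' y i \<bullet> i))\<bar>
        \<le> e * measure lborel (cbox p (p + h *\<^sub>R One))"
proof -
  define D where "D y = (\<Sum>i\<in>Basis. W' y i \<bullet> i)" for y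
  let ?n = "real DIM('a)"
  \<comment> \<open>Each coordinate contributes \<open>2 * e' * (?n + 1) * h ^ DIM('a)\<close>, and
    there are \<open>?n\<close> of them, which makes half of the admissible error. Continuity of
    \<open>D\<close> at \<open>x\<close> uses the other half.\<close>
  define e' where "e' = e / (4 * ?n * (?n + 1))"
  have n: "?n > 0" by simp
  have e': "e' > 0" using e n unfolding e'_def by (intro divide_pos_pos mult_pos_pos) auto
  have lin: "linear (W' x)" using W'[of x] has_derivative_linear by blast
  define R where "R y = W y - W x - W' x (y - x)" for y
  obtain r1 where r1: "r1 > 0" "\<And>y. norm (y - x) < r1 \<Longrightarrow> norm (R y) \<le> e' * norm (y - x)"
    using W'[of x] e' unfolding has_derivative_at_alt R_def by blast
  have "isCont D x" using div_cont unfolding D_def by (simp add: continuous_on_eq_continuous_at)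
  then obtain r2 where r2: "r2 > 0" "\<And>y. norm (y - x) < r2 \<Longrightarrow> \<bar>D y - D x\<bar> < e / 2"
    using e unfolding continuous_at_eps_delta dist_norm real_norm_def by (metis half_gt_zero)
  define r where "r = min r1 r2 / (?n + 1)"
  have r: "r > 0" using r1 r2 n unfolding r_def by (intro divide_pos_pos) auto
  have "\<bar>integral (cbox p (p + h *\<^sub>R One)) (\<lambda>y. dq d y - D y)\<bar> \<le> e * measure lborel (cbox p (p + h *\<^sub>R One))"
    if d: "0 < d" "d \<le> h" and h: "h < r" and x: "x \<in> cbox p (p + h *\<^sub>R One)" for p h d
  proof -
    let ?Q = "cbox p (p + h *\<^sub>R One)"
    have h0: "h > 0" using d by simp
    have hr: "(?n + 1) * h < min r1 r2" using h n unfolding r_def by (simp add: less_divide_eq mult.commute)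
    have content: "measure lborel ?Q = h ^ DIM('a)"
      using h0 by (subst content_cbox) (auto simp: inner_add)
    have small: "norm (y - x) \<le> (?n + 1) * h" if "y \<in> cbox p (p + h *\<^sub>R One + d *\<^sub>R i)" "i \<in> Basis" for y i
      using cube_mem_norm[OF x that] d by (simp add: add.commute)
    have Rb: "norm (R y) \<le> e' * ((?n + 1) * h)" if "y \<in> cbox p (p + h *\<^sub>R One + d *\<^sub>R i)" "i \<in> Basis" for y i
    proof -
      have "norm (R y) \<le> e' * norm (y - x)" using r1(2)[of y] small[OF that] hr by simp
      also have "\<dots> \<le> e' * ((?n + 1) * h)" using e' small[OF that] by (intro mult_left_mono) auto
      finally show ?thesis .
    qed
    have Rc: "continuous_on S (\<lambda>y. R y \<bullet> i)" for i S
      unfolding R_def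
      by (intro continuous_intros continuous_W linear_continuous_on_compose[OF _ lin])
    have Rc': "continuous_on S (\<lambda>y. R (y + d *\<^sub>R i) \<bullet> i)" for i S
      by (rule continuous_on_compose2[OF Rc[of UNIV]]) (auto intro!: continuous_intros)
    have Dc: "continuous_on S D" for S
      unfolding D_def using div_cont by (rule continuous_on_subset) simp
    \<comment> \<open>The affine part of \<open>W\<close> at \<open>x\<close> has exact difference
      quotients \<open>W' x i\<close> for every \<open>d\<close>; their trace is \<open>D x\<close>,
      so only the quotients of \<open>R\<close> remain to be estimated.\<close>
    have split: "dq d y - D y = (\<Sum>i\<in>Basis. (R (y + d *\<^sub>R i) \<bullet> i - R y \<bullet> i) / d) + (D x - D y)" for y
    proof -
      have "(R (y + d *\<^sub>R i) \<bullet> i - R y \<bullet> i) / d = (W (y + d *\<^sub>R i) - W y) \<bullet> i / d - W' x i \<bullet> i" if "i \<in> Basis" for i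
      proof -
        have "W' x (y + d *\<^sub>R i - x) = W' x (y - x) + d *\<^sub>R W' x i"
          using linear_add[OF lin, of "y - x" "d *\<^sub>R i"] linear_scale[OF lin, of d i]
          by (simp add: algebra_simps)
        then have "R (y + d *\<^sub>R i) \<bullet> i - R y \<bullet> i = (W (y + d *\<^sub>R i) - W y) \<bullet> i - d * (W' x i \<bullet> i)"
          by (simp add: R_def inner_diff inner_add algebra_simps)
        then show ?thesis using d by (simp add: diff_divide_distrib)
      qed
      then have "(\<Sum>i\<in>Basis. (R (y + d *\<^sub>R i) \<bullet> i - R y \<bullet> i) / d) = dq d y - D x"
        by (simp add: dq_def D_def sum_subtractf)
      then show ?thesis by simp
    qed
    have comp: "\<bar>integral ?Q (\<lambda>y. (R (y + d *\<^sub>R i) \<bullet> i - R y \<bullet> i) / d)\<bar> \<le> 2 * e' * (?n + 1) * h ^ DIM('a)"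
      if i: "i \<in> Basis" for i
    proof -
      have "integral ?Q (\<lambda>y. (R (y + d *\<^sub>R i) \<bullet> i - R y \<bullet> i) / d) = integral ?Q (\<lambda>y. R (y + d *\<^sub>R i) \<bullet> i - R y \<bullet> i) / d"
        by simp
      moreover have "\<bar>integral ?Q (\<lambda>y. R (y + d *\<^sub>R i) \<bullet> i - R y \<bullet> i)\<bar> \<le> d * (2 * e' * (?n + 1) * h ^ DIM('a))"
      proof -
        have "\<bar>integral ?Q (\<lambda>y. R (y + d *\<^sub>R i) \<bullet> i - R y \<bullet> i)\<bar>
          \<le> 2 * (e' * ((?n + 1) * h)) * d * h ^ (DIM('a) - 1)"
        proof -
          have vec: "\<bar>R y \<bullet> i\<bar> \<le> e' * ((?n + 1) * h)" if "y \<in> cbox p (p + h *\<^sub>R One + d *\<^sub>R i)" for y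
            using Rb[OF that i] Basis_le_norm[OF i, of "R y"] by linarith
          have "\<bar>integral ?Q (\<lambda>y. (\<lambda>y. R y \<bullet> i) (y + d *\<^sub>R i) - (\<lambda>y. R y \<bullet> i) y)\<bar>
            \<le> 2 * (e' * ((?n + 1) * h)) * d * h ^ (DIM('a) - 1)"
            by (rule integral_cube_shift_diff[OF Rc i d]) (rule vec)
          then show ?thesis by simp
        qed
        also have "\<dots> = d * (2 * e' * (?n + 1) * (h * h ^ (DIM('a) - 1)))" by (simp only: mult_ac)
        also have "h * h ^ (DIM('a) - 1) = h ^ DIM('a)"
          by (metis DIM_positive power_eq_if less_numeral_extra(3))
        finally show ?thesis .
      qed
      ultimately show ?thesis using d by (simp add: divide_le_eq mult.commute)
    qed
    have dint: "(\<lambda>y. (R (y + d *\<^sub>R i) \<bullet> i - R y \<bullet> i) / d) integrable_on ?Q" for i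
      using d by (intro integrable_continuous continuous_intros Rc Rc') auto
    have "\<bar>integral ?Q (\<lambda>y. D x - D y)\<bar> \<le> e / 2 * measure lborel ?Q"
    proof -
      have "norm (integral ?Q (\<lambda>y. D x - D y)) \<le> e / 2 * measure lborel ?Q"
      proof (rule integrable_bound)
        fix y assume y: "y \<in> ?Q"
        obtain i :: 'a where i: "i \<in> Basis" using nonempty_Basis by blast
        have "y \<in> cbox p (p + h *\<^sub>R One + d *\<^sub>R i)"
          using y i d by (auto simp: mem_box inner_add inner_Basis intro: order_trans)
        then have "norm (y - x) < r2" using small[OF _ i] hr by fastforce
        then show "norm (D x - D y) \<le> e / 2" using r2(2)[of y] by (simp add: abs_minus_commute)
      qed (use e Dc in \<open>auto intro!: integrable_continuous continuous_intros\<close>)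
      then show ?thesis by simp
    qed
    moreover have "\<bar>integral ?Q (\<lambda>y. \<Sum>i\<in>Basis. (R (y + d *\<^sub>R i) \<bullet> i - R y \<bullet> i) / d)\<bar> \<le> e / 2 * measure lborel ?Q"
    proof -
      have "integral ?Q (\<lambda>y. \<Sum>i\<in>Basis. (R (y + d *\<^sub>R i) \<bullet> i - R y \<bullet> i) / d)
        = (\<Sum>i\<in>Basis. integral ?Q (\<lambda>y. (R (y + d *\<^sub>R i) \<bullet> i - R y \<bullet> i) / d))"
        by (intro integral_sum dint) simp
      then have "\<bar>integral ?Q (\<lambda>y. \<Sum>i\<in>Basis. (R (y + d *\<^sub>R i) \<bullet> i - R y \<bullet> i) / d)\<bar>
        \<le> (\<Sum>i\<in>(Basis::'a set). \<bar>integral ?Q (\<lambda>y. (R (y + d *\<^sub>R i) \<bullet> i - R y \<bullet> i) / d)\<bar>)"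
        by (simp only: sum_abs)
      also have "\<dots> \<le> (\<Sum>i\<in>(Basis::'a set). 2 * e' * (?n + 1) * h ^ DIM('a))" by (intro sum_mono comp)
      also have "\<dots> = e / 2 * measure lborel ?Q"
      proof -
        have e4: "e = e' * (4 * ?n * (?n + 1))" using n by (simp add: e'_def add_pos_pos less_imp_neq[symmetric])
        show ?thesis unfolding content by (subst e4) (simp add: algebra_simps)
      qed
      finally show ?thesis .
    qed
    moreover have "integral ?Q (\<lambda>y. dq d y - D y) = integral ?Q (\<lambda>y. \<Sum>i\<in>Basis. (R (y + d *\<^sub>R i) \<bullet> i - R y \<bullet> i) / d)
       + integral ?Q (\<lambda>y. D x - D y)"
      unfolding split
    proof (rule integral_add)
      show "(\<lambda>y. \<Sum>i\<in>Basis. (R (y + d *\<^sub>R i) \<bullet> i - R y \<bullet> i) / d) integrable_on ?Q"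
        by (intro integrable_sum dint) simp
      show "(\<lambda>y. D x - D y) integrable_on ?Q"
        by (intro integrable_continuous continuous_on_diff continuous_on_const Dc)
    qed
    ultimately show ?thesis by linarith
  qed
  then show ?thesis using that r unfolding D_def by blast
qed

text \<open>On a large cube the integral of \<open>dq d\<close> is 0, while bisection shows that for
  small \<open>d\<close> it differs from that of the divergence by at most \<open>e\<close> times
  the volume. Letting \<open>e\<close> be arbitrary leaves 0.\<close>

proposition integral_divergence_eq_0:
  assumes supp: "\<And>x. norm x > b \<Longrightarrow> W x = 0"
  shows "((\<lambda>x. \<Sum>i\<in>Basis. W' x i \<bullet> i) has_integral 0) UNIV"
proof -
  define D where "D y = (\<Sum>i\<in>Basis. W' y i \<bullet> i)" for y
  \<comment> \<open>The margin 2 keeps the support inside the cube after a translation by any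
    \<open>d \<le> 1\<close>.\<close>
  define m where "m = \<bar>b\<bar> + 2"
  define p :: 'a where "p = - (m *\<^sub>R One)"
  define Q where "Q = cbox p (p + (2 * m) *\<^sub>R One)"
  have m: "m > 0" by (simp add: m_def)
  have Dc: "continuous_on S D" for S
    unfolding D_def using div_cont by (rule continuous_on_subset) simp
  have Qin: "x \<in> cbox (p + d *\<^sub>R i) (p + (2 * m) *\<^sub>R One + d *\<^sub>R i)"
    if "norm x \<le> b" "i \<in> Basis" "0 \<le> d" "d \<le> 1" for x i d
  proof -
    have "\<bar>x \<bullet> j\<bar> \<le> b" if "j \<in> Basis" for j using Basis_le_norm[OF that, of x] \<open>norm x \<le> b\<close> by linarith
    then have "\<bar>x \<bullet> j\<bar> \<le> m - 2" if "j \<in> Basis" for j using that unfolding m_def by fastforce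
    then have "- m + 1 \<le> x \<bullet> j" "x \<bullet> j \<le> m" if "j \<in> Basis" for j using that by fastforce+
    moreover have "(d *\<^sub>R i) \<bullet> j = (if j = i then d else 0)" if "j \<in> Basis" for j
      using that \<open>i \<in> Basis\<close> by (simp add: inner_Basis)
    moreover have "p \<bullet> j = - m" "(p + (2 * m) *\<^sub>R One) \<bullet> j = m" if "j \<in> Basis" for j
      using that by (simp_all add: p_def inner_add inner_diff)
    ultimately show ?thesis
      unfolding mem_box inner_add_left[of _ "d *\<^sub>R i"] using that(3,4) m by (smt (verit))
  qed
  obtain i0 :: 'a where i0: "i0 \<in> Basis" using nonempty_Basis by blast
  have D0: "D x = 0" if "norm x > b" for x
  proof -
    have "open {x::'a. norm x > b}" by (intro open_Collect_less continuous_intros)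
    then have "(W has_derivative (\<lambda>_. 0)) (at x)"
      by (rule has_derivative_transform_within_open[OF has_derivative_const[of 0]]) (use that supp in auto)
    then have "W' x = (\<lambda>_. 0)" using W'[of x] has_derivative_unique by blast
    then show ?thesis by (simp add: D_def)
  qed
  have dq0: "integral Q (dq d) = 0" if d: "0 < d" "d \<le> 1" for d
  proof -
    have int: "(\<lambda>y. W y \<bullet> i) integrable_on cbox a c" "(\<lambda>y. W (y + d *\<^sub>R i) \<bullet> i) integrable_on cbox a c" for i a c
      by (intro integrable_continuous continuous_intros continuous_W continuous_on_compose2[OF continuous_W[of UNIV]]; simp)+
    have restr: "integral S (\<lambda>y. W y \<bullet> i) = integral UNIV (\<lambda>y. W y \<bullet> i)" if "\<And>x. norm x \<le> b \<Longrightarrow> x \<in> S" for S i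
    proof -
      have "(\<lambda>y. if y \<in> S then W y \<bullet> i else 0) = (\<lambda>y. W y \<bullet> i)" using supp that by (metis inner_zero_left not_le)
      then show ?thesis using integral_restrict_UNIV[of S "\<lambda>y. W y \<bullet> i"] by simp
    qed
    have "integral Q (\<lambda>y. W (y + d *\<^sub>R i) \<bullet> i) = integral Q (\<lambda>y. W y \<bullet> i)" if i: "i \<in> Basis" for i
    proof -
      have "integral Q (\<lambda>y. W (y + d *\<^sub>R i) \<bullet> i) = integral (cbox (p + d *\<^sub>R i) (p + (2 * m) *\<^sub>R One + d *\<^sub>R i)) (\<lambda>y. W y \<bullet> i)"
        using integral_shift_cbox[of "p + d *\<^sub>R i" "d *\<^sub>R i" "p + (2 * m) *\<^sub>R One + d *\<^sub>R i" "\<lambda>y. W y \<bullet> i"]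
        by (simp add: Q_def)
      also have "\<dots> = integral UNIV (\<lambda>y. W y \<bullet> i)" using Qin i d by (intro restr) auto
      also have "\<dots> = integral Q (\<lambda>y. W y \<bullet> i)" unfolding Q_def using Qin[of _ i 0] i by (intro restr[symmetric]) auto
      finally show ?thesis .
    qed
    then have "(\<Sum>i\<in>Basis. (integral Q (\<lambda>y. W (y + d *\<^sub>R i) \<bullet> i) - integral Q (\<lambda>y. W y \<bullet> i)) / d) = 0"
      by simp
    moreover have "integral Q (dq d) = (\<Sum>i\<in>Basis. (integral Q (\<lambda>y. W (y + d *\<^sub>R i) \<bullet> i) - integral Q (\<lambda>y. W y \<bullet> i)) / d)"
    proof -
      have "integral Q (dq d) = integral Q (\<lambda>y. \<Sum>i\<in>Basis. (W (y + d *\<^sub>R i) \<bullet> i - W y \<bullet> i) / d)"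
        by (simp add: dq_def[abs_def] inner_diff)
      also have "\<dots> = (\<Sum>i\<in>Basis. integral Q (\<lambda>y. (W (y + d *\<^sub>R i) \<bullet> i - W y \<bullet> i) / d))"
        unfolding Q_def by (intro integral_sum integrable_on_divide integrable_diff int) auto
      also have "\<dots> = (\<Sum>i\<in>Basis. (integral Q (\<lambda>y. W (y + d *\<^sub>R i) \<bullet> i) - integral Q (\<lambda>y. W y \<bullet> i)) / d)"
        unfolding Q_def by (simp add: integral_diff[OF int(2) int(1)])
      finally show ?thesis .
    qed
    ultimately show ?thesis by simp
  qed
  have bound: "\<bar>integral Q D\<bar> \<le> e * measure lborel Q" if e: "e > 0" for e
  proof -
    \<comment> \<open>How small \<open>d\<close> must be depends on the cube. An eventual statement
      can be combined over the two halves, and the error bound is additive because it is a multiple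
      of the volume.\<close>
    define P where "P S \<longleftrightarrow> (\<forall>\<^sub>F d in at_right 0. \<bar>integral S (\<lambda>y. dq d y - D y)\<bar> \<le> e * measure lborel S)" for S
    have "P Q"
      unfolding Q_def
    proof (rule cube_bisection)
      fix a b :: 'a and k c assume k: "k \<in> Basis" and P: "P (cbox a b \<inter> {x. x \<bullet> k \<le> c})" "P (cbox a b \<inter> {x. c \<le> x \<bullet> k})"
      have "\<forall>\<^sub>F d::real in at_right 0. d > 0" by (simp add: eventually_at_right_less)
      with P[unfolded P_def] show "P (cbox a b)"
        unfolding P_def
      proof eventually_elim
        case (elim d)
        have int: "(\<lambda>y. dq d y - D y) integrable_on cbox a b"
          using elim by (intro integrable_continuous continuous_intros continuous_dq Dc)
        have "integral (cbox a b) (\<lambda>y. dq d y - D y) = integral (cbox a b \<inter> {x. x \<bullet> k \<le> c}) (\<lambda>y. dq d y - D y)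
          + integral (cbox a b \<inter> {x. c \<le> x \<bullet> k}) (\<lambda>y. dq d y - D y)"
          by (intro integral_unique has_integral_split[OF _ _ k, of _ _ a b c] integrable_integral integrable_split int k)
        moreover have "e * measure lborel (cbox a b) = e * measure lborel (cbox a b \<inter> {x. x \<bullet> k \<le> c})
            + e * measure lborel (cbox a b \<inter> {x. c \<le> x \<bullet> k})"
          using content_split[OF k, of a b c] by (simp add: distrib_left)
        ultimately show ?case using elim(1,2) by linarith
      qed
    next
      fix x
      obtain r where r: "r > 0" "\<And>p h d. 0 < d \<Longrightarrow> d \<le> h \<Longrightarrow> h < r \<Longrightarrow> x \<in> cbox p (p + h *\<^sub>R One) \<Longrightarrow>
        \<bar>integral (cbox p (p + h *\<^sub>R One)) (\<lambda>y. dq d y - D y)\<bar> \<le> e * measure lborel (cbox p (p + h *\<^sub>R One))"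
        unfolding D_def using dq_integral_local[OF e, of x] by blast
      have "P (cbox p (p + h *\<^sub>R One))" if h: "0 < h" "h < r" "x \<in> cbox p (p + h *\<^sub>R One)" for p h
      proof -
        have "\<forall>\<^sub>F d in at_right 0. d \<in> {0<..<h}" using h by (intro eventually_at_right_real)
        then show ?thesis unfolding P_def by eventually_elim (use r(2) h in auto)
      qed
      then show "\<exists>r>0. \<forall>p h. 0 < h \<and> h < r \<and> x \<in> cbox p (p + h *\<^sub>R One) \<longrightarrow> P (cbox p (p + h *\<^sub>R One))"
        using r(1) by blast
    qed (use m in simp)
    moreover have "\<forall>\<^sub>F d::real in at_right 0. d \<in> {0<..<1}" by (intro eventually_at_right_real) simp
    ultimately have "\<forall>\<^sub>F d::real in at_right 0. \<bar>integral Q D\<bar> \<le> e * measure lborel Q"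
      unfolding P_def
    proof eventually_elim
      case (elim d)
      have "integral Q (\<lambda>y. dq d y - D y) = integral Q (dq d) - integral Q D"
        using elim unfolding Q_def by (intro integral_diff integrable_continuous continuous_dq Dc) auto
      then show ?case using elim dq0[of d] by simp
    qed
    then show ?thesis by simp
  qed
  have "integral Q D = 0"
  proof (rule ccontr)
    assume ne: "integral Q D \<noteq> 0"
    have c: "measure lborel Q > 0" using bound[of 1] ne measure_nonneg[of lborel Q] by linarith
    have "\<bar>integral Q D\<bar> \<le> \<bar>integral Q D\<bar> / (2 * measure lborel Q) * measure lborel Q"
      using ne c by (intro bound divide_pos_pos) auto
    then show False using c ne by (simp add: field_simps)
  qed
  then have "(D has_integral 0) Q"
    unfolding Q_def by (metis Dc integrable_continuous integrable_integral)
  then have "(D has_integral 0) UNIV"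
    using has_integral_on_superset[of D 0 Q UNIV] D0 Qin[OF _ i0, of _ 0] unfolding Q_def
    by (metis add.right_neutral not_le order_refl scale_zero_left subset_UNIV zero_le_one)
  then show ?thesis by (simp add: D_def[abs_def])
qed

end

section \<open>Isoperimetric inequality between two levels\<close>

lemma nn_integral_layer_cake:
  fixes S :: "(real \<times> 'a::euclidean_space) set"
  assumes S: "S \<in> sets (borel \<Otimes>\<^sub>M borel)" and k: "k \<in> borel_measurable borel"
  shows "(\<integral>\<^sup>+\<tau>. k \<tau> * emeasure lborel {x. (\<tau>, x) \<in> S} \<partial>lborel)
       = (\<integral>\<^sup>+x. (\<integral>\<^sup>+\<tau>. k \<tau> * indicator S (\<tau>, x) \<partial>lborel) \<partial>lborel)"
    and "(\<lambda>\<tau>. emeasure lborel {x. (\<tau>, x) \<in> S}) \<in> borel_measurable borel"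
proof -
  have eq: "{x. (\<tau>, x) \<in> S} = Pair \<tau> -` S" for \<tau> by auto
  have [measurable]: "S \<in> sets (borel \<Otimes>\<^sub>M borel)" "k \<in> borel_measurable borel" by fact+
  have "sets (borel \<Otimes>\<^sub>M lborel) = sets (borel \<Otimes>\<^sub>M (borel :: 'a measure))"
    by (intro sets_pair_measure_cong) simp_all
  then show "(\<lambda>\<tau>. emeasure lborel {x. (\<tau>, x) \<in> S}) \<in> borel_measurable borel"
    unfolding eq using S by (intro lborel.measurable_emeasure_Pair) auto
  have sec: "{x. (\<tau>, x) \<in> S} \<in> sets borel" for \<tau>
    using sets_Pair1[OF S, of \<tau>] by (simp add: vimage_def)
  have ind: "indicator {x. (\<tau>, x) \<in> S} x = (indicator S (\<tau>, x) :: ennreal)" for \<tau> x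
    by (simp add: indicator_def)
  have "(\<integral>\<^sup>+\<tau>. k \<tau> * emeasure lborel {x. (\<tau>, x) \<in> S} \<partial>lborel)
      = (\<integral>\<^sup>+\<tau>. (\<integral>\<^sup>+x. k \<tau> * indicator S (\<tau>, x) \<partial>lborel) \<partial>lborel)"
    using sec by (simp add: nn_integral_cmult_indicator flip: ind)
  also have "\<dots> = (\<integral>\<^sup>+x. (\<integral>\<^sup>+\<tau>. k \<tau> * indicator S (\<tau>, x) \<partial>lborel) \<partial>lborel)"
    by (rule lborel_pair.Fubini') (simp add: borel_prod[symmetric] split_beta')
  finally show "(\<integral>\<^sup>+\<tau>. k \<tau> * emeasure lborel {x. (\<tau>, x) \<in> S} \<partial>lborel)
       = (\<integral>\<^sup>+x. (\<integral>\<^sup>+\<tau>. k \<tau> * indicator S (\<tau>, x) \<partial>lborel) \<partial>lborel)" .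
qed

text \<open>With \<open>a\<close> and \<open>k\<close> the roots of the two volumes, Brunn-Minkowski
  bounds the volume of the sum below by \<open>(a + e * k) ^ n\<close>, and Bernoulli's inequality
  extracts the term linear in \<open>e\<close>. Its coefficient is the isoperimetric lower bound for
  the anisotropic perimeter.\<close>

lemma brunn_minkowski_dilate:
  fixes A K :: "'a::euclidean_space set"
  assumes A: "open A" "bounded A" "A \<noteq> {}" and K: "convex K" "bounded K" "interior K \<noteq> {}" and e: "e > 0"
  shows "measure lebesgue A + e * (DIM('a) * root DIM('a) (measure lebesgue K) * root DIM('a) (measure lebesgue A) ^ (DIM('a) - 1))
    \<le> measure lebesgue (A + (\<lambda>z. e *\<^sub>R z) ` interior K)"
proof -
  let ?n = "DIM('a)" let ?r = "root ?n" let ?eK = "(\<lambda>z. e *\<^sub>R z) ` interior K"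
  have K_int: "measure lebesgue (interior K) = measure lebesgue K"
  proof (rule measure_negligible_symdiff)
    show "K \<in> lmeasurable" using K by (simp add: measurable_convex)
    show "negligible (K - interior K \<union> (interior K - K))"
      using negligible_convex_frontier[OF K(1)]
      by (rule negligible_subset) (use interior_subset closure_subset in \<open>auto simp: frontier_def\<close>)
  qed
  have eK: "measure lebesgue ?eK = e ^ ?n * measure lebesgue K"
    using measure_lebesgue_affine[of e 0 "interior K"] e by (simp add: K_int)
  have rA: "?r (measure lebesgue A) > 0"
    using A by (metis DIM_positive lmeasurable_open measure_nonneg negligible_iff_measure open_not_negligible order_le_less real_root_gt_zero)
  have bK: "bounded (interior K)" using bounded_subset[OF K(2) interior_subset] .
  define a where "a = ?r (measure lebesgue A)"
  define k where "k = ?r (measure lebesgue K)"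
  have a: "a > 0" using rA by (simp add: a_def)
  have k: "k \<ge> 0" by (simp add: k_def real_root_ge_zero)
  have an: "a ^ ?n = measure lebesgue A" by (simp add: a_def)
  have ek: "?r (measure lebesgue ?eK) = e * k"
    using e by (simp add: eK real_root_mult k_def real_root_power_cancel)
  have "a ^ ?n + e * (?n * k * a ^ (?n - 1)) = a ^ ?n * (1 + ?n * (e * k / a))"
    using a by (simp add: power_diff field_simps)
  also have "\<dots> \<le> a ^ ?n * (1 + e * k / a) ^ ?n"
    using a e k by (intro mult_left_mono Bernoulli_inequality) (auto intro: order_trans[of _ 0])
  also have "\<dots> = (a * (1 + e * k / a)) ^ ?n" by (simp add: power_mult_distrib)
  also have "a * (1 + e * k / a) = a + e * k" using a by (simp add: field_simps)
  also have "(a + e * k) ^ ?n \<le> measure lebesgue (A + ?eK)"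
    unfolding a_def ek[symmetric]
    by (rule brunn_minkowski_open[OF A]) (use K e bK in \<open>auto intro!: open_scaling bounded_scaling\<close>)
  finally show ?thesis by (simp add: an a_def k_def)
qed

lemma compact_superlevel:
  fixes v :: "'a::euclidean_space \<Rightarrow> real"
  assumes "continuous_on UNIV v" "bounded {x. v x > 0}" "s > 0"
  shows "compact {x. s \<le> v x}"
proof -
  have "closed {x. s \<le> v x}" using assms(1) by (intro closed_Collect_le) auto
  moreover have "bounded {x. s \<le> v x}" using assms(3) by (intro bounded_subset[OF assms(2)]) auto
  ultimately show ?thesis by (simp add: compact_eq_bounded_closed)
qed

text \<open>The expansion is taken at \<open>x = y + e *\<^sub>R z\<close>, since \<open>F\<close>
  has to be evaluated at the point that is to be shown to lie in the enlarged set. Then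
  \<open>y - x\<close> is \<open>- e *\<^sub>R z\<close>, whence the sign in the hypothesis on
  \<open>K\<close>. Compactness of \<open>{x. s / 2 \<le> v x}\<close> makes the threshold
  independent of \<open>y\<close>.\<close>

lemma superlevel_translate:
  fixes v :: "'a::euclidean_space \<Rightarrow> real"
  assumes v: "continuous_on UNIV v" "bounded {x. v x > 0}"
    and der: "\<And>x. v x > 0 \<Longrightarrow> (v has_derivative (\<lambda>h. Dv x \<bullet> h)) (at x)"
    and Dv: "continuous_on {x. v x > 0} Dv"
    and K: "bounded K" "\<And>z \<xi>. z \<in> K \<Longrightarrow> - (z \<bullet> \<xi>) \<le> F \<xi>"
    and s: "s > 0" and \<eta>: "\<eta> > 0"
  obtains \<epsilon> where "\<epsilon> > 0"
    "\<And>e y z. 0 < e \<Longrightarrow> e \<le> \<epsilon> \<Longrightarrow> s \<le> v y \<Longrightarrow> z \<in> K \<Longrightarrow>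
       s / 2 < v (y + e *\<^sub>R z) \<and> v y \<le> v (y + e *\<^sub>R z) + e * (F (Dv (y + e *\<^sub>R z)) + \<eta>)"
proof -
  obtain R where R: "R > 0" "\<And>z. z \<in> K \<Longrightarrow> norm z \<le> R" using K(1) by (auto simp: bounded_pos)
  have "open {x. s / 2 < v x}" using v(1) by (intro open_Collect_less) auto
  then have "\<exists>d>0. \<forall>x\<in>{x. s \<le> v x}. \<forall>y\<in>- {x. s / 2 < v x}. d \<le> dist x y"
    using s by (intro separate_compact_closed compact_superlevel[OF v s]) (auto simp: closed_Compl)
  then obtain d where d: "d > 0" "\<And>x y. s \<le> v x \<Longrightarrow> \<not> s / 2 < v y \<Longrightarrow> d \<le> dist x y" by auto
  have "uniformly_continuous_on {x. s / 2 \<le> v x} Dv"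
    using s by (intro compact_uniformly_continuous compact_superlevel[OF v] continuous_on_subset[OF Dv]) auto
  then obtain d' where d': "d' > 0"
    "\<And>x y. s / 2 \<le> v x \<Longrightarrow> s / 2 \<le> v y \<Longrightarrow> dist y x < d' \<Longrightarrow> dist (Dv y) (Dv x) < \<eta> / R"
    using \<eta> R(1) unfolding uniformly_continuous_on_def by (metis (mono_tags, lifting) divide_pos_pos mem_Collect_eq)
  \<comment> \<open>\<open>\<rho> \<le> d\<close> keeps the ball around \<open>y\<close> in
    \<open>{x. s / 2 < v x}\<close>, and \<open>2 * \<rho> \<le> d'\<close> makes the gradients at
    any two of its points differ by less than \<open>\<eta> / R\<close>. Over a distance of at most
    \<open>e * R\<close> this costs \<open>e * \<eta>\<close>.\<close>
  define \<rho> where "\<rho> = min d (d' / 2)"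
  have \<rho>: "\<rho> > 0" "\<rho> \<le> d" "2 * \<rho> \<le> d'" using d d' by (auto simp: \<rho>_def)
  show ?thesis
  proof (rule that[of "\<rho> / (2 * R)"])
    show "\<rho> / (2 * R) > 0" using \<rho> R by simp
    fix e y z assume e: "0 < e" "e \<le> \<rho> / (2 * R)" and y: "s \<le> v y" and z: "z \<in> K"
    define x where "x = y + e *\<^sub>R z"
    have "e * R < \<rho>" using e R \<rho> by (simp add: field_simps)
    moreover have yx: "norm (y - x) \<le> e * R" using e R(2)[OF z] by (simp add: x_def)
    ultimately have xB: "x \<in> ball y \<rho>" by (simp add: dist_norm)
    have B: "s / 2 < v w" if "w \<in> ball y \<rho>" for w using d(2)[OF y, of w] that \<rho> by fastforce
    have "norm (v y - v x - Dv x \<bullet> (y - x)) \<le> norm (y - x) * (\<eta> / R)"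
    proof (rule differentiable_bound_linearization[where S = "ball y \<rho>" and f' = "\<lambda>x h. Dv x \<bullet> h"])
      show "x + t *\<^sub>R (y - x) \<in> ball y \<rho>" if "t \<in> {0..1}" for t
        using convexD_alt[OF convex_ball xB centre_in_ball[THEN iffD2, OF \<rho>(1)], of t] that
        by (simp add: algebra_simps)
      show "(v has_derivative (\<bullet>) (Dv w)) (at w within ball y \<rho>)" if "w \<in> ball y \<rho>" for w
        by (rule has_derivative_at_withinI, rule der) (use B[OF that] s in simp)
      show "onorm ((\<bullet>) (Dv w) - (\<bullet>) (Dv x)) \<le> \<eta> / R" if "w \<in> ball y \<rho>" for w
      proof (rule onorm_bound)
        have "dist w x \<le> dist w y + dist y x" by (rule dist_triangle)
        then have "dist w x < d'" using that xB \<rho> by (simp add: dist_commute)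
        then have "norm (Dv w - Dv x) < \<eta> / R"
          using d'(2)[of x w] B[OF that] B[OF xB] by (simp add: dist_norm)
        then have le: "norm (Dv w - Dv x) * norm h \<le> \<eta> / R * norm h" for h by (intro mult_right_mono) auto
        show "norm (((\<bullet>) (Dv w) - (\<bullet>) (Dv x)) h) \<le> \<eta> / R * norm h" for h
          using order_trans[OF Cauchy_Schwarz_ineq2[of "Dv w - Dv x" h] le[of h]] by (simp add: inner_diff_left)
      qed (use \<eta> R in simp)
    qed (rule xB)
    also have "\<dots> \<le> e * R * (\<eta> / R)" using yx \<eta> R by (intro mult_right_mono) auto
    also have "\<dots> = e * \<eta>" using R by simp
    finally have "v y \<le> v x + Dv x \<bullet> (y - x) + e * \<eta>" by (simp add: abs_le_iff)
    moreover have "Dv x \<bullet> (y - x) = e * - (z \<bullet> Dv x)" by (simp add: x_def inner_commute)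
    moreover have "e * - (z \<bullet> Dv x) \<le> e * F (Dv x)" using K(2)[OF z] e by (intro mult_left_mono) auto
    ultimately have "v y \<le> v x + e * (F (Dv x) + \<eta>)" by (simp add: algebra_simps)
    then show "s / 2 < v (y + e *\<^sub>R z) \<and> v y \<le> v (y + e *\<^sub>R z) + e * (F (Dv (y + e *\<^sub>R z)) + \<eta>)"
      using B[OF xB] by (simp add: x_def)
  qed
qed

lemma nn_integral_truncation:
  "(\<integral>\<^sup>+\<tau>. indicator {s..<t} \<tau> * indicator {\<tau>. P \<and> \<tau> < w} \<tau> \<partial>lborel)
   = ennreal (if P then max 0 (min t w - s) else 0)" for s t w :: real
proof (cases P)
  case True
  have "(\<integral>\<^sup>+\<tau>. indicator {s..<t} \<tau> * indicator {\<tau>. P \<and> \<tau> < w} \<tau> \<partial>lborel) = (\<integral>\<^sup>+\<tau>. indicator {s..<min t w} \<tau> \<partial>lborel)"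
    using True by (intro nn_integral_cong) (auto simp: indicator_def)
  also have "\<dots> = ennreal (max 0 (min t w - s))"
    by (cases "s \<le> min t w") (auto simp: max_def)
  finally show ?thesis using True by simp
qed simp

text \<open>With \<open>w = v + e (f + \<eta>)\<close> the hypothesis on translates says that \<open>{v > \<tau>} + e K\<close> is contained in
  \<open>{w > \<tau>}\<close>. The Brunn-Minkowski inequality bounds its volume from below, and integration over
  \<open>\<tau>\<close> between \<open>s\<close> and \<open>t\<close> turns the volumes into integrals of truncations of \<open>v\<close> and \<open>w\<close>.\<close>

lemma superlevel_isoperimetric_approx:
  fixes v :: "'a::euclidean_space \<Rightarrow> real"
  assumes dim: "DIM('a) \<ge> 2"
    and v: "continuous_on UNIV v" "bounded {x. v x > 0}"
    and f: "continuous_on {x. s / 2 < v x} f" "\<And>x. s / 2 < v x \<Longrightarrow> 0 \<le> f x \<and> f x \<le> M"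
    and K: "convex K" "bounded K" "interior K \<noteq> {}"
    and st: "0 < s" "s < t" and e: "0 < e" and \<eta>: "0 < \<eta>" "\<eta> \<le> 1"
    and tr: "\<And>y z. s \<le> v y \<Longrightarrow> z \<in> K \<Longrightarrow> s / 2 < v (y + e *\<^sub>R z) \<and> v y \<le> v (y + e *\<^sub>R z) + e * (f (y + e *\<^sub>R z) + \<eta>)"
  shows "DIM('a) * root DIM('a) (measure lebesgue K) * root DIM('a) (measure lebesgue {x. t \<le> v x}) ^ (DIM('a) - 1) * (t - s)
    \<le> (\<integral>x. indicator {x. s - e * (M + 1) < v x \<and> v x < t \<and> s / 2 < v x} x * (f x + \<eta>) \<partial>lborel)"
proof -
  let ?n = "DIM('a)"
  define c where "c = ?n * root ?n (measure lebesgue K) * root ?n (measure lebesgue {x. t \<le> v x}) ^ (?n - 1)"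
  have c: "c \<ge> 0" by (simp add: c_def real_root_ge_zero)
  define X where "X = {x. s / 2 < v x}"
  have X: "open X" using v(1) unfolding X_def by (intro open_Collect_less) auto
  have Xb: "bounded X" using st unfolding X_def by (intro bounded_subset[OF v(2)]) auto
  have [measurable]: "v \<in> borel_measurable borel" using v(1) by (rule borel_measurable_continuous_onI)
  \<comment> \<open>\<open>f\<close> is controlled only on \<open>X\<close>; the extension by zero
    is Borel on the whole space.\<close>
  define g where "g x = indicator X x *\<^sub>R f x" for x
  have [measurable]: "g \<in> borel_measurable borel"
    unfolding g_def by (rule borel_measurable_continuous_on_indicator) (use X f in \<open>auto simp: X_def\<close>)
  have g: "0 \<le> g x \<and> g x \<le> max 0 M" for x using f(2) by (force simp: g_def X_def indicator_def)
  define w where "w x = v x + e * (g x + \<eta>)" for x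
  have [measurable]: "w \<in> borel_measurable borel" unfolding w_def by measurable
  define S1 where "S1 = {(\<tau>, x). s / 2 < v x \<and> \<tau> < v x}"
  define S2 where "S2 = {(\<tau>, x). s / 2 < v x \<and> \<tau> < w x}"
  have [measurable]: "S1 \<in> sets (borel \<Otimes>\<^sub>M borel)" "S2 \<in> sets (borel \<Otimes>\<^sub>M borel)"
  proof -
    have "{z \<in> space (borel \<Otimes>\<^sub>M borel). s / 2 < v (snd z) \<and> fst z < v (snd z)} \<in> sets (borel \<Otimes>\<^sub>M borel)"
      "{z \<in> space (borel \<Otimes>\<^sub>M borel). s / 2 < v (snd z) \<and> fst z < w (snd z)} \<in> sets (borel \<Otimes>\<^sub>M borel)"
      by measurable
    then show "S1 \<in> sets (borel \<Otimes>\<^sub>M borel)" "S2 \<in> sets (borel \<Otimes>\<^sub>M borel)"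
      by (simp_all add: space_pair_measure S1_def S2_def split_beta')
  qed
  \<comment> \<open>For fixed \<open>x\<close>, \<open>p x\<close> and \<open>q x\<close> are the
    lengths of the sets of levels in \<open>{s..<t}\<close> lying below \<open>v x\<close> and below
    \<open>w x\<close>, hence the inner integrals of the layer-cake formula.\<close>
  define p where "p x = (if s / 2 < v x then max 0 (min t (v x) - s) else 0)" for x
  define q where "q x = (if s / 2 < v x then max 0 (min t (w x) - s) else 0)" for x
  define h where "h x = indicator {x. s - e * (M + 1) < v x \<and> v x < t \<and> s / 2 < v x} x * (f x + \<eta>)" for x
  have heq: "h x = indicator {x. s - e * (M + 1) < v x \<and> v x < t \<and> s / 2 < v x} x * (g x + \<eta>)" for x
    by (auto simp: h_def g_def X_def indicator_def)
  have [measurable]: "p \<in> borel_measurable borel" "q \<in> borel_measurable borel" "h \<in> borel_measurable borel"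
    unfolding p_def q_def heq[abs_def] by measurable
  have h0: "h x \<ge> 0" for x using g \<eta> by (simp add: heq)
  have hle: "h x \<le> indicator X x * (max 0 M + 1)" for x
    using g[of x] \<eta> by (auto simp: heq indicator_def X_def)
  have fin: "emeasure lborel X < \<infinity>" by (rule emeasure_bounded_finite[OF Xb])
  have hint: "integrable lborel h"
  proof (rule Bochner_Integration.integrable_bound)
    show "integrable lborel (\<lambda>x. indicator X x * (max 0 M + 1))"
      using X fin by (intro integrable_mult_left integrable_real_indicator) auto
  qed (use h0 hle in \<open>auto intro!: AE_I2 simp: abs_of_nonneg order_trans[OF hle abs_ge_self]\<close>)
  have key: "emeasure lborel {x. (\<tau>, x) \<in> S1} + ennreal (e * c) \<le> emeasure lborel {x. (\<tau>, x) \<in> S2}"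
    if \<tau>: "\<tau> \<in> {s..<t}" for \<tau>
  proof -
    let ?A = "{x. \<tau> < v x}"
    have s1: "{x. (\<tau>, x) \<in> S1} = ?A" using \<tau> st by (auto simp: S1_def)
    have A: "open ?A" using v(1) by (intro open_Collect_less) auto
    have Ab: "bounded ?A" using \<tau> st by (intro bounded_subset[OF v(2)]) auto
    have "{x \<in> space borel. s / 2 < v x \<and> \<tau> < w x} \<in> sets borel" by measurable
    then have S2b: "{x. (\<tau>, x) \<in> S2} \<in> sets borel" by (simp add: S2_def)
    have S2X: "{x. (\<tau>, x) \<in> S2} \<subseteq> X" by (auto simp: S2_def X_def)
    then have S2m: "{x. (\<tau>, x) \<in> S2} \<in> lmeasurable"
      using S2b by (intro bounded_set_imp_lmeasurable bounded_subset[OF Xb]) auto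
    have real: "measure lebesgue ?A + e * c \<le> measure lebesgue {x. (\<tau>, x) \<in> S2}"
    proof (cases "?A = {}")
      case True
      then have "v x < t" for x using \<tau> by (auto simp: set_eq_iff not_less intro: le_less_trans)
      then have "{x. t \<le> v x} = {}" by (auto simp: not_le)
      \<comment> \<open>The exponent \<open>?n - 1\<close> is positive because the dimension is at
        least 2, so the power of the vanishing volume is 0.\<close>
      then have "c = 0" using dim by (simp add: c_def)
      then show ?thesis using True by simp
    next
      case False
      have "c \<le> ?n * root ?n (measure lebesgue K) * root ?n (measure lebesgue ?A) ^ (?n - 1)"
        unfolding c_def
      proof (intro mult_left_mono power_mono real_root_le_mono measure_mono_fmeasurable)
        show "{x. t \<le> v x} \<subseteq> ?A" using \<tau> by auto
        show "?A \<in> lmeasurable" using A Ab by (simp add: lmeasurable_open)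
      qed (auto simp: real_root_ge_zero)
      then have "measure lebesgue ?A + e * c \<le> measure lebesgue ?A
          + e * (?n * root ?n (measure lebesgue K) * root ?n (measure lebesgue ?A) ^ (?n - 1))"
        using e by simp
      also have "\<dots> \<le> measure lebesgue (?A + (\<lambda>z. e *\<^sub>R z) ` interior K)"
        by (rule brunn_minkowski_dilate[OF A Ab False K e])
      also have "\<dots> \<le> measure lebesgue {x. (\<tau>, x) \<in> S2}"
      proof (rule measure_mono_fmeasurable[OF _ _ S2m])
        show "?A + (\<lambda>z. e *\<^sub>R z) ` interior K \<in> sets lebesgue"
          using open_set_plus[OF A] by (simp add: borel_open)
        show "?A + (\<lambda>z. e *\<^sub>R z) ` interior K \<subseteq> {x. (\<tau>, x) \<in> S2}"
        proof
          fix x assume "x \<in> ?A + (\<lambda>z. e *\<^sub>R z) ` interior K"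
          then obtain y z where yz: "\<tau> < v y" "z \<in> K" "x = y + e *\<^sub>R z"
            using interior_subset by (auto simp: set_plus_def)
          have sx: "s / 2 < v x" "v y \<le> v x + e * (f x + \<eta>)"
            using tr[of y z] yz \<tau> by auto
          then have "\<tau> < w x" using yz by (simp add: w_def g_def X_def)
          then show "x \<in> {x. (\<tau>, x) \<in> S2}" using sx by (simp add: S2_def)
        qed
      qed
      finally show ?thesis .
    qed
    have "emeasure lborel {x. (\<tau>, x) \<in> S1} = ennreal (measure lebesgue ?A)"
      using emeasure_eq_measure2[of ?A lebesgue] A Ab unfolding s1
      by (simp add: lmeasurable_open)
    moreover have "emeasure lborel {x. (\<tau>, x) \<in> S2} = ennreal (measure lebesgue {x. (\<tau>, x) \<in> S2})"
      using emeasure_eq_measure2[OF S2m] S2b by simp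
    ultimately show ?thesis using real c e by (simp flip: ennreal_plus)
  qed
  have cake: "(\<integral>\<^sup>+\<tau>. indicator {s..<t} \<tau> * emeasure lborel {x. (\<tau>, x) \<in> S1} \<partial>lborel) = (\<integral>\<^sup>+x. ennreal (p x) \<partial>lborel)"
    "(\<integral>\<^sup>+\<tau>. indicator {s..<t} \<tau> * emeasure lborel {x. (\<tau>, x) \<in> S2} \<partial>lborel) = (\<integral>\<^sup>+x. ennreal (q x) \<partial>lborel)"
  proof -
    have "(indicator S1 (\<tau>, x) :: ennreal) = indicator {\<tau>. s / 2 < v x \<and> \<tau> < v x} \<tau>"
      "(indicator S2 (\<tau>, x) :: ennreal) = indicator {\<tau>. s / 2 < v x \<and> \<tau> < w x} \<tau>" for \<tau> x
      by (auto simp: S1_def S2_def indicator_def)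
    then show "(\<integral>\<^sup>+\<tau>. indicator {s..<t} \<tau> * emeasure lborel {x. (\<tau>, x) \<in> S1} \<partial>lborel) = (\<integral>\<^sup>+x. ennreal (p x) \<partial>lborel)"
    "(\<integral>\<^sup>+\<tau>. indicator {s..<t} \<tau> * emeasure lborel {x. (\<tau>, x) \<in> S2} \<partial>lborel) = (\<integral>\<^sup>+x. ennreal (q x) \<partial>lborel)"
      by (simp_all add: nn_integral_layer_cake nn_integral_truncation p_def q_def)
  qed
  have meas: "(\<lambda>\<tau>. emeasure lborel {x. (\<tau>, x) \<in> S1}) \<in> borel_measurable borel"
    by (rule nn_integral_layer_cake(2)[where k = "\<lambda>_. 0"]) simp_all
  have "(\<integral>\<^sup>+x. ennreal (p x) \<partial>lborel) + ennreal (e * c * (t - s))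
    = (\<integral>\<^sup>+\<tau>. indicator {s..<t} \<tau> * emeasure lborel {x. (\<tau>, x) \<in> S1} \<partial>lborel) + (\<integral>\<^sup>+\<tau>. ennreal (e * c) * indicator {s..<t} \<tau> \<partial>lborel)"
    using st c e by (simp add: cake nn_integral_cmult_indicator flip: ennreal_mult)
  also have "\<dots> = (\<integral>\<^sup>+\<tau>. indicator {s..<t} \<tau> * emeasure lborel {x. (\<tau>, x) \<in> S1} + ennreal (e * c) * indicator {s..<t} \<tau> \<partial>lborel)"
    by (subst nn_integral_add) (use meas in auto)
  also have "\<dots> \<le> (\<integral>\<^sup>+\<tau>. indicator {s..<t} \<tau> * emeasure lborel {x. (\<tau>, x) \<in> S2} \<partial>lborel)"
    using key by (intro nn_integral_mono) (auto simp: indicator_def)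
  also have "\<dots> = (\<integral>\<^sup>+x. ennreal (q x) \<partial>lborel)" by (rule cake)
  also have "\<dots> \<le> (\<integral>\<^sup>+x. ennreal (p x) + ennreal (e * h x) \<partial>lborel)"
  proof (rule nn_integral_mono)
    fix x
    \<comment> \<open>Truncation to \<open>{s..<t}\<close> does not increase the difference
      \<open>w x - v x\<close>, which is \<open>e * (f x + \<eta>)\<close>. Nothing is gained if
      \<open>v x \<ge> t\<close>, where \<open>p x\<close> is already full, or if
      \<open>w x \<le> s\<close>, where \<open>q x = 0\<close>.\<close>
    have "q x \<le> p x + e * h x"
    proof (cases "s / 2 < v x")
      case True
      have fx: "g x = f x" "0 \<le> f x" "f x \<le> M" using True f(2) by (auto simp: g_def X_def)
      have wv: "v x \<le> w x" using fx e \<eta> by (simp add: w_def)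
      show ?thesis
      proof (cases "v x < t \<and> s - e * (M + 1) < v x")
        case True
        then have "e * h x = w x - v x" using \<open>s / 2 < v x\<close> fx by (simp add: h_def w_def)
        then show ?thesis using wv by (auto simp: p_def q_def max_def min_def)
      next
        case False
        have "e * (f x + \<eta>) \<le> e * (M + 1)" using fx \<eta> e by (intro mult_left_mono) auto
        then have "t \<le> v x \<or> w x \<le> s" using False fx by (auto simp: w_def)
        then have "q x \<le> p x" using wv st by (auto simp: p_def q_def max_def min_def)
        then show ?thesis using h0[of x] e by (simp add: add_increasing2)
      qed
    qed (use h0 e in \<open>simp add: p_def q_def\<close>)
    moreover have "p x \<ge> 0" by (simp add: p_def)
    ultimately show "ennreal (q x) \<le> ennreal (p x) + ennreal (e * h x)"
      using h0 e by (simp flip: ennreal_plus)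
  qed
  also have "\<dots> = (\<integral>\<^sup>+x. ennreal (p x) \<partial>lborel) + (\<integral>\<^sup>+x. ennreal (e * h x) \<partial>lborel)"
    by (intro nn_integral_add) simp_all
  also have "(\<integral>\<^sup>+x. ennreal (e * h x) \<partial>lborel) = ennreal (\<integral>x. e * h x \<partial>lborel)"
    using hint h0 e by (intro nn_integral_eq_integral) auto
  finally have "(\<integral>\<^sup>+x. ennreal (p x) \<partial>lborel) + ennreal (e * c * (t - s))
     \<le> (\<integral>\<^sup>+x. ennreal (p x) \<partial>lborel) + ennreal (\<integral>x. e * h x \<partial>lborel)" .
  \<comment> \<open>Finiteness permits cancelling the integral of \<open>p\<close> on both
    sides.\<close>
  moreover have "(\<integral>\<^sup>+x. ennreal (p x) \<partial>lborel) \<noteq> \<infinity>"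
  proof -
    have "(\<integral>\<^sup>+x. ennreal (p x) \<partial>lborel) \<le> (\<integral>\<^sup>+x. ennreal (t - s) * indicator X x \<partial>lborel)"
      using st by (intro nn_integral_mono) (auto simp: p_def X_def indicator_def intro!: ennreal_leI)
    also have "\<dots> < \<infinity>" using fin X by (subst nn_integral_cmult_indicator) (auto simp: ennreal_mult_less_top)
    finally show ?thesis by simp
  qed
  ultimately have "ennreal (e * c * (t - s)) \<le> ennreal (\<integral>x. e * h x \<partial>lborel)"
    by (simp add: ennreal_add_left_cancel_le)
  moreover have "0 \<le> (\<integral>x. e * h x \<partial>lborel)" using h0 e by (intro integral_nonneg_AE) auto
  ultimately have "e * (c * (t - s)) \<le> e * (\<integral>x. h x \<partial>lborel)"
    by (simp add: mult.assoc)
  then show ?thesis using e by (simp add: c_def h_def[abs_def])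
qed

section \<open>Integrals over superlevel sets and the limit of vanishing translations\<close>

lemma integrable_superlevel:
  fixes v f :: "'a::euclidean_space \<Rightarrow> real"
  assumes v: "continuous_on UNIV v" "bounded {x. v x > 0}" and f: "continuous_on {x. v x > 0} f"
    and s: "0 < s" and S: "S \<in> sets borel" "S \<subseteq> {x. s \<le> v x}"
  shows "integrable lborel (\<lambda>x. indicator S x * f x)"
proof -
  have "integrable lborel (\<lambda>x. indicator {x. s \<le> v x} x *\<^sub>R f x)"
    using s by (intro borel_integrable_compact compact_superlevel[OF v] continuous_on_subset[OF f]) auto
  then have "integrable lborel (\<lambda>x. indicator S x *\<^sub>R (indicator {x. s \<le> v x} x *\<^sub>R f x))"
    by (rule integrable_mult_indicator[rotated]) (use S in simp)
  moreover have "indicator S x *\<^sub>R (indicator {x. s \<le> v x} x *\<^sub>R f x) = indicator S x * f x" for x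
    using S(2) by (auto simp: indicator_def)
  ultimately show ?thesis by (simp only:)
qed

lemma superlevel_bound:
  fixes v f :: "'a::euclidean_space \<Rightarrow> real"
  assumes v: "continuous_on UNIV v" "bounded {x. v x > 0}" and f: "continuous_on {x. v x > 0} f" and s: "0 < s"
  obtains M where "M \<ge> 0" "\<And>x. s \<le> v x \<Longrightarrow> \<bar>f x\<bar> \<le> M"
proof -
  have "compact (f ` {x. s \<le> v x})"
    using s by (intro compact_continuous_image compact_superlevel[OF v] continuous_on_subset[OF f]) auto
  then have "bounded (f ` {x. s \<le> v x})" by (rule compact_imp_bounded)
  then obtain M where "M > 0" "\<And>y. y \<in> f ` {x. s \<le> v x} \<Longrightarrow> norm y \<le> M" by (auto simp: bounded_pos)
  then show ?thesis using that[of M] by auto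
qed

lemma superlevel_sets:
  fixes v :: "'a::euclidean_space \<Rightarrow> real"
  assumes "continuous_on UNIV v"
  shows "{x. s \<le> v x} \<in> sets borel" "{x. s \<le> v x \<and> v x < t} \<in> sets borel"
proof -
  have [measurable]: "v \<in> borel_measurable borel" using assms by (rule borel_measurable_continuous_onI)
  have "{x \<in> space borel. s \<le> v x} \<in> sets borel" "{x \<in> space borel. s \<le> v x \<and> v x < t} \<in> sets borel"
    by measurable
  then show "{x. s \<le> v x} \<in> sets borel" "{x. s \<le> v x \<and> v x < t} \<in> sets borel" by simp_all
qed

text \<open>This is the coarea formula combined with the isoperimetric inequality, integrated over
  the levels from \<open>s\<close> to \<open>t\<close>. The approximate layers reach slightly below
  \<open>s\<close>, so their limit contains \<open>{x. v x = s}\<close>; this fixes the half-open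
  form of the layer.\<close>

proposition superlevel_isoperimetric:
  fixes v :: "'a::euclidean_space \<Rightarrow> real"
  assumes dim: "DIM('a) \<ge> 2"
    and v: "continuous_on UNIV v" "bounded {x. v x > 0}"
    and der: "\<And>x. v x > 0 \<Longrightarrow> (v has_derivative (\<lambda>h. Dv x \<bullet> h)) (at x)"
    and Dv: "continuous_on {x. v x > 0} Dv"
    and F: "continuous_on UNIV F" "\<And>\<xi>. 0 \<le> F \<xi>"
    and K: "convex K" "bounded K" "interior K \<noteq> {}" "\<And>z \<xi>. z \<in> K \<Longrightarrow> - (z \<bullet> \<xi>) \<le> F \<xi>"
    and st: "0 < s" "s < t"
  shows "DIM('a) * root DIM('a) (measure lebesgue K) * root DIM('a) (measure lebesgue {x. t \<le> v x}) ^ (DIM('a) - 1) * (t - s)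
    \<le> (\<integral>x. indicator {x. s \<le> v x \<and> v x < t} x * F (Dv x) \<partial>lborel)"
proof -
  let ?n = "DIM('a)"
  define c where "c = ?n * root ?n (measure lebesgue K) * root ?n (measure lebesgue {x. t \<le> v x}) ^ (?n - 1) * (t - s)"
  define f where "f x = F (Dv x)" for x
  have f: "continuous_on {x. v x > 0} f"
    unfolding f_def by (rule continuous_on_compose2[OF F(1) Dv]) simp
  obtain M where M: "M \<ge> 0" "\<And>x. s / 2 \<le> v x \<Longrightarrow> \<bar>f x\<bar> \<le> M"
    using superlevel_bound[OF v f, of "s / 2"] st by auto
  define \<eta> where "\<eta> k = 1 / real (Suc k)" for k
  have \<eta>: "0 < \<eta> k" "\<eta> k \<le> 1" for k by (simp_all add: \<eta>_def)
  have \<eta>0: "\<eta> \<longlonglongrightarrow> 0" unfolding \<eta>_def using LIMSEQ_inverse_real_of_nat by (simp add: inverse_eq_divide)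
  \<comment> \<open>The bound \<open>\<epsilon> \<le> \<eta> k\<close> couples the two parameters,
    so that the translation length tends to 0 together with \<open>\<eta>\<close>.\<close>
  have "\<exists>\<epsilon>>0. \<epsilon> \<le> \<eta> k \<and> (\<forall>y z. s \<le> v y \<longrightarrow> z \<in> K \<longrightarrow>
       s / 2 < v (y + \<epsilon> *\<^sub>R z) \<and> v y \<le> v (y + \<epsilon> *\<^sub>R z) + \<epsilon> * (f (y + \<epsilon> *\<^sub>R z) + \<eta> k))" for k
  proof -
    obtain \<epsilon> where "\<epsilon> > 0" "\<And>e y z. 0 < e \<Longrightarrow> e \<le> \<epsilon> \<Longrightarrow> s \<le> v y \<Longrightarrow> z \<in> K \<Longrightarrow>
       s / 2 < v (y + e *\<^sub>R z) \<and> v y \<le> v (y + e *\<^sub>R z) + e * (f (y + e *\<^sub>R z) + \<eta> k)"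
      unfolding f_def using superlevel_translate[OF v der Dv K(2,4) st(1) \<eta>(1)[of k]] by metis
    then show ?thesis using \<eta>[of k] by (intro exI[of _ "min \<epsilon> (\<eta> k)"]) auto
  qed
  then obtain e where e: "\<And>k. e k > 0" "\<And>k. e k \<le> \<eta> k"
    "\<And>k y z. s \<le> v y \<Longrightarrow> z \<in> K \<Longrightarrow> s / 2 < v (y + e k *\<^sub>R z) \<and> v y \<le> v (y + e k *\<^sub>R z) + e k * (f (y + e k *\<^sub>R z) + \<eta> k)"
    by metis
  define h where "h k x = indicator {x. s - e k * (M + 1) < v x \<and> v x < t \<and> s / 2 < v x} x * (f x + \<eta> k)" for k x
  have hc: "c \<le> (\<integral>x. h k x \<partial>lborel)" for k
    unfolding c_def h_def
  proof (rule superlevel_isoperimetric_approx[OF dim v _ _ K(1-3) st e(1) \<eta>])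
    show "continuous_on {x. s / 2 < v x} f" using st by (intro continuous_on_subset[OF f]) auto
    show "0 \<le> f x \<and> f x \<le> M" if "s / 2 < v x" for x using M(2)[of x] F(2) that by (simp add: f_def abs_le_iff)
  qed (rule e(3))
  have e0: "e \<longlonglongrightarrow> 0" by (rule tendsto_sandwich[OF _ _ tendsto_const \<eta>0]) (use e in \<open>auto simp: less_imp_le\<close>)
  have [measurable]: "v \<in> borel_measurable borel" using v(1) by (rule borel_measurable_continuous_onI)
  define X where "X = {x. 0 < v x}"
  have X: "open X" using v(1) unfolding X_def by (intro open_Collect_less) auto
  define g where "g x = indicator X x *\<^sub>R f x" for x
  have [measurable]: "g \<in> borel_measurable borel"
    unfolding g_def by (rule borel_measurable_continuous_on_indicator) (use X f in \<open>auto simp: X_def\<close>)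
  have lim: "(\<lambda>k. \<integral>x. h k x \<partial>lborel) \<longlonglongrightarrow> (\<integral>x. indicator {x. s \<le> v x \<and> v x < t} x * f x \<partial>lborel)"
  proof (rule integral_dominated_convergence[where w = "\<lambda>x. indicator {x. s / 2 \<le> v x} x * (M + 1)"])
    have "(\<lambda>x. indicator {x. s \<le> v x \<and> v x < t} x * f x) = (\<lambda>x. indicator {x. s \<le> v x \<and> v x < t} x * g x)"
      using st by (intro ext) (auto simp: indicator_def X_def g_def)
    moreover have "(\<lambda>x. indicator {x. s \<le> v x \<and> v x < t} x * g x) \<in> borel_measurable lborel"
      by measurable
    ultimately show "(\<lambda>x. indicator {x. s \<le> v x \<and> v x < t} x * f x) \<in> borel_measurable lborel"
      by simp
    have "h k = (\<lambda>x. indicator {x. s - e k * (M + 1) < v x \<and> v x < t \<and> s / 2 < v x} x * (g x + \<eta> k))" for k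
      using st by (intro ext) (auto simp: h_def indicator_def X_def g_def)
    moreover have "(\<lambda>x. indicator {x. s - e k * (M + 1) < v x \<and> v x < t \<and> s / 2 < v x} x * (g x + \<eta> k)) \<in> borel_measurable lborel" for k
      by measurable
    ultimately show "(\<lambda>x. h k x) \<in> borel_measurable lborel" for k by simp
    show "integrable lborel (\<lambda>x. indicator {x. s / 2 \<le> v x} x * (M + 1))"
      using st by (intro integrable_superlevel[OF v, of _ "s / 2"] superlevel_sets v) auto
    show "AE x in lborel. norm (h k x) \<le> indicator {x. s / 2 \<le> v x} x * (M + 1)" for k
    proof (rule AE_I2)
      fix x show "norm (h k x) \<le> indicator {x. s / 2 \<le> v x} x * (M + 1)"
        using M(2)[of x] M(1) F(2)[of "Dv x"] \<eta>[of k] by (auto simp: h_def f_def indicator_def abs_le_iff)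
    qed
    show "AE x in lborel. (\<lambda>k. h k x) \<longlonglongrightarrow> indicator {x. s \<le> v x \<and> v x < t} x * f x"
    proof (rule AE_I2)
      fix x
      show "(\<lambda>k. h k x) \<longlonglongrightarrow> indicator {x. s \<le> v x \<and> v x < t} x * f x"
      proof (cases "s \<le> v x \<and> v x < t")
        case True
        have pos: "0 < e k * (M + 1)" for k using e(1)[of k] M(1) by simp
        have "h k x = f x + \<eta> k" for k using True st pos[of k] by (simp add: h_def)
        moreover have "(\<lambda>k. f x + \<eta> k) \<longlonglongrightarrow> f x + 0" by (intro tendsto_intros \<eta>0)
        ultimately show ?thesis using True by simp
      next
        case False
        have "\<forall>\<^sub>F k in sequentially. h k x = 0"
        proof (cases "v x < t")
          case True
          have "(\<lambda>k. s - e k * (M + 1)) \<longlonglongrightarrow> s - 0 * (M + 1)" by (intro tendsto_intros e0)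
          from order_tendstoD(1)[OF this, of "v x"]
          have "\<forall>\<^sub>F k in sequentially. v x < s - e k * (M + 1)"
            using False True by simp
          then show ?thesis by eventually_elim (simp add: h_def)
        qed (simp add: h_def)
        then show ?thesis using False by (auto intro: tendsto_eventually)
      qed
    qed
  qed
  have "c \<le> (\<integral>x. indicator {x. s \<le> v x \<and> v x < t} x * f x \<partial>lborel)"
    by (rule LIMSEQ_le_const[OF lim]) (use hc in auto)
  then show ?thesis by (simp add: c_def f_def)
qed

text \<open>Because the inequality in \<open>{x. s \<le> v x}\<close> is weak,
  \<open>s - d k \<le> v x\<close> for all large \<open>k\<close> exactly when
  \<open>s \<le> v x\<close>, which gives continuity from the left. The restriction
  \<open>d k \<le> s / 2\<close> keeps all sets in one compact superlevel set, which supplies the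
  dominating function.\<close>

lemma tendsto_integral_superlevel:
  fixes v G :: "'a::euclidean_space \<Rightarrow> real"
  assumes v: "continuous_on UNIV v" "bounded {x. v x > 0}" and G: "continuous_on {x. v x > 0} G"
    and s: "0 < s" and d: "d \<longlonglongrightarrow> 0" "\<And>k. 0 \<le> d k" "\<And>k. d k \<le> s / 2"
  shows "(\<lambda>k. \<integral>x. indicator {x. s - d k \<le> v x} x * G x \<partial>lborel) \<longlonglongrightarrow> (\<integral>x. indicator {x. s \<le> v x} x * G x \<partial>lborel)"
proof (rule integral_dominated_convergence[where w = "\<lambda>x. indicator {x. s / 2 \<le> v x} x * \<bar>G x\<bar>"])
  show "(\<lambda>x. indicator {x. s \<le> v x} x * G x) \<in> borel_measurable lborel"
    by (intro borel_measurable_integrable integrable_superlevel[OF v G s] superlevel_sets v) auto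
  have dk: "s - d k > 0" for k using d(3)[of k] s by linarith
  show "(\<lambda>x. indicator {x. s - d k \<le> v x} x * G x) \<in> borel_measurable lborel" for k
    by (intro borel_measurable_integrable integrable_superlevel[OF v G dk] superlevel_sets v) auto
  show "integrable lborel (\<lambda>x. indicator {x. s / 2 \<le> v x} x * \<bar>G x\<bar>)"
    using s by (intro integrable_superlevel[OF v, of _ "s / 2"] superlevel_sets v continuous_intros G) auto
  have dk': "s / 2 \<le> s - d k" for k using d(3)[of k] by simp
  show "AE x in lborel. norm (indicator {x. s - d k \<le> v x} x * G x) \<le> indicator {x. s / 2 \<le> v x} x * \<bar>G x\<bar>" for k
    using order_trans[OF dk'] by (intro AE_I2) (auto simp: indicator_def)
  show "AE x in lborel. (\<lambda>k. indicator {x. s - d k \<le> v x} x * G x) \<longlonglongrightarrow> indicator {x. s \<le> v x} x * G x"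
  proof (rule AE_I2)
    fix x
    have "\<forall>\<^sub>F k in sequentially. (s - d k \<le> v x) = (s \<le> v x)"
    proof (cases "s \<le> v x")
      case True
      then show ?thesis using d(2) by (intro always_eventually allI) (metis diff_left_mono diff_zero order_trans)
    next
      case False
      have "(\<lambda>k. s - d k) \<longlonglongrightarrow> s - 0" by (intro tendsto_intros d)
      from order_tendstoD(1)[OF this, of "v x"] have "\<forall>\<^sub>F k in sequentially. v x < s - d k" using False by simp
      then show ?thesis by eventually_elim (use False in auto)
    qed
    then have "\<forall>\<^sub>F k in sequentially. indicator {x. s - d k \<le> v x} x * G x = indicator {x. s \<le> v x} x * G x"
      by eventually_elim (simp add: indicator_def)
    then show "(\<lambda>k. indicator {x. s - d k \<le> v x} x * G x) \<longlonglongrightarrow> indicator {x. s \<le> v x} x * G x"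
      by (rule tendsto_eventually)
  qed
qed

section \<open>Energy between two levels\<close>

text \<open>For \<open>d > 0\<close> this is a C^1 version of the positive part: its derivative
  rises linearly from 0 to 1 on \<open>{0..d}\<close>. Writing it with squares of positive parts
  reduces differentiability at the two joints to \<open>has_real_derivative_max_sq\<close>.\<close>

definition ramp :: "real \<Rightarrow> real \<Rightarrow> real" where
  "ramp d x = ((max 0 x)\<^sup>2 - (max 0 (x - d))\<^sup>2) / (2 * d)"

definition ramp' :: "real \<Rightarrow> real \<Rightarrow> real" where
  "ramp' d x = (max 0 x - max 0 (x - d)) / d"

lemma has_real_derivative_max_sq: "((\<lambda>x. (max 0 x)\<^sup>2) has_real_derivative 2 * max 0 x) (at x)" for x :: real
proof (cases x "0::real" rule: linorder_cases)
  case less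
  have "((\<lambda>x::real. (max 0 x)\<^sup>2) has_real_derivative 0) (at x)"
    by (rule has_field_derivative_transform_within_open[of "\<lambda>_. 0" 0 x "{..<0}"]) (use less in auto)
  then show ?thesis using less by simp
next
  case greater
  have "((\<lambda>x::real. x\<^sup>2) has_real_derivative 2 * x) (at x)" by (auto intro!: derivative_eq_intros)
  then have "((\<lambda>x::real. (max 0 x)\<^sup>2) has_real_derivative 2 * x) (at x)"
    by (rule has_field_derivative_transform_within_open[of _ _ x "{0<..}"]) (use greater in auto)
  then show ?thesis using greater by simp
next
  case equal
  have "((\<lambda>h. ((max 0 (0 + h))\<^sup>2 - (max 0 0)\<^sup>2) / h) \<longlongrightarrow> 0) (at (0::real))"
  proof (rule tendsto_sandwich[of "\<lambda>h. - \<bar>h\<bar>" _ _ "\<lambda>h. \<bar>h\<bar>"])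
    show "\<forall>\<^sub>F h in at (0::real). - \<bar>h\<bar> \<le> ((max 0 (0 + h))\<^sup>2 - (max 0 0)\<^sup>2) / h"
      by (intro always_eventually allI) (auto simp: max_def power2_eq_square)
    show "\<forall>\<^sub>F h in at (0::real). ((max 0 (0 + h))\<^sup>2 - (max 0 0)\<^sup>2) / h \<le> \<bar>h\<bar>"
      by (intro always_eventually allI) (auto simp: max_def power2_eq_square)
    have "((\<lambda>h. - \<bar>h\<bar>) \<longlongrightarrow> - \<bar>0\<bar>) (at (0::real))" by (intro tendsto_intros)
    then show "((\<lambda>h. - \<bar>h\<bar>) \<longlongrightarrow> 0) (at (0::real))" by simp
    have "((\<lambda>h. \<bar>h\<bar>) \<longlongrightarrow> \<bar>0\<bar>) (at (0::real))" by (intro tendsto_intros)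
    then show "((\<lambda>h. \<bar>h\<bar>) \<longlongrightarrow> 0) (at (0::real))" by simp
  qed
  then show ?thesis using equal by (simp add: DERIV_def)
qed

lemma has_real_derivative_ramp:
  assumes "d > 0"
  shows "(ramp d has_real_derivative ramp' d x) (at x)"
proof -
  have "((\<lambda>x. ((max 0 x)\<^sup>2 - (max 0 (x - d))\<^sup>2) / (2 * d)) has_real_derivative
      (2 * max 0 x - 2 * max 0 (x - d) * (1 - 0)) / (2 * d)) (at x)"
    by (intro DERIV_cdivide DERIV_diff has_real_derivative_max_sq
        DERIV_chain2[OF has_real_derivative_max_sq] DERIV_ident DERIV_const)
  moreover have "(2 * max 0 x - 2 * max 0 (x - d) * (1 - 0)) / (2 * d) = ramp' d x"
    using assms by (simp add: ramp'_def field_simps)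
  ultimately show ?thesis by (simp add: ramp_def[abs_def])
qed

lemma ramp'_bounds: "d > 0 \<Longrightarrow> 0 \<le> ramp' d x" "d > 0 \<Longrightarrow> ramp' d x \<le> 1"
  by (auto simp: ramp'_def max_def)

lemma ramp_diff_bounds:
  assumes "d > 0" "x \<le> y"
  shows "ramp d x \<le> ramp d y" "ramp d y - ramp d x \<le> y - x"
proof -
  show "ramp d x \<le> ramp d y"
    using has_real_derivative_ramp[OF assms(1)] ramp'_bounds(1)[OF assms(1)]
    by (intro DERIV_nonneg_imp_nondecreasing[OF assms(2)]) blast
  have "x - ramp d x \<le> y - ramp d y"
  proof (rule DERIV_nonneg_imp_nondecreasing[OF assms(2)])
    fix z
    have "((\<lambda>x. x - ramp d x) has_real_derivative 1 - ramp' d z) (at z)"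
      by (intro DERIV_diff DERIV_ident has_real_derivative_ramp assms)
    then show "\<exists>l. ((\<lambda>x. x - ramp d x) has_real_derivative l) (at z) \<and> 0 \<le> l"
      using ramp'_bounds(2)[OF assms(1), of z] by (intro exI[of _ "1 - ramp' d z"]) simp
  qed
  then show "ramp d y - ramp d x \<le> y - x" by simp
qed

text \<open>Composed with \<open>v\<close>, this is the multiplier with which the field is tested.\<close>

definition level_cutoff :: "real \<Rightarrow> real \<Rightarrow> real \<Rightarrow> real \<Rightarrow> real" where
  "level_cutoff d s t x = ramp d (x - (s - d)) - ramp d (x - t)"

definition level_cutoff' :: "real \<Rightarrow> real \<Rightarrow> real \<Rightarrow> real \<Rightarrow> real" where
  "level_cutoff' d s t x = ramp' d (x - (s - d)) - ramp' d (x - t)"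

lemma level_cutoff_props:
  assumes "d > 0" "s \<le> t"
  shows "(level_cutoff d s t has_real_derivative level_cutoff' d s t x) (at x)"
    "0 \<le> level_cutoff' d s t x" "s \<le> x \<Longrightarrow> x \<le> t \<Longrightarrow> level_cutoff' d s t x = 1"
    "0 \<le> level_cutoff d s t x" "level_cutoff d s t x \<le> t - s + d"
    "x \<le> s - d \<Longrightarrow> level_cutoff d s t x = 0" "x \<le> s - d \<Longrightarrow> level_cutoff' d s t x = 0"
proof -
  have "((\<lambda>x. ramp d (x - (s - d)) - ramp d (x - t)) has_real_derivative
      ramp' d (x - (s - d)) * (1 - 0) - ramp' d (x - t) * (1 - 0)) (at x)"
    by (intro DERIV_diff DERIV_chain2[OF has_real_derivative_ramp[OF assms(1)]] DERIV_ident DERIV_const)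
  then show "(level_cutoff d s t has_real_derivative level_cutoff' d s t x) (at x)"
    by (simp add: level_cutoff_def[abs_def] level_cutoff'_def)
  have "max 0 (x - t) - max 0 (x - t - d) \<le> max 0 (x - (s - d)) - max 0 (x - (s - d) - d)"
    using assms by (auto simp: max_def)
  then show "0 \<le> level_cutoff' d s t x"
    using assms(1) by (simp add: level_cutoff'_def ramp'_def divide_right_mono)
  show "level_cutoff' d s t x = 1" if "s \<le> x" "x \<le> t"
    using that assms by (auto simp: level_cutoff'_def ramp'_def max_def)
  show "0 \<le> level_cutoff d s t x" "level_cutoff d s t x \<le> t - s + d"
    using ramp_diff_bounds[OF assms(1), of "x - t" "x - (s - d)"] assms by (auto simp: level_cutoff_def)
  show "x \<le> s - d \<Longrightarrow> level_cutoff d s t x = 0" "x \<le> s - d \<Longrightarrow> level_cutoff' d s t x = 0"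
    using assms by (auto simp: level_cutoff_def level_cutoff'_def ramp_def ramp'_def)
qed

lemma continuous_level_cutoff: "d > 0 \<Longrightarrow> s \<le> t \<Longrightarrow> continuous_on A (level_cutoff d s t)"
  using level_cutoff_props(1) by (meson DERIV_isCont continuous_at_imp_continuous_on)

lemma continuous_level_cutoff': "d > 0 \<Longrightarrow> continuous_on A (level_cutoff' d s t)"
  unfolding level_cutoff'_def[abs_def] ramp'_def by (intro continuous_intros) auto

text \<open>The divergence of the field \<open>W\<close>, the cutoff of \<open>v\<close> times
  \<open>V\<close>, contains \<open>V\<close> only through its divergence \<open>- G\<close> and the
  product \<open>V x \<bullet> Dv x = E x\<close>. Both are continuous, which is what the divergence
  theorem for differentiable fields asks for.\<close>

lemma superlevel_energy_identity:
  fixes v :: "'a::euclidean_space \<Rightarrow> real"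
  assumes v: "continuous_on UNIV v" "bounded {x. v x > 0}"
    and der: "\<And>x. v x > 0 \<Longrightarrow> (v has_derivative (\<lambda>h. Dv x \<bullet> h)) (at x)"
    and V: "\<And>x. v x > 0 \<Longrightarrow> V differentiable (at x)" "\<And>x. v x > 0 \<Longrightarrow> divergence V x = - G x"
      "\<And>x. v x > 0 \<Longrightarrow> V x \<bullet> Dv x = E x"
    and G: "continuous_on {x. v x > 0} G" and E: "continuous_on {x. v x > 0} E"
    and st: "0 < d" "d < s" "s \<le> t"
  shows "(\<integral>x. indicator {x. s - d \<le> v x} x * (level_cutoff' d s t (v x) * E x) \<partial>lborel)
       = (\<integral>x. indicator {x. s - d \<le> v x} x * (level_cutoff d s t (v x) * G x) \<partial>lborel)"
proof -
  note cp = level_cutoff_props[OF st(1,3)]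
  define W where "W x = (if v x > 0 then level_cutoff d s t (v x) *\<^sub>R V x else 0)" for x
  define W' where "W' x = (if v x > 0
    then (\<lambda>h. level_cutoff d s t (v x) *\<^sub>R frechet_derivative V (at x) h + (level_cutoff' d s t (v x) * (Dv x \<bullet> h)) *\<^sub>R V x)
    else (\<lambda>_. 0))" for x
  define D where "D x = (\<Sum>i\<in>Basis. W' x i \<bullet> i)" for x
  have X: "open {x. v x > 0}" using v(1) by (intro open_Collect_less) auto
  have Y: "open {x. v x < s - d}" using v(1) by (intro open_Collect_less) auto
  \<comment> \<open>Two open sets cover the space since \<open>s - d > 0\<close>, and
    \<open>W\<close> vanishes on the second one. Differentiability and continuity can thus be
    checked on each set separately, and the boundary of the positivity set causes no
    difficulty.\<close>
  have XY: "v x > 0 \<or> v x < s - d" for x using st by linarith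
  have D: "D x = level_cutoff' d s t (v x) * E x - level_cutoff d s t (v x) * G x" if x: "v x > 0" for x
  proof -
    have "D x = level_cutoff d s t (v x) * divergence V x + level_cutoff' d s t (v x) * (\<Sum>i\<in>Basis. (Dv x \<bullet> i) * (V x \<bullet> i))"
      using x by (simp add: D_def W'_def divergence_def inner_add sum.distrib sum_distrib_left mult_ac)
    also have "(\<Sum>i\<in>Basis. (Dv x \<bullet> i) * (V x \<bullet> i)) = V x \<bullet> Dv x"
      by (subst inner_commute) (rule euclidean_inner[symmetric])
    finally show ?thesis using V(2,3)[OF x] by simp
  qed
  have D0: "D x = 0" if "v x < s - d" for x
    using that cp(6,7)[of "v x"] by (simp add: D_def W'_def)
  have der_W: "(W has_derivative W' x) (at x)" for x
  proof (cases "v x > 0")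
    case True
    have "(V has_derivative frechet_derivative V (at x)) (at x)"
      using V(1)[OF True] by (simp add: frechet_derivative_works)
    moreover have "((\<lambda>x. level_cutoff d s t (v x)) has_derivative (\<lambda>h. level_cutoff' d s t (v x) * (Dv x \<bullet> h))) (at x)"
      using has_derivative_compose[OF der[OF True] cp(1)[of "v x", unfolded has_field_derivative_def]] .
    ultimately have "((\<lambda>x. level_cutoff d s t (v x) *\<^sub>R V x) has_derivative
      (\<lambda>h. level_cutoff d s t (v x) *\<^sub>R frechet_derivative V (at x) h + (level_cutoff' d s t (v x) * (Dv x \<bullet> h)) *\<^sub>R V x)) (at x)"
      by (rule has_derivative_scaleR[rotated])
    then have "(W has_derivative
      (\<lambda>h. level_cutoff d s t (v x) *\<^sub>R frechet_derivative V (at x) h + (level_cutoff' d s t (v x) * (Dv x \<bullet> h)) *\<^sub>R V x)) (at x)"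
      by (rule has_derivative_transform_within_open[OF _ X]) (use True in \<open>auto simp: W_def\<close>)
    then show ?thesis using True by (simp add: W'_def)
  next
    case False
    then have lt: "v x < s - d" using XY by blast
    have "(W has_derivative (\<lambda>_. 0)) (at x)"
      by (rule has_derivative_transform_within_open[OF has_derivative_const[of 0] Y]) (use lt in \<open>auto simp: W_def cp\<close>)
    then show ?thesis using False by (simp add: W'_def)
  qed
  have contD: "continuous_on UNIV D"
  proof -
    have "continuous_on {x. v x > 0} (\<lambda>x. level_cutoff' d s t (v x) * E x - level_cutoff d s t (v x) * G x)"
      by (intro continuous_intros E G continuous_on_compose2[OF continuous_level_cutoff'[OF st(1), of UNIV]]
          continuous_on_compose2[OF continuous_level_cutoff[OF st(1,3), of UNIV]] continuous_on_subset[OF v(1)]) auto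
    then have "continuous_on {x. v x > 0} D" by (rule continuous_on_eq) (simp add: D)
    moreover have "continuous_on {x. v x < s - d} D"
      by (rule continuous_on_eq[of _ "\<lambda>_. 0"]) (auto simp: D0)
    ultimately have "continuous_on ({x. v x > 0} \<union> {x. v x < s - d}) D"
      using X Y by (intro continuous_on_open_Un)
    moreover have "{x. v x > 0} \<union> {x. v x < s - d} = UNIV" using XY by auto
    ultimately show ?thesis by simp
  qed
  obtain b where b: "\<And>x. v x > 0 \<Longrightarrow> norm x \<le> b" using v(2) by (auto simp: bounded_iff)
  have int0: "(D has_integral 0) UNIV"
    unfolding D_def
  proof (rule integral_divergence_eq_0[OF der_W])
    show "continuous_on UNIV (\<lambda>x. \<Sum>i\<in>Basis. W' x i \<bullet> i)" using contD by (simp add: D_def[abs_def])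
    show "W x = 0" if "norm x > b" for x using b[of x] that by (auto simp: W_def)
  qed
  let ?A = "\<lambda>x. indicator {x. s - d \<le> v x} x * (level_cutoff' d s t (v x) * E x)"
  let ?B = "\<lambda>x. indicator {x. s - d \<le> v x} x * (level_cutoff d s t (v x) * G x)"
  have iA: "integrable lborel ?A"
    using st by (intro integrable_superlevel[OF v, of _ "s - d"] superlevel_sets v continuous_intros E
        continuous_on_compose2[OF continuous_level_cutoff'[OF st(1), of UNIV]] continuous_on_subset[OF v(1)]) auto
  have iB: "integrable lborel ?B"
    using st by (intro integrable_superlevel[OF v, of _ "s - d"] superlevel_sets v continuous_intros G
        continuous_on_compose2[OF continuous_level_cutoff[OF st(1,3), of UNIV]] continuous_on_subset[OF v(1)]) auto
  have DAB: "D x = ?A x - ?B x" for x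
  proof (cases "s - d \<le> v x")
    case True
    then show ?thesis using D[of x] st by simp
  qed (simp add: D0)
  have "(D has_integral (\<integral>x. ?A x - ?B x \<partial>lborel)) UNIV"
    unfolding DAB[abs_def] by (rule has_integral_integral_lborel) (rule Bochner_Integration.integrable_diff[OF iA iB])
  then have "(\<integral>x. ?A x - ?B x \<partial>lborel) = 0" using int0 has_integral_unique by blast
  then show ?thesis using Bochner_Integration.integral_diff[OF iA iB] by simp
qed

text \<open>The cutoff has slope 1 on \<open>{s..t}\<close> and height at most
  \<open>t - s + d\<close>. The identity therefore bounds the energy of the layer by
  \<open>t - s + d\<close> times the integral of \<open>G\<close> above \<open>s - d\<close>, and
  left continuity removes \<open>d\<close>.\<close>

proposition superlevel_energy:
  fixes v :: "'a::euclidean_space \<Rightarrow> real"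
  assumes v: "continuous_on UNIV v" "bounded {x. v x > 0}"
    and der: "\<And>x. v x > 0 \<Longrightarrow> (v has_derivative (\<lambda>h. Dv x \<bullet> h)) (at x)"
    and V: "\<And>x. v x > 0 \<Longrightarrow> V differentiable (at x)" "\<And>x. v x > 0 \<Longrightarrow> divergence V x = - G x"
      "\<And>x. v x > 0 \<Longrightarrow> V x \<bullet> Dv x = E x"
    and G: "continuous_on {x. v x > 0} G" "\<And>x. v x > 0 \<Longrightarrow> 0 \<le> G x"
    and E: "continuous_on {x. v x > 0} E" "\<And>x. v x > 0 \<Longrightarrow> 0 \<le> E x"
    and st: "0 < s" "s \<le> t"
  shows "(\<integral>x. indicator {x. s \<le> v x \<and> v x < t} x * E x \<partial>lborel) \<le> (t - s) * (\<integral>x. indicator {x. s \<le> v x} x * G x \<partial>lborel)"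
proof -
  define d where "d k = (s / 2) * inverse (real (Suc k))" for k
  have d: "0 < d k" "d k \<le> s / 2" for k
    using st by (auto simp: d_def divide_simps)
  have ds: "d k < s" for k using d(2)[of k] st by linarith
  have d0: "d \<longlonglongrightarrow> 0" unfolding d_def using tendsto_mult[OF tendsto_const LIMSEQ_inverse_real_of_nat, of "s / 2"] by simp
  let ?I = "\<lambda>r. \<integral>x. indicator {x. r \<le> v x} x * G x \<partial>lborel"
  have le: "(\<integral>x. indicator {x. s \<le> v x \<and> v x < t} x * E x \<partial>lborel) \<le> (t - s + d k) * ?I (s - d k)" for k
  proof -
    have sd: "s - d k > 0" using ds[of k] by simp
    note cp = level_cutoff_props[OF d(1)[of k] st(2)]
    have "(\<integral>x. indicator {x. s \<le> v x \<and> v x < t} x * E x \<partial>lborel)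
      \<le> (\<integral>x. indicator {x. s - d k \<le> v x} x * (level_cutoff' (d k) s t (v x) * E x) \<partial>lborel)"
    proof (rule integral_mono)
      show "integrable lborel (\<lambda>x. indicator {x. s \<le> v x \<and> v x < t} x * E x)"
        by (intro integrable_superlevel[OF v E(1) st(1)] superlevel_sets v) auto
      show "integrable lborel (\<lambda>x. indicator {x. s - d k \<le> v x} x * (level_cutoff' (d k) s t (v x) * E x))"
        using sd by (intro integrable_superlevel[OF v, of _ "s - d k"] superlevel_sets v continuous_intros E
          continuous_on_compose2[OF continuous_level_cutoff'[OF d(1), of UNIV]] continuous_on_subset[OF v(1)]) auto
      fix x
      show "indicator {x. s \<le> v x \<and> v x < t} x * E x \<le> indicator {x. s - d k \<le> v x} x * (level_cutoff' (d k) s t (v x) * E x)"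
        using cp(2,3)[of "v x"] E(2)[of x] sd d(1)[of k] by (auto simp: indicator_def)
    qed
    also have "\<dots> = (\<integral>x. indicator {x. s - d k \<le> v x} x * (level_cutoff (d k) s t (v x) * G x) \<partial>lborel)"
      by (rule superlevel_energy_identity[OF v der V G(1) E(1) d(1) ds st(2)])
    also have "\<dots> \<le> (\<integral>x. (t - s + d k) * (indicator {x. s - d k \<le> v x} x * G x) \<partial>lborel)"
    proof (rule integral_mono)
      show "integrable lborel (\<lambda>x. indicator {x. s - d k \<le> v x} x * (level_cutoff (d k) s t (v x) * G x))"
        using sd by (intro integrable_superlevel[OF v, of _ "s - d k"] superlevel_sets v continuous_intros G
          continuous_on_compose2[OF continuous_level_cutoff[OF d(1) st(2), of UNIV]] continuous_on_subset[OF v(1)]) auto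
      show "integrable lborel (\<lambda>x. (t - s + d k) * (indicator {x. s - d k \<le> v x} x * G x))"
        using sd by (intro integrable_mult_right integrable_superlevel[OF v G(1) sd] superlevel_sets v) auto
      fix x
      show "indicator {x. s - d k \<le> v x} x * (level_cutoff (d k) s t (v x) * G x) \<le> (t - s + d k) * (indicator {x. s - d k \<le> v x} x * G x)"
        using cp(5)[of "v x"] G(2)[of x] sd by (auto simp: indicator_def intro!: mult_right_mono)
    qed
    finally show ?thesis by simp
  qed
  have "(\<lambda>k. (t - s + d k) * ?I (s - d k)) \<longlonglongrightarrow> (t - s + 0) * ?I s"
    using d by (intro tendsto_intros d0 tendsto_integral_superlevel[OF v G(1) st(1)]) (auto intro: less_imp_le)
  then have "(\<integral>x. indicator {x. s \<le> v x \<and> v x < t} x * E x \<partial>lborel) \<le> (t - s + 0) * ?I s"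
    by (rule LIMSEQ_le_const) (use le in auto)
  then show ?thesis by simp
qed

section \<open>Jensen's inequality and the inequality between two levels\<close>

lemma power_tangent_le:
  fixes x y :: real
  assumes "0 \<le> x" "0 < y"
  shows "y ^ n + n * y ^ (n - 1) * (x - y) \<le> x ^ n"
proof (cases n)
  case (Suc k)
  have "y ^ n + n * y ^ (n - 1) * (x - y) = y ^ n * (1 + n * (x / y - 1))"
    using assms Suc by (simp add: field_simps)
  also have "\<dots> \<le> y ^ n * (1 + (x / y - 1)) ^ n"
    using assms by (intro mult_left_mono Bernoulli_inequality) auto
  also have "\<dots> = (y * (x / y)) ^ n" by (simp only: power_mult_distrib) simp
  also have "\<dots> = x ^ n" using assms by simp
  finally show ?thesis .
qed simp

text \<open>Jensen's inequality by integrating a tangent line of the power. The point of tangency is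
  the mean value \<open>A / m\<close>, so the linear term integrates to 0.\<close>

lemma integral_power_mean:
  fixes f :: "'a \<Rightarrow> real"
  assumes S: "S \<in> sets M" "emeasure M S < \<infinity>" and f: "\<And>x. x \<in> S \<Longrightarrow> 0 \<le> f x"
    and int: "integrable M (\<lambda>x. indicator S x * f x)" "integrable M (\<lambda>x. indicator S x * f x ^ n)"
    and n: "n \<ge> 1"
  shows "(\<integral>x. indicator S x * f x \<partial>M) ^ n \<le> measure M S ^ (n - 1) * (\<integral>x. indicator S x * f x ^ n \<partial>M)"
proof -
  define A where "A = (\<integral>x. indicator S x * f x \<partial>M)"
  define B where "B = (\<integral>x. indicator S x * f x ^ n \<partial>M)"
  define m where "m = measure M S"
  have A0: "A \<ge> 0" unfolding A_def using f by (intro integral_nonneg_AE AE_I2) (auto simp: indicator_def)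
  have B0: "B \<ge> 0" unfolding B_def using f by (intro integral_nonneg_AE AE_I2) (auto simp: indicator_def)
  have m0: "m \<ge> 0" by (simp add: m_def)
  have "A ^ n \<le> m ^ (n - 1) * B"
  proof (cases "A = 0")
    case True
    then have "A ^ n = 0" using n by simp
    then show ?thesis using mult_nonneg_nonneg[OF zero_le_power[OF m0, of "n - 1"] B0] by linarith
  next
    case False
    then have A: "A > 0" using A0 by simp
    have m: "m > 0"
    proof (rule ccontr)
      assume "\<not> m > 0"
      then have "m = 0" using m0 by simp
      then have "emeasure M S = 0" using S(2) by (simp add: m_def emeasure_eq_ennreal_measure)
      then have "AE x in M. x \<notin> S" using S by (intro AE_not_in) auto
      then have "AE x in M. indicator S x * f x = 0" by eventually_elim simp
      then have "A = 0" unfolding A_def by (rule integral_eq_zero_AE)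
      then show False using A by simp
    qed
    define y where "y = A / m"
    have y: "y > 0" using A m by (simp add: y_def)
    have Sint: "integrable M (indicator S :: 'a \<Rightarrow> real)" using S by (intro integrable_real_indicator)
    have "(\<integral>x. (y ^ n - n * y ^ (n - 1) * y) * indicator S x + n * y ^ (n - 1) * (indicator S x * f x) \<partial>M) \<le> B"
      unfolding B_def
    proof (rule integral_mono)
      fix x
      show "(y ^ n - n * y ^ (n - 1) * y) * indicator S x + n * y ^ (n - 1) * (indicator S x * f x) \<le> indicator S x * f x ^ n"
        using power_tangent_le[OF f y, of x n] by (auto simp: indicator_def algebra_simps)
    qed (use int Sint in \<open>auto intro!: integrable_mult_right Bochner_Integration.integrable_add\<close>)
    also have "(\<integral>x. (y ^ n - n * y ^ (n - 1) * y) * indicator S x + n * y ^ (n - 1) * (indicator S x * f x) \<partial>M)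
      = (y ^ n - n * y ^ (n - 1) * y) * m + n * y ^ (n - 1) * A"
      using int Sint S by (subst Bochner_Integration.integral_add) (auto simp: m_def A_def intro!: integrable_mult_right)
    also have "\<dots> = y ^ n * m" using m by (simp add: y_def algebra_simps)
    finally have "m ^ (n - 1) * (y ^ n * m) \<le> m ^ (n - 1) * B" using m by (intro mult_left_mono) auto
    moreover have "m ^ (n - 1) * (y ^ n * m) = A ^ n"
    proof -
      have "m ^ (n - 1) * (y ^ n * m) = (m ^ (n - 1) * m) * y ^ n" by simp
      also have "m ^ (n - 1) * m = m ^ n" using n by (metis One_nat_def Suc_pred less_eq_Suc_le power_Suc2)
      also have "m ^ n * y ^ n = (m * y) ^ n" by (simp add: power_mult_distrib)
      finally show ?thesis using m by (simp add: y_def)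
    qed
    ultimately show ?thesis by simp
  qed
  then show ?thesis by (simp add: A_def B_def m_def)
qed

text \<open>The isoperimetric bound is raised to the power n, which clears the roots, and is chained
  with Jensen and the energy bound. The left side carries \<open>(t - s) ^ n\<close> and the energy
  bound one factor \<open>t - s\<close>; cancelling it leaves
  \<open>(t - s) ^ (n - 1)\<close>.\<close>

lemma superlevel_inequality:
  fixes v F G :: "'a::euclidean_space \<Rightarrow> real"
  assumes dim: "DIM('a) \<ge> 2"
    and v: "continuous_on UNIV v" "bounded {x. v x > 0}"
    and der: "\<And>x. v x > 0 \<Longrightarrow> (v has_derivative (\<lambda>h. Dv x \<bullet> h)) (at x)"
    and Dv: "continuous_on {x. v x > 0} Dv"
    and F: "continuous_on UNIV F" "\<And>\<xi>. 0 \<le> F \<xi>"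
    and K: "convex K" "bounded K" "interior K \<noteq> {}" "\<And>z \<xi>. z \<in> K \<Longrightarrow> - (z \<bullet> \<xi>) \<le> F \<xi>"
    and V: "\<And>x. v x > 0 \<Longrightarrow> V differentiable (at x)" "\<And>x. v x > 0 \<Longrightarrow> divergence V x = - (DIM('a) * G x)"
      "\<And>x. v x > 0 \<Longrightarrow> V x \<bullet> Dv x = DIM('a) * F (Dv x) ^ DIM('a)"
    and G: "continuous_on {x. v x > 0} G" "\<And>x. v x > 0 \<Longrightarrow> 0 \<le> G x"
    and st: "0 < s" "s < t"
  shows "real DIM('a) ^ DIM('a) * measure lebesgue K * (measure lebesgue {x. t \<le> v x} * (t - s)) ^ (DIM('a) - 1)
    \<le> (\<integral>x. indicator {x. s \<le> v x} x * G x \<partial>lborel) *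
        (measure lebesgue {x. s \<le> v x} - measure lebesgue {x. t \<le> v x}) ^ (DIM('a) - 1)"
proof -
  let ?n = "DIM('a)" let ?S = "{x. s \<le> v x \<and> v x < t}"
  define \<mu> where "\<mu> = measure lebesgue {x. t \<le> v x}"
  define \<kappa> where "\<kappa> = measure lebesgue K"
  define I where "I = (\<integral>x. indicator {x. s \<le> v x} x * G x \<partial>lborel)"
  define A where "A = (\<integral>x. indicator ?S x * F (Dv x) \<partial>lborel)"
  define B where "B = (\<integral>x. indicator ?S x * F (Dv x) ^ ?n \<partial>lborel)"
  have f: "continuous_on {x. v x > 0} (\<lambda>x. F (Dv x))"
    by (rule continuous_on_compose2[OF F(1) Dv]) simp
  have iso: "?n * root ?n \<kappa> * root ?n \<mu> ^ (?n - 1) * (t - s) \<le> A"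
    unfolding \<kappa>_def \<mu>_def A_def by (rule superlevel_isoperimetric[OF dim v der Dv F K st])
  have "(\<integral>x. indicator ?S x * (?n * F (Dv x) ^ ?n) \<partial>lborel) \<le> (t - s) * (\<integral>x. indicator {x. s \<le> v x} x * (?n * G x) \<partial>lborel)"
    using F(2) G st by (intro superlevel_energy[OF v der V]) (auto intro!: continuous_intros f)
  moreover have "(\<integral>x. indicator ?S x * (?n * F (Dv x) ^ ?n) \<partial>lborel) = ?n * B"
    unfolding B_def by (subst integral_mult_right_zero[symmetric]) (simp add: mult_ac)
  moreover have "(\<integral>x. indicator {x. s \<le> v x} x * (?n * G x) \<partial>lborel) = ?n * I"
    unfolding I_def by (subst integral_mult_right_zero[symmetric]) (simp add: mult_ac)
  ultimately have "?n * B \<le> ?n * ((t - s) * I)" by (simp add: mult_ac)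
  then have en: "B \<le> (t - s) * I" by simp
  have Sb: "?S \<in> sets borel" by (rule superlevel_sets[OF v(1)])
  have comp: "compact {x. r \<le> v x}" if "r > 0" for r by (rule compact_superlevel[OF v that])
  have m: "measure lborel ?S = measure lebesgue {x. s \<le> v x} - \<mu>"
  proof -
    have "?S = {x. s \<le> v x} - {x. t \<le> v x}" by auto
    moreover have "measure lebesgue ({x. s \<le> v x} - {x. t \<le> v x}) = measure lebesgue {x. s \<le> v x} - measure lebesgue {x. t \<le> v x}"
      by (rule measurable_measure_Diff) (use comp[of s] comp[of t] st in \<open>auto simp: lmeasurable_compact fmeasurableD\<close>)
    ultimately have "measure lebesgue ?S = measure lebesgue {x. s \<le> v x} - measure lebesgue {x. t \<le> v x}" by metis
    then show ?thesis using Sb by (simp add: \<mu>_def)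
  qed
  have jensen: "A ^ ?n \<le> measure lborel ?S ^ (?n - 1) * B"
    unfolding A_def B_def
  proof (rule integral_power_mean)
    show "?S \<in> sets lborel" using Sb by simp
    show "emeasure lborel ?S < \<infinity>"
      by (intro emeasure_bounded_finite bounded_subset[OF compact_imp_bounded[OF comp[OF st(1)]]]) auto
    show "integrable lborel (\<lambda>x. indicator ?S x * F (Dv x))"
      by (intro integrable_superlevel[OF v f st(1)] Sb) auto
    show "integrable lborel (\<lambda>x. indicator ?S x * F (Dv x) ^ ?n)"
      by (intro integrable_superlevel[OF v _ st(1)] Sb continuous_intros f) auto
  qed (use F dim in auto)
  have "(?n * root ?n \<kappa> * root ?n \<mu> ^ (?n - 1) * (t - s)) ^ ?n \<le> A ^ ?n"
    using iso st by (intro power_mono) (auto simp: \<kappa>_def \<mu>_def real_root_ge_zero)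
  also have "(?n * root ?n \<kappa> * root ?n \<mu> ^ (?n - 1) * (t - s)) ^ ?n
     = real ?n ^ ?n * root ?n \<kappa> ^ ?n * (root ?n \<mu> ^ ?n) ^ (?n - 1) * (t - s) ^ ?n"
    by (simp add: power_mult_distrib flip: power_mult) (simp add: mult.commute)
  also have "\<dots> = (t - s) * (real ?n ^ ?n * \<kappa> * (\<mu> * (t - s)) ^ (?n - 1))"
  proof -
    have "(t - s) ^ ?n = (t - s) * (t - s) ^ (?n - 1)"
      using dim by (metis DIM_positive power_eq_if less_numeral_extra(3))
    then show ?thesis by (simp add: \<kappa>_def \<mu>_def power_mult_distrib)
  qed
  also have "A ^ ?n \<le> measure lborel ?S ^ (?n - 1) * B" by (rule jensen)
  also have "\<dots> \<le> measure lborel ?S ^ (?n - 1) * ((t - s) * I)" by (intro mult_left_mono en) simp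
  finally have "(t - s) * (real ?n ^ ?n * \<kappa> * (\<mu> * (t - s)) ^ (?n - 1)) \<le> (t - s) * (I * measure lborel ?S ^ (?n - 1))"
    by (simp add: mult_ac)
  then have "real ?n ^ ?n * \<kappa> * (\<mu> * (t - s)) ^ (?n - 1) \<le> I * measure lborel ?S ^ (?n - 1)"
    using st by simp
  then show ?thesis unfolding m by (simp add: \<kappa>_def \<mu>_def I_def)
qed

section \<open>Integration over the levels\<close>

text \<open>A convex function lies above its tangent at \<open>b\<close>. The function is the
  primitive of \<open>y powr q\<close>, chosen so that the factor \<open>I powr q\<close> of the
  level inequality becomes a derivative.\<close>

lemma powr_diff_ge:
  fixes a b q :: real
  assumes "0 < b" "b \<le> a" "0 < q"
  shows "b powr q * (a - b) \<le> a powr (q + 1) / (q + 1) - b powr (q + 1) / (q + 1)"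
proof -
  have "b powr (q + 1) / (q + 1) - b powr q * b \<le> a powr (q + 1) / (q + 1) - b powr q * a"
  proof (rule DERIV_nonneg_imp_nondecreasing[OF assms(2)])
    fix y assume y: "b \<le> y" "y \<le> a"
    have "((\<lambda>y. y powr (q + 1) / (q + 1) - b powr q * y) has_real_derivative y powr q - b powr q) (at y)"
      using assms y by (auto intro!: derivative_eq_intros)
    moreover have "b powr q \<le> y powr q" using assms y by (intro powr_mono2) auto
    ultimately show "\<exists>l. ((\<lambda>y. y powr (q + 1) / (q + 1) - b powr q * y) has_real_derivative l) (at y) \<and> 0 \<le> l"
      by (intro exI[of _ "y powr q - b powr q"]) simp
  qed
  then show ?thesis by (simp add: algebra_simps)
qed

text \<open>Shifting by \<open>h\<close> makes the two integrals telescope: what remains is the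
  integral of \<open>J\<close> over an interval of length \<open>h\<close> below 0, where
  \<open>J\<close> is \<open>j\<close>. Boundedness of \<open>J\<close> and its vanishing above
  \<open>M\<close> make the common part finite, hence cancellable.\<close>

lemma nn_integral_decreasing_quotient_le:
  fixes J :: "real \<Rightarrow> real"
  assumes anti: "\<And>s t. s \<le> t \<Longrightarrow> J t \<le> J s" and J0: "\<And>s. 0 \<le> J s" "\<And>s. s \<le> 0 \<Longrightarrow> J s = j"
    and J1: "\<And>s. s > M \<Longrightarrow> J s = 0" and h: "h > 0"
  shows "(\<integral>\<^sup>+t. ennreal ((J (t - h) - J t) / h) * indicator {0<..} t \<partial>lborel) \<le> ennreal j"
proof -
  have "mono (\<lambda>s. - J s)" using anti by (auto intro!: monoI)
  then have "(\<lambda>s. - J s) \<in> borel_measurable borel" by (rule borel_measurable_mono)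
  then have "(\<lambda>s. - (- J s)) \<in> borel_measurable borel" by (rule borel_measurable_uminus)
  then have [measurable]: "J \<in> borel_measurable borel" by simp
  have j: "j \<ge> 0" using J0(1)[of 0] J0(2)[of 0] by simp
  have Jj: "J s \<le> j" for s using anti[of "min s 0" s] J0(2)[of "min s 0"] by simp
  let ?P = "\<integral>\<^sup>+t. ennreal (J t) * indicator {0<..} t \<partial>lborel"
  have fin: "?P < \<infinity>"
  proof -
    have "?P \<le> (\<integral>\<^sup>+t. ennreal j * indicator {0..\<bar>M\<bar>} t \<partial>lborel)"
    proof (rule nn_integral_mono)
      fix t
      show "ennreal (J t) * indicator {0<..} t \<le> ennreal j * indicator {0..\<bar>M\<bar>} t"
        using J1[of t] Jj[of t] by (auto simp: indicator_def intro: ennreal_leI)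
    qed
    also have "\<dots> < \<infinity>" by (simp add: nn_integral_cmult_indicator ennreal_mult_less_top)
    finally show ?thesis .
  qed
  have "(\<integral>\<^sup>+t. ennreal (J (t - h) - J t) * indicator {0<..} t \<partial>lborel) + ?P
     = (\<integral>\<^sup>+t. ennreal (J (t - h) - J t) * indicator {0<..} t + ennreal (J t) * indicator {0<..} t \<partial>lborel)"
    by (rule nn_integral_add[symmetric]) measurable
  also have "\<dots> = (\<integral>\<^sup>+t. ennreal (J (t - h)) * indicator {0<..} t \<partial>lborel)"
  proof (rule nn_integral_cong)
    fix t
    have "ennreal (J (t - h) - J t) + ennreal (J t) = ennreal (J (t - h))"
      using anti[of "t - h" t] h J0(1)[of t] by (simp flip: ennreal_plus)
    then show "ennreal (J (t - h) - J t) * indicator {0<..} t + ennreal (J t) * indicator {0<..} t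
        = ennreal (J (t - h)) * indicator {0<..} t"
      by (simp add: indicator_def)
  qed
  also have "\<dots> = (\<integral>\<^sup>+t. ennreal (J t) * indicator {-h<..} t \<partial>lborel)"
    by (subst (2) nn_integral_real_affine[where c = 1 and t = "- h"])
       (auto intro!: nn_integral_cong simp: indicator_def)
  also have "\<dots> = (\<integral>\<^sup>+t. ennreal j * indicator {-h<..0} t + ennreal (J t) * indicator {0<..} t \<partial>lborel)"
    using h J0(2) by (intro nn_integral_cong) (auto simp: indicator_def)
  also have "\<dots> = (\<integral>\<^sup>+t. ennreal j * indicator {-h<..0} t \<partial>lborel) + ?P"
    by (rule nn_integral_add) measurable
  also have "(\<integral>\<^sup>+t. ennreal j * indicator {-h<..0} t \<partial>lborel) = ennreal (j * h)"
    using h j by (simp add: nn_integral_cmult_indicator ennreal_mult)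
  finally have "(\<integral>\<^sup>+t. ennreal (J (t - h) - J t) * indicator {0<..} t \<partial>lborel) + ?P = ennreal (j * h) + ?P" .
  then have eq: "(\<integral>\<^sup>+t. ennreal (J (t - h) - J t) * indicator {0<..} t \<partial>lborel) = ennreal (j * h)"
    using fin by (auto simp: add.commute[of _ ?P] ennreal_add_left_cancel)
  have "(\<integral>\<^sup>+t. ennreal ((J (t - h) - J t) / h) * indicator {0<..} t \<partial>lborel)
    = (\<integral>\<^sup>+t. ennreal (1 / h) * (ennreal (J (t - h) - J t) * indicator {0<..} t) \<partial>lborel)"
  proof (rule nn_integral_cong)
    fix t
    have "ennreal ((J (t - h) - J t) / h) = ennreal (1 / h) * ennreal (J (t - h) - J t)"
      using anti[of "t - h" t] h by (simp flip: ennreal_mult)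
    then show "ennreal ((J (t - h) - J t) / h) * indicator {0<..} t
      = ennreal (1 / h) * (ennreal (J (t - h) - J t) * indicator {0<..} t)"
      by (simp add: mult.assoc)
  qed
  also have "\<dots> = ennreal (1 / h) * ennreal (j * h)"
    by (subst nn_integral_cmult) (measurable, simp add: eq)
  also have "\<dots> = ennreal j" using h j by (simp flip: ennreal_mult)
  finally show ?thesis by simp
qed

text \<open>Neither \<open>I\<close> nor \<open>\<mu>\<close> is differentiated: the argument uses backward difference quotients and Fatou's
  lemma. Since \<open>I\<close> is left continuous the pointwise lower bound holds at every level, so jumps of
  \<open>I\<close> and \<open>\<mu>\<close> do no harm.\<close>

proposition level_set_integral_inequality:
  fixes I \<mu> g :: "real \<Rightarrow> real"
  assumes q: "q > 0" and C: "C \<ge> 0"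
    and I: "\<And>s t. s \<le> t \<Longrightarrow> I t \<le> I s" "\<And>s. 0 \<le> I s" "\<And>s. s \<le> 0 \<Longrightarrow> I s = I0" "\<And>s. s > M \<Longrightarrow> I s = 0"
    and I_left: "\<And>s d. s > 0 \<Longrightarrow> d \<longlonglongrightarrow> 0 \<Longrightarrow> (\<And>k. 0 \<le> d k) \<Longrightarrow> (\<And>k. d k \<le> s / 2) \<Longrightarrow> (\<lambda>k. I (s - d k)) \<longlonglongrightarrow> I s"
    and \<mu>: "\<And>s t. s \<le> t \<Longrightarrow> \<mu> t \<le> \<mu> s" "\<And>s. 0 \<le> \<mu> s"
    and g: "continuous_on UNIV g" "\<And>s. s \<ge> 0 \<Longrightarrow> 0 \<le> g s"
    and iso: "\<And>s t. 0 < s \<Longrightarrow> s < t \<Longrightarrow> C * \<mu> t * (t - s) \<le> I s powr q * (\<mu> s - \<mu> t)"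
    and drop: "\<And>s t m. 0 < s \<Longrightarrow> s < t \<Longrightarrow> (\<And>r. s \<le> r \<Longrightarrow> r \<le> t \<Longrightarrow> m \<le> g r) \<Longrightarrow> m * (\<mu> s - \<mu> t) \<le> I s - I t"
    and degen: "\<And>s. 0 < s \<Longrightarrow> I s = 0 \<Longrightarrow> g s * \<mu> s = 0"
  shows "(\<integral>\<^sup>+t. ennreal (C * g t * \<mu> t) * indicator {0<..} t \<partial>lborel) \<le> ennreal (I0 powr (q + 1) / (q + 1))"
proof -
  define J where "J s = I s powr (q + 1) / (q + 1)" for s
  have J: "s \<le> t \<Longrightarrow> J t \<le> J s" "0 \<le> J s" for s t
    using I(1)[of s t] I(2)[of t] q by (auto simp: J_def intro!: divide_right_mono powr_mono2)
  have J': "s \<le> 0 \<Longrightarrow> J s = I0 powr (q + 1) / (q + 1)" "s > M \<Longrightarrow> J s = 0" for s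
    using I(3,4)[of s] by (auto simp: J_def)
  have "mono (\<lambda>s. - J s)" using J(1) by (auto intro!: monoI)
  then have "(\<lambda>s. - J s) \<in> borel_measurable borel" by (rule borel_measurable_mono)
  then have "(\<lambda>s. - (- J s)) \<in> borel_measurable borel" by (rule borel_measurable_uminus)
  then have [measurable]: "J \<in> borel_measurable borel" by simp
  define h where "h k = inverse (real (Suc k))" for k
  have h: "h k > 0" for k by (simp add: h_def)
  have h0: "h \<longlonglongrightarrow> 0" unfolding h_def by (rule LIMSEQ_inverse_real_of_nat)
  define D where "D k t = ennreal ((J (t - h k) - J t) / h k) * indicator {0<..} t" for k t
  have [measurable]: "D k \<in> borel_measurable borel" for k unfolding D_def by measurable
  have point: "ennreal (C * g t * \<mu> t) * indicator {0<..} t \<le> liminf (\<lambda>k. D k t)" for t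
  \<comment> \<open>If \<open>I t = 0\<close>, the hypothesis \<open>degen\<close> makes the left
    side vanish. Otherwise \<open>I t > 0\<close>, as is required for the tangent inequality and for
    the limit of the quotients in \<open>L\<close>.\<close>
  proof (cases "0 < t \<and> I t \<noteq> 0")
    case False
    then have "ennreal (C * g t * \<mu> t) * indicator {0<..} t = 0" using degen[of t] by (auto simp: indicator_def)
    then show ?thesis by (metis zero_le)
  next
    case True
    then have t: "t > 0" and It: "I t > 0" using I(2)[of t] by auto
    \<comment> \<open>Left continuity is available for steps up to \<open>t / 2\<close> only; from
      some index on \<open>d k\<close> is just \<open>h k\<close>.\<close>
    define d where "d k = min (h k) (t / 2)" for k
    have d: "0 < d k" "d k \<le> t / 2" "d k \<le> h k" for k using h[of k] t by (auto simp: d_def)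
    have "d \<longlonglongrightarrow> min 0 (t / 2)" unfolding d_def by (intro tendsto_intros h0)
    then have d0: "d \<longlonglongrightarrow> 0" using t by simp
    \<comment> \<open>The minimum of \<open>g\<close> on the interval is the constant
      \<open>m\<close> for \<open>drop\<close>. The minimisers tend to \<open>t\<close>, so these
      minima tend to \<open>g t\<close>.\<close>
    have "\<exists>r\<in>{t - d k..t}. \<forall>x\<in>{t - d k..t}. g r \<le> g x" for k
      by (rule continuous_attains_inf) (use d(1)[of k] continuous_on_subset[OF g(1)] in auto)
    then have "\<exists>r. t - d k \<le> r \<and> r \<le> t \<and> (\<forall>x. t - d k \<le> x \<longrightarrow> x \<le> t \<longrightarrow> g r \<le> g x)" for k
      by (meson atLeastAtMost_iff)
    then obtain r where r: "\<And>k. t - d k \<le> r k" "\<And>k. r k \<le> t" "\<And>k x. t - d k \<le> x \<Longrightarrow> x \<le> t \<Longrightarrow> g (r k) \<le> g x"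
      by metis
    have "(\<lambda>k. t - d k) \<longlonglongrightarrow> t - 0" by (intro tendsto_intros d0)
    then have td: "(\<lambda>k. t - d k) \<longlonglongrightarrow> t" by simp
    have r0: "r \<longlonglongrightarrow> t"
      by (rule tendsto_sandwich[OF _ _ td tendsto_const]) (use r in auto)
    have "isCont g t" using g(1) by (simp add: continuous_on_eq_continuous_at)
    then have gr: "(\<lambda>k. g (r k)) \<longlonglongrightarrow> g t" using r0 by (rule isCont_tendsto_compose)
    have Id: "(\<lambda>k. I (t - d k)) \<longlonglongrightarrow> I t" using d d0 t by (intro I_left) (auto intro: less_imp_le)
    \<comment> \<open>\<open>iso\<close> involves \<open>I\<close> at the lower end
      \<open>t - d k\<close>, whereas the tangent inequality involves it at \<open>t\<close>. The
      quotient records this mismatch and tends to 1 by left continuity.\<close>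
    define L where "L k = C * g (r k) * \<mu> t * (I t powr q / I (t - d k) powr q)" for k
    have "L \<longlonglongrightarrow> C * g t * \<mu> t * (I t powr q / I t powr q)"
      unfolding L_def using It by (intro tendsto_intros gr Id) auto
    then have "L \<longlonglongrightarrow> C * g t * \<mu> t" using It by simp
    then have lim: "(\<lambda>k. ennreal (L k)) \<longlonglongrightarrow> ennreal (C * g t * \<mu> t)" by (rule tendsto_ennrealI)
    have "\<forall>\<^sub>F k in sequentially. h k < t / 2" using t by (intro order_tendstoD(2)[OF h0]) simp
    then have ev: "\<forall>\<^sub>F k in sequentially. ennreal (L k) \<le> D k t"
    proof eventually_elim
      case (elim k)
      then have dh: "d k = h k" by (simp add: d_def)
      define s where "s = t - h k"
      have s: "0 < s" "s < t" using elim h[of k] t by (auto simp: s_def)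
      have Ist: "I t \<le> I s" using I(1) s by simp
      then have Is: "I s powr q > 0" using It by simp
      have rk: "g (r k) \<ge> 0" using r(1)[of k] s dh by (intro g(2)) (simp add: s_def)
      have "C * \<mu> t * h k / I s powr q \<le> \<mu> s - \<mu> t"
        using iso[OF s] Is by (simp add: s_def divide_le_eq mult.commute)
      then have "g (r k) * (C * \<mu> t * h k / I s powr q) \<le> g (r k) * (\<mu> s - \<mu> t)"
        using rk by (rule mult_left_mono)
      also have "\<dots> \<le> I s - I t" using r(3)[of k] dh by (intro drop[OF s]) (simp add: s_def)
      finally have "I t powr q * (g (r k) * (C * \<mu> t * h k / I s powr q)) \<le> I t powr q * (I s - I t)"
        by (intro mult_left_mono) simp_all
      also have "\<dots> \<le> J s - J t" unfolding J_def by (rule powr_diff_ge[OF It Ist q])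
      finally have "L k * h k \<le> J s - J t" by (simp add: L_def dh s_def mult_ac)
      then have "L k \<le> (J s - J t) / h k" using h[of k] by (simp add: le_divide_eq)
      then show ?case using t by (simp add: D_def s_def ennreal_leI)
    qed
    have "ennreal (C * g t * \<mu> t) = liminf (\<lambda>k. ennreal (L k))"
      using lim by (intro lim_imp_Liminf[symmetric]) auto
    also have "\<dots> \<le> liminf (\<lambda>k. D k t)" using ev by (rule Liminf_mono)
    finally show ?thesis using t by simp
  qed
  have "(\<integral>\<^sup>+t. ennreal (C * g t * \<mu> t) * indicator {0<..} t \<partial>lborel) \<le> (\<integral>\<^sup>+t. liminf (\<lambda>k. D k t) \<partial>lborel)"
    by (intro nn_integral_mono point)
  also have "\<dots> \<le> liminf (\<lambda>k. \<integral>\<^sup>+t. D k t \<partial>lborel)" by (rule nn_integral_liminf) simp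
  also have "\<dots> \<le> liminf (\<lambda>k::nat. ennreal (I0 powr (q + 1) / (q + 1)))"
    unfolding D_def
    by (intro Liminf_mono always_eventually allI nn_integral_decreasing_quotient_le[where M = M]) (use J J' h in auto)
  also have "\<dots> = ennreal (I0 powr (q + 1) / (q + 1))" by (simp add: Liminf_const)
  finally show ?thesis .
qed

text \<open>Here the level functions are instantiated. Exchanging the order of integration turns the
  integral of \<open>g t * \<mu> t\<close> over the levels into the integral of the primitive of
  \<open>g\<close> at \<open>v x\<close>, and at level 0 the function \<open>I\<close> is the full
  integral of \<open>g (v x)\<close>.\<close>

lemma superlevel_potential_inequality:
  fixes v F :: "'a::euclidean_space \<Rightarrow> real" and g :: "real \<Rightarrow> real"
  assumes dim: "DIM('a) \<ge> 2"
    and v: "continuous_on UNIV v" "bounded {x. v x > 0}"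
    and der: "\<And>x. v x > 0 \<Longrightarrow> (v has_derivative (\<lambda>h. Dv x \<bullet> h)) (at x)"
    and Dv: "continuous_on {x. v x > 0} Dv"
    and F: "continuous_on UNIV F" "\<And>\<xi>. 0 \<le> F \<xi>"
    and K: "convex K" "bounded K" "interior K \<noteq> {}" "\<And>z \<xi>. z \<in> K \<Longrightarrow> - (z \<bullet> \<xi>) \<le> F \<xi>"
    and V: "\<And>x. v x > 0 \<Longrightarrow> V differentiable (at x)" "\<And>x. v x > 0 \<Longrightarrow> divergence V x = - (DIM('a) * g (v x))"
      "\<And>x. v x > 0 \<Longrightarrow> V x \<bullet> Dv x = DIM('a) * F (Dv x) ^ DIM('a)"
    and g: "continuous_on UNIV g" "\<And>r. r \<ge> 0 \<Longrightarrow> 0 \<le> g r"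
  defines "q \<equiv> 1 / real (DIM('a) - 1)"
    and "C \<equiv> root (DIM('a) - 1) (real DIM('a) ^ DIM('a) * measure lebesgue K)"
  shows "C * integral {x. v x > 0} (\<lambda>x. integral {0..v x} g)
      \<le> integral {x. v x > 0} (\<lambda>x. g (v x)) powr (q + 1) / (q + 1)"
proof -
  let ?p = "DIM('a) - 1" let ?\<Omega> = "{x. v x > 0}"
  have p: "?p > 0" using dim by simp
  have q: "q > 0" using p by (simp add: q_def)
  have [measurable]: "v \<in> borel_measurable borel" using v(1) by (rule borel_measurable_continuous_onI)
  have \<Omega>: "open ?\<Omega>" using v(1) by (intro open_Collect_less) auto
  have gv: "continuous_on A (\<lambda>x. g (v x))" for A
    by (rule continuous_on_compose2[OF g(1) continuous_on_subset[OF v(1)]]) auto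
  have K0: "measure lebesgue K > 0"
  proof -
    have "\<not> negligible K" using K(3) open_not_negligible[OF open_interior] negligible_subset interior_subset by blast
    then show ?thesis using measurable_convex[OF K(1,2)] by (metis negligible_iff_measure measure_nonneg order_le_less)
  qed
  have C: "C > 0" unfolding C_def using p K0 by (intro real_root_gt_zero) auto
  have comp: "compact (closure ?\<Omega>)" using v(2) by (simp add: compact_closure)
  have intg: "integrable lborel (\<lambda>x. indicator S x * f x)" if "S \<in> sets borel" "S \<subseteq> ?\<Omega>" "continuous_on UNIV f"
    for S and f :: "'a \<Rightarrow> real"
  proof -
    have "integrable lborel (\<lambda>x. indicator (closure ?\<Omega>) x *\<^sub>R f x)"
      using comp that(3) by (intro borel_integrable_compact continuous_on_subset[OF that(3)]) auto
    then have "integrable lborel (\<lambda>x. indicator S x *\<^sub>R (indicator (closure ?\<Omega>) x *\<^sub>R f x))"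
      by (rule integrable_mult_indicator[rotated]) (use that in simp)
    moreover have "indicator S x *\<^sub>R (indicator (closure ?\<Omega>) x *\<^sub>R f x) = indicator S x * f x" for x
      using that(2) closure_subset[of ?\<Omega>] by (auto simp: indicator_def)
    ultimately show ?thesis by (simp only:)
  qed
  have "compact (v ` closure ?\<Omega>)" using comp continuous_on_subset[OF v(1)] by (intro compact_continuous_image) auto
  then obtain M where M: "\<And>x. x \<in> closure ?\<Omega> \<Longrightarrow> \<bar>v x\<bar> \<le> M"
    by (force dest!: compact_imp_bounded simp: bounded_iff)
  \<comment> \<open>The condition \<open>0 < v x\<close> makes \<open>L s\<close> the whole
    positivity set for every \<open>s \<le> 0\<close>, so that \<open>I\<close> and
    \<open>\<mu>\<close> are finite and constant there.\<close>
  define L where "L s = {x. 0 < v x \<and> s \<le> v x}" for s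
  have L_sets: "L s \<in> sets borel" for s
  proof -
    have "{x \<in> space borel. 0 < v x \<and> s \<le> v x} \<in> sets borel" by measurable
    then show ?thesis by (simp add: L_def)
  qed
  have L\<Omega>: "L s \<subseteq> ?\<Omega>" for s by (auto simp: L_def)
  have Lpos: "L s = {x. s \<le> v x}" if "s > 0" for s using that by (auto simp: L_def)
  have Lm: "L s \<in> lmeasurable" for s
    using L_sets[of s] by (intro bounded_set_imp_lmeasurable bounded_subset[OF v(2) L\<Omega>]) auto
  define \<mu> where "\<mu> s = measure lebesgue (L s)" for s
  define I where "I s = (\<integral>x. indicator (L s) x * g (v x) \<partial>lborel)" for s
  have Iint: "integrable lborel (\<lambda>x. indicator (L s) x * g (v x))" for s
    by (intro intg L_sets L\<Omega> gv)
  have g0: "0 \<le> g (v x)" if "x \<in> L s" for x s using that by (auto simp: L_def intro!: g(2))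
  have iso: "C * \<mu> t * (t - s) \<le> I s powr q * (\<mu> s - \<mu> t)" if st: "0 < s" "s < t" for s t
  proof -
    have I0: "I s \<ge> 0" unfolding I_def using g0 by (intro integral_nonneg_AE AE_I2) (auto simp: indicator_def)
    have \<mu>le: "\<mu> t \<le> \<mu> s"
      unfolding \<mu>_def using st by (intro measure_mono_fmeasurable Lm fmeasurableD) (auto simp: L_def)
    \<comment> \<open>The root and the power 1/(n-1) agree at 0 as well, since
      \<open>0 powr q\<close> is 0.\<close>
    have Iq: "I s powr q = root ?p (I s)"
    proof (cases "I s = 0")
      case False
      then show ?thesis using I0 p by (simp add: root_powr_inverse q_def)
    qed simp
    have "real DIM('a) ^ DIM('a) * measure lebesgue K * (\<mu> t * (t - s)) ^ ?p \<le> I s * (\<mu> s - \<mu> t) ^ ?p"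
      using superlevel_inequality[OF dim v der Dv F K V gv _ st] st
      by (simp add: \<mu>_def I_def Lpos g(2) less_imp_le)
    then have "root ?p (real DIM('a) ^ DIM('a) * measure lebesgue K * (\<mu> t * (t - s)) ^ ?p) \<le> root ?p (I s * (\<mu> s - \<mu> t) ^ ?p)"
      using p by simp
    then have "C * (\<mu> t * (t - s)) \<le> root ?p (I s) * (\<mu> s - \<mu> t)"
      using p st \<mu>le by (simp add: real_root_mult real_root_power_cancel C_def \<mu>_def)
    then show ?thesis by (simp add: Iq mult.assoc)
  qed
  have main: "(\<integral>\<^sup>+t. ennreal (C * g t * \<mu> t) * indicator {0<..} t \<partial>lborel) \<le> ennreal (I 0 powr (q + 1) / (q + 1))"
  proof (rule level_set_integral_inequality[OF q])
    show "0 \<le> C" using C by simp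
    show "I t \<le> I s" if "s \<le> t" for s t
      unfolding I_def
    proof (rule integral_mono[OF Iint Iint])
      fix x
      have "L t \<subseteq> L s" using that by (auto simp: L_def)
      then show "indicator (L t) x * g (v x) \<le> indicator (L s) x * g (v x)"
        using g0[of x s] by (auto simp: indicator_def)
    qed
    show "0 \<le> I s" for s
      unfolding I_def using g0 by (intro integral_nonneg_AE AE_I2) (auto simp: indicator_def)
    have L0: "L s = L 0" if "s \<le> 0" for s using that by (auto simp: L_def)
    show "I s = I 0" if "s \<le> 0" for s unfolding I_def L0[OF that] by simp
    show "I s = 0" if "s > M" for s
    proof -
      have "L s = {}" using M closure_subset[of ?\<Omega>] that by (fastforce simp: L_def)
      then show ?thesis by (simp add: I_def)
    qed
    show "(\<lambda>k. I (s - d k)) \<longlonglongrightarrow> I s"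
      if "0 < s" "d \<longlonglongrightarrow> 0" "\<And>k. 0 \<le> d k" "\<And>k. d k \<le> s / 2" for s d
    proof -
      have "0 < s - d k" for k using that(1) that(4)[of k] by linarith
      then show ?thesis
        using tendsto_integral_superlevel[OF v gv that] that(1) by (simp add: I_def Lpos)
    qed
    show "\<mu> t \<le> \<mu> s" if "s \<le> t" for s t
      unfolding \<mu>_def using that by (intro measure_mono_fmeasurable Lm fmeasurableD) (auto simp: L_def)
    show "0 \<le> \<mu> s" for s by (simp add: \<mu>_def)
    show "C * \<mu> t * (t - s) \<le> I s powr q * (\<mu> s - \<mu> t)" if "0 < s" "s < t" for s t
      by (rule iso[OF that])
    show "m * (\<mu> s - \<mu> t) \<le> I s - I t"
      if st: "0 < s" "s < t" and m: "\<And>r. s \<le> r \<Longrightarrow> r \<le> t \<Longrightarrow> m \<le> g r" for s t m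
    proof -
      let ?S = "L s - L t"
      have sub: "L t \<subseteq> L s" using st by (auto simp: L_def)
      have Sm: "?S \<in> sets borel" using L_sets by auto
      have "measure lebesgue ?S = \<mu> s - \<mu> t"
        unfolding \<mu>_def by (intro measurable_measure_Diff Lm fmeasurableD sub)
      then have S\<mu>: "measure lborel ?S = \<mu> s - \<mu> t" using Sm by simp
      have "m * (\<mu> s - \<mu> t) = (\<integral>x. indicator ?S x * m \<partial>lborel)" using Sm by (simp add: S\<mu>)
      also have "\<dots> \<le> (\<integral>x. indicator ?S x * g (v x) \<partial>lborel)"
      proof (rule integral_mono)
        show "integrable lborel (\<lambda>x. indicator ?S x * m)"
          "integrable lborel (\<lambda>x. indicator ?S x * g (v x))"
          using L\<Omega> by (intro intg Sm gv continuous_intros; auto)+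
        show "indicator ?S x * m \<le> indicator ?S x * g (v x)" for x
          using m[of "v x"] st by (auto simp: indicator_def Lpos L_def)
      qed
      also have "\<dots> = (\<integral>x. indicator (L s) x * g (v x) - indicator (L t) x * g (v x) \<partial>lborel)"
        using sub by (intro Bochner_Integration.integral_cong) (auto simp: indicator_def)
      also have "\<dots> = I s - I t"
        unfolding I_def by (rule Bochner_Integration.integral_diff[OF Iint Iint])
      finally show ?thesis .
    qed
    \<comment> \<open>If \<open>I s = 0\<close>, then \<open>iso\<close> forces
      \<open>\<mu> t = 0\<close> for all \<open>t > s\<close>, so \<open>v \<le> s\<close>
      everywhere because nonempty open sets are not null. Thus \<open>v\<close> equals
      \<open>s\<close> on \<open>L s\<close>, and \<open>I s\<close> is the product of
      \<open>\<mu> s\<close> and \<open>g s\<close>.\<close>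
    show "g s * \<mu> s = 0" if s: "0 < s" and Is: "I s = 0" for s
    proof -
      have \<mu>t: "\<mu> t = 0" if "s < t" for t
      proof -
        have "C * \<mu> t * (t - s) \<le> 0" using iso[OF s that] by (simp add: Is)
        moreover have "C * \<mu> t * (t - s) \<ge> 0" using C that by (simp add: \<mu>_def)
        ultimately show ?thesis using C that by simp
      qed
      have vs: "v x \<le> s" for x
      proof (rule ccontr)
        assume "\<not> v x \<le> s"
        then obtain t where t: "s < t" "t < v x" by (meson dense not_le)
        have "open {x. t < v x}" using v(1) by (intro open_Collect_less) auto
        moreover have "negligible (L t)" using \<mu>t[OF t(1)] Lm[of t] by (simp add: \<mu>_def negligible_iff_measure)
        then have "negligible {x. t < v x}"
          by (rule negligible_subset) (use s t in \<open>auto simp: L_def\<close>)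
        ultimately show False using t(2) open_not_negligible by blast
      qed
      have "indicator (L s) x * g (v x) = indicator (L s) x * g s" for x
        using vs[of x] s by (auto simp: indicator_def L_def)
      then have "I s = (\<integral>x. indicator (L s) x * g s \<partial>lborel)" by (simp only: I_def)
      also have "\<dots> = measure lborel (L s) * g s" using L_sets[of s] by simp
      finally show ?thesis using Is L_sets[of s] by (auto simp: \<mu>_def)
    qed
  qed (use g in auto)
  define H where "H r = integral {0..r} g" for r
  have gint: "g integrable_on {0..r}" for r
    by (intro integrable_continuous_interval continuous_on_subset[OF g(1)]) simp
  have H0: "H r \<ge> 0" for r unfolding H_def using g(2) by (intro integral_nonneg gint) auto
  have Hint: "integrable lborel (\<lambda>x. indicator ?\<Omega> x * H (v x))"
  proof -
    have "continuous_on {0..\<bar>M\<bar>} H"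
      unfolding H_def by (rule indefinite_integral_continuous_1[OF gint])
    \<comment> \<open>Clipping \<open>v\<close> to \<open>{0..\<bar>M\<bar>}\<close>, where
      \<open>H\<close> is known to be continuous, gives a globally continuous function that agrees
      with \<open>H (v x)\<close> on the positivity set.\<close>
    then have "continuous_on UNIV (\<lambda>x. H (max 0 (min \<bar>M\<bar> (v x))))"
      by (rule continuous_on_compose2) (auto intro!: continuous_intros v)
    then have "integrable lborel (\<lambda>x. indicator ?\<Omega> x * H (max 0 (min \<bar>M\<bar> (v x))))"
      using \<Omega> by (intro intg) auto
    moreover have "indicator ?\<Omega> x * H (max 0 (min \<bar>M\<bar> (v x))) = indicator ?\<Omega> x * H (v x)" for x
    proof (cases "x \<in> ?\<Omega>")
      case True
      then have "max 0 (min \<bar>M\<bar> (v x)) = v x" using M[of x] closure_subset[of ?\<Omega>] by (auto simp: max_def min_def)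
      then show ?thesis by simp
    qed simp
    ultimately show ?thesis by (simp only:)
  qed
  \<comment> \<open>For fixed \<open>x\<close> the positive levels \<open>t\<close> with
    \<open>x \<in> L t\<close> are those with \<open>t \<le> v x\<close>, so the inner integral is a
    primitive of \<open>g\<close> at \<open>v x\<close>.\<close>
  have inner: "(\<integral>\<^sup>+t. ennreal (C * g t) * indicator {0<..} t * indicator {(t, x). x \<in> L t} (t, x) \<partial>lborel)
      = ennreal (C * (indicator ?\<Omega> x * H (v x)))" for x
  proof (cases "v x > 0")
    case True
    have "(\<integral>\<^sup>+t. ennreal (C * g t) * indicator {0<..} t * indicator {(t, x). x \<in> L t} (t, x) \<partial>lborel)
       = (\<integral>\<^sup>+t. ennreal (C * g t) * indicator {0<..v x} t \<partial>lborel)"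
      using True by (intro nn_integral_cong) (auto simp: indicator_def L_def)
    also have "\<dots> = (\<integral>\<^sup>+t. ennreal (C * g t) * indicator {0..v x} t \<partial>lborel)"
    proof (rule nn_integral_cong_AE)
      have "AE t::real in lborel. t \<noteq> 0" by (rule AE_lborel_singleton)
      then show "AE t in lborel. ennreal (C * g t) * indicator {0<..v x} t = ennreal (C * g t) * indicator {0..v x} t"
        by eventually_elim (auto simp: indicator_def)
    qed
    also have "\<dots> = ennreal (C * H (v x))"
    proof (rule nn_integral_has_integral_lebesgue')
      show "((\<lambda>t. C * g t) has_integral C * H (v x)) {0..v x}"
        unfolding H_def by (intro has_integral_mult_right integrable_integral gint)
    qed (use C g in auto)
    finally show ?thesis using True by simp
  next
    case False
    then have "x \<notin> L t" for t by (simp add: L_def)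
    then show ?thesis using False by simp
  qed
  have "(\<integral>\<^sup>+t. ennreal (C * g t * \<mu> t) * indicator {0<..} t \<partial>lborel)
     = (\<integral>\<^sup>+t. ennreal (C * g t) * indicator {0<..} t * emeasure lborel {x. (t, x) \<in> {(t, x). x \<in> L t}} \<partial>lborel)"
  proof (rule nn_integral_cong)
    fix t :: real
    have "emeasure lborel (L t) = ennreal (\<mu> t)"
      using emeasure_eq_measure2[OF Lm[of t]] L_sets[of t] by (simp add: \<mu>_def)
    then show "ennreal (C * g t * \<mu> t) * indicator {0<..} t
      = ennreal (C * g t) * indicator {0<..} t * emeasure lborel {x. (t, x) \<in> {(t, x). x \<in> L t}}"
      using C g(2)[of t] by (auto simp: indicator_def ennreal_mult \<mu>_def)
  qed
  also have "\<dots> = (\<integral>\<^sup>+x. (\<integral>\<^sup>+t. ennreal (C * g t) * indicator {0<..} t * indicator {(t, x). x \<in> L t} (t, x) \<partial>lborel) \<partial>lborel)"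
  proof (rule nn_integral_layer_cake)
    have "{z \<in> space (borel \<Otimes>\<^sub>M borel). 0 < v (snd z) \<and> fst z \<le> v (snd z)} \<in> sets (borel \<Otimes>\<^sub>M borel)"
      by measurable
    then show "{(t, x). x \<in> L t} \<in> sets (borel \<Otimes>\<^sub>M borel)"
      by (simp add: space_pair_measure L_def split_beta')
    have [measurable]: "g \<in> borel_measurable borel" using g(1) by (rule borel_measurable_continuous_onI)
    show "(\<lambda>t. ennreal (C * g t) * indicator {0<..} t) \<in> borel_measurable borel" by measurable
  qed
  also have "\<dots> = (\<integral>\<^sup>+x. ennreal (C * (indicator ?\<Omega> x * H (v x))) \<partial>lborel)" by (simp add: inner)
  also have "\<dots> = ennreal (\<integral>x. C * (indicator ?\<Omega> x * H (v x)) \<partial>lborel)"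
    using Hint H0 C by (intro nn_integral_eq_integral integrable_mult_right) auto
  finally have "(\<integral>x. C * (indicator ?\<Omega> x * H (v x)) \<partial>lborel) \<le> I 0 powr (q + 1) / (q + 1)"
    using main q by (simp add: ennreal_le_iff)
  moreover have HK: "integral ?\<Omega> f = (\<integral>x. indicator ?\<Omega> x * f x \<partial>lborel)"
    if "integrable lborel (\<lambda>x. indicator ?\<Omega> x * f x)" for f :: "'a \<Rightarrow> real"
    using set_borel_integral_eq_integral(2)[of ?\<Omega> f] that
    by (simp add: set_integrable_def set_lebesgue_integral_def)
  have "L 0 = ?\<Omega>" by (auto simp: L_def)
  then have "I 0 = integral ?\<Omega> (\<lambda>x. g (v x))" using HK[of "\<lambda>x. g (v x)"] Iint[of 0] by (simp add: I_def)
  moreover have "(\<integral>x. C * (indicator ?\<Omega> x * H (v x)) \<partial>lborel) = C * integral ?\<Omega> (\<lambda>x. H (v x))"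
    using HK[OF Hint] by simp
  ultimately show ?thesis by (simp only: H_def)
qed

section \<open>The differential equation\<close>

text \<open>Every linear functional is an inner product with a fixed vector, so the choice in
  \<open>grad\<close> has a witness, and uniqueness of the derivative determines its values.\<close>

lemma grad_has_derivative:
  fixes f :: "'a::euclidean_space \<Rightarrow> real"
  assumes "(f has_derivative f') (at x)"
  shows "(f has_derivative (\<lambda>h. grad f x \<bullet> h)) (at x)" "grad f x \<bullet> h = f' h"
proof -
  have lin: "linear f'" using assms has_derivative_linear by blast
  have "f' h = (\<Sum>i\<in>Basis. f' i *\<^sub>R i) \<bullet> h" for h
  proof -
    have "f' h = f' (\<Sum>i\<in>Basis. (h \<bullet> i) *\<^sub>R i)" by (simp add: euclidean_representation)
    also have "\<dots> = (\<Sum>i\<in>Basis. (h \<bullet> i) * f' i)"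
      by (simp add: linear_sum[OF lin] linear_scale[OF lin])
    also have "\<dots> = (\<Sum>i\<in>Basis. f' i *\<^sub>R i) \<bullet> h"
      by (simp add: inner_sum_left inner_commute[of h] mult.commute)
    finally show ?thesis .
  qed
  then have "f' = (\<lambda>h. (\<Sum>i\<in>Basis. f' i *\<^sub>R i) \<bullet> h)" by blast
  then have "\<exists>w. (f has_derivative (\<lambda>h. w \<bullet> h)) (at x)" using assms by metis
  then show *: "(f has_derivative (\<lambda>h. grad f x \<bullet> h)) (at x)"
    unfolding grad_def by (rule someI_ex)
  show "grad f x \<bullet> h = f' h" using has_derivative_unique[OF * assms] by metis
qed

lemma smooth_on_grad:
  fixes u :: "'a::euclidean_space \<Rightarrow> real"
  assumes "smooth_on S u"
  shows "x \<in> S \<Longrightarrow> (u has_derivative (\<lambda>h. grad u x \<bullet> h)) (at x)" "continuous_on S (grad u)"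
proof -
  have "Ck_on 1 S u" using assms unfolding smooth_on_def by blast
  then obtain u' where u': "\<And>x. x \<in> S \<Longrightarrow> (u has_derivative u' x) (at x)" "\<And>w. continuous_on S (\<lambda>x. u' x w)"
    by auto
  show "x \<in> S \<Longrightarrow> (u has_derivative (\<lambda>h. grad u x \<bullet> h)) (at x)"
    by (rule grad_has_derivative(1)[OF u'(1)])
  have "grad u x = (\<Sum>i\<in>Basis. u' x i *\<^sub>R i)" if "x \<in> S" for x
    using grad_has_derivative(2)[OF u'(1)[OF that]] euclidean_representation[of "grad u x"] by simp
  then have "continuous_on S (grad u) \<longleftrightarrow> continuous_on S (\<lambda>x. \<Sum>i\<in>Basis. u' x i *\<^sub>R i)"
    by (intro continuous_on_cong) auto
  moreover have "continuous_on S (\<lambda>x. \<Sum>i\<in>Basis. u' x i *\<^sub>R i)" by (intro continuous_intros u')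
  ultimately show "continuous_on S (grad u)" by simp
qed

text \<open>Differentiating F(t \<xi>)^n = t^n F(\<xi>)^n at t = 1 gives the identity where
  \<open>F\<close> is differentiable. At the origin both sides are 0, whatever vector
  \<open>grad\<close> denotes there.\<close>

lemma euler_homogeneous:
  fixes F :: "'a::euclidean_space \<Rightarrow> real"
  assumes C1: "Ck_on 1 (- {0}) F" and hom: "\<And>t x. F (t *\<^sub>R x) = \<bar>t\<bar> * F x"
    and n: "n \<ge> 1"
  shows "grad (\<lambda>\<xi>. F \<xi> ^ n) \<xi> \<bullet> \<xi> = n * F \<xi> ^ n"
proof (cases "\<xi> = 0")
  case True
  then show ?thesis using hom[of 0 0] n by simp
next
  case False
  then obtain F' where "(F has_derivative F') (at \<xi>)" using C1 by auto
  then have "(\<lambda>\<xi>. F \<xi> ^ n) differentiable (at \<xi>)"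
    by (intro differentiable_power) (auto simp: differentiable_def)
  then have g: "((\<lambda>\<xi>. F \<xi> ^ n) has_derivative (\<lambda>h. grad (\<lambda>\<xi>. F \<xi> ^ n) \<xi> \<bullet> h)) (at \<xi>)"
    unfolding differentiable_def using grad_has_derivative(1) by blast
  have "((\<lambda>t::real. t *\<^sub>R \<xi>) has_derivative (\<lambda>h. h *\<^sub>R \<xi>)) (at 1)"
    by (auto intro!: derivative_eq_intros)
  then have "((\<lambda>t::real. F (t *\<^sub>R \<xi>) ^ n) has_derivative (\<lambda>h. grad (\<lambda>\<xi>. F \<xi> ^ n) \<xi> \<bullet> (h *\<^sub>R \<xi>))) (at 1)"
    by (rule has_derivative_compose) (use g in simp)
  then have "((\<lambda>t::real. F (t *\<^sub>R \<xi>) ^ n) has_real_derivative (grad (\<lambda>\<xi>. F \<xi> ^ n) \<xi> \<bullet> \<xi>)) (at 1)"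
    by (rule has_derivative_imp_has_field_derivative) simp
  then have "((\<lambda>t::real. t ^ n * F \<xi> ^ n) has_real_derivative (grad (\<lambda>\<xi>. F \<xi> ^ n) \<xi> \<bullet> \<xi>)) (at 1)"
    by (rule has_field_derivative_transform_within_open[of _ _ 1 "{0<..}"]) (auto simp: hom power_mult_distrib)
  moreover have "((\<lambda>t::real. t ^ n * F \<xi> ^ n) has_real_derivative (n * F \<xi> ^ n)) (at 1)"
    by (auto intro!: derivative_eq_intros)
  ultimately show ?thesis by (rule DERIV_unique)
qed

lemma polar_body_eq:
  assumes "\<And>z. z \<noteq> 0 \<Longrightarrow> 0 < F z" "F 0 = 0"
  shows "polar_body F = {x. \<forall>z. x \<bullet> z \<le> F z}"
proof -
  have "(x \<bullet> z) / F z \<le> 1 \<longleftrightarrow> x \<bullet> z \<le> F z" if "z \<noteq> 0" for x z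
    using assms(1)[OF that] by (simp add: divide_le_eq)
  then show ?thesis unfolding polar_body_def using assms(2) by (metis inner_zero_right order_refl)
qed

text \<open>The body is an intersection of half-spaces. The lower bound on \<open>F\<close> puts the
  ball of radius \<open>a\<close> inside it, and testing with \<open>z = x\<close> against the upper
  bound gives boundedness.\<close>

lemma polar_body_props:
  fixes F :: "'a::euclidean_space \<Rightarrow> real"
  assumes a: "0 < a" and F: "\<And>z. a * norm z \<le> F z \<and> F z \<le> c * norm z"
  shows "convex (polar_body F)" "bounded (polar_body F)" "interior (polar_body F) \<noteq> {}"
    "x \<in> polar_body F \<Longrightarrow> x \<bullet> z \<le> F z"
proof -
  have "F z > 0" if "z \<noteq> 0" for z
  proof -
    have "0 < a * norm z" using a that by simp
    then show ?thesis using F[of z] by linarith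
  qed
  moreover have "F 0 = 0" using F[of 0] by simp
  ultimately have eq: "polar_body F = {x. \<forall>z. x \<bullet> z \<le> F z}" by (rule polar_body_eq)
  show "x \<in> polar_body F \<Longrightarrow> x \<bullet> z \<le> F z" by (simp add: eq)
  have "polar_body F = (\<Inter>z. {x. z \<bullet> x \<le> F z})" by (auto simp: eq inner_commute)
  then show "convex (polar_body F)" by (simp add: convex_halfspace_le convex_INT)
  show "bounded (polar_body F)"
  proof (rule boundedI)
    fix x assume "x \<in> polar_body F"
    then have "x \<bullet> x \<le> c * norm x" using F[of x] by (auto simp: eq intro: order_trans)
    then have "norm x * norm x \<le> c * norm x" by (simp add: dot_square_norm power2_eq_square)
    then show "norm x \<le> max 0 c" by (cases "x = 0") auto
  qed
  have "ball 0 a \<subseteq> polar_body F"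
  proof
    fix x :: 'a assume "x \<in> ball 0 a"
    then have "norm x * norm z \<le> a * norm z" for z :: 'a by (intro mult_right_mono) auto
    then have "x \<bullet> z \<le> F z" for z
      using norm_cauchy_schwarz[of x z] F[of z] by (meson order_trans)
    then show "x \<in> polar_body F" by (simp add: eq)
  qed
  then have "ball 0 a \<subseteq> interior (polar_body F)" by (simp add: interior_maximal)
  then show "interior (polar_body F) \<noteq> {}" using a by force
qed

lemma continuous_zero_extension:
  fixes u :: "'a::euclidean_space \<Rightarrow> real"
  assumes "open \<Omega>" "continuous_on (closure \<Omega>) u" "\<And>x. x \<in> frontier \<Omega> \<Longrightarrow> u x = 0"
  shows "continuous_on UNIV (\<lambda>x. if x \<in> \<Omega> then u x else 0)"
proof -
  have "continuous_on (closure \<Omega> \<union> - \<Omega>) (\<lambda>x. if x \<in> \<Omega> then u x else 0)"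
  proof (rule continuous_on_closed_Un)
    show "continuous_on (closure \<Omega>) (\<lambda>x. if x \<in> \<Omega> then u x else 0)"
      by (rule continuous_on_eq[OF assms(2)])
         (use assms(1,3) in \<open>auto simp: frontier_def interior_open\<close>)
    show "continuous_on (- \<Omega>) (\<lambda>x. if x \<in> \<Omega> then u x else 0)"
      by (rule continuous_on_eq[of _ "\<lambda>_. 0"]) auto
  qed (use assms(1) in auto)
  moreover have "closure \<Omega> \<union> - \<Omega> = UNIV" using closure_subset by fastforce
  ultimately show ?thesis by simp
qed

text \<open>With p = n - 1 the exponent 1/p + 1 is n/(n-1). Multiplying by it clears the denominator
  on the right and puts a factor n/(n-1) on the left: the n raises the exponent n/(n-1) in the root
  to (2n-1)/(n-1), and n - 1 is the final denominator.\<close>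

lemma constant_identity:
  fixes n \<kappa> A B :: real and p :: nat
  assumes p: "p \<ge> 1" "n = real p + 1" and \<kappa>: "\<kappa> \<ge> 0"
    and le: "root p (n ^ (p + 1) * \<kappa>) * A \<le> B powr (1 / real p + 1) / (1 / real p + 1)"
  shows "B powr (n / (n - 1)) \<ge> (n powr ((2 * n - 1) / (n - 1)) * \<kappa> powr (1 / (n - 1)) / (n - 1)) * A"
proof -
  have n: "n > 0" "n - 1 = real p" "real p > 0" using p by auto
  have e: "1 / real p + 1 = n / (n - 1)" using n p by (simp add: field_simps)
  have r: "root p (n ^ (p + 1) * \<kappa>) = n powr (n / (n - 1)) * \<kappa> powr (1 / (n - 1))"
  proof -
    have np: "real (p + 1) * (1 / real p) = n / (n - 1)" using p by simp
    have "root p (n ^ (p + 1)) = (n ^ (p + 1)) powr (1 / real p)"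
      using n p by (simp add: root_powr_inverse)
    also have "\<dots> = n powr (n / (n - 1))"
      unfolding powr_realpow[OF n(1), symmetric] by (simp only: powr_powr np)
    finally have "root p (n ^ (p + 1)) = n powr (n / (n - 1))" .
    moreover have "root p \<kappa> = \<kappa> powr (1 / (n - 1))"
      using p \<kappa> n by (cases "\<kappa> = 0") (auto simp: root_powr_inverse)
    ultimately show ?thesis by (simp add: real_root_mult)
  qed
  have ee: "(2 * n - 1) / (n - 1) = n / (n - 1) + 1" using n by (simp add: field_simps)
  have "n powr ((2 * n - 1) / (n - 1)) = n powr (n / (n - 1)) * n"
    unfolding ee using n by (simp add: powr_add)
  then have "(n powr ((2 * n - 1) / (n - 1)) * \<kappa> powr (1 / (n - 1)) / (n - 1)) * A
     = n / (n - 1) * (root p (n ^ (p + 1) * \<kappa>) * A)"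
    unfolding r by simp
  also have "\<dots> \<le> n / (n - 1) * (B powr (n / (n - 1)) / (n / (n - 1)))"
    using le n unfolding e by (intro mult_left_mono) auto
  also have "\<dots> = B powr (n / (n - 1))" using n by simp
  finally show ?thesis .
qed

theorem theorem1p5:
  fixes F :: "'a::euclidean_space \<Rightarrow> real"
    and \<Omega> :: "'a set"
    and g :: "real \<Rightarrow> real"
    and u :: "'a \<Rightarrow> real"
    and a c :: real
  defines "n \<equiv> DIM('a)"
  assumes dim: "DIM('a) \<ge> 2"
    and F_nonneg: "\<forall>x. F x \<ge> 0"
    and F_convex: "convex_on UNIV F"
    and F_C1: "Ck_on 1 (- {0}) F"
    and F_even: "\<forall>x. F (- x) = F x"
    and F_hom: "\<forall>t x. F (t *\<^sub>R x) = \<bar>t\<bar> * F x"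
    and ac: "0 < a" "a \<le> c"
    and F_bounds: "\<forall>\<xi>. a * norm \<xi> \<le> F \<xi> \<and> F \<xi> \<le> c * norm \<xi>"
    and \<Omega>_open: "open \<Omega>" and \<Omega>_conn: "connected \<Omega>" and \<Omega>_bdd: "bounded \<Omega>"
    and \<Omega>_ne: "\<Omega> \<noteq> {}"
    and \<Omega>_smooth: "smooth_boundary \<Omega>"
    and g_cont: "continuous_on UNIV g"
    and g_nonneg: "\<forall>\<sigma>\<ge>0. g \<sigma> \<ge> 0"
    and u_smooth: "\<exists>S. open S \<and> closure \<Omega> \<subseteq> S \<and> smooth_on S u"
    and u_pos: "\<forall>x\<in>\<Omega>. u x > 0"
    and u_bdry: "\<forall>x\<in>frontier \<Omega>. u x = 0"
    and u_eq: "\<forall>x\<in>\<Omega>.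
        (\<lambda>y. grad (\<lambda>\<xi>. F \<xi> ^ n) (grad u y)) differentiable (at x) \<and>
        - (1 / real n) * divergence (\<lambda>y. grad (\<lambda>\<xi>. F \<xi> ^ n) (grad u y)) x = g (u x)"
  shows "(integral \<Omega> (\<lambda>x. g (u x))) powr (real n / (real n - 1)) \<ge>
         (real n powr ((2 * real n - 1) / (real n - 1))
            * measure lebesgue (polar_body F) powr (1 / (real n - 1)) / (real n - 1))
         * integral \<Omega> (\<lambda>x. integral {0..u x} g)"

proof -
  \<comment> \<open>Every positive superlevel set of the extension is a compact subset of
    \<open>\<Omega>\<close>, so working at positive levels produces no boundary terms.\<close>
  define v where "v x = (if x \<in> \<Omega> then u x else 0)" for x
  define V where "V y = grad (\<lambda>\<xi>. F \<xi> ^ n) (grad u y)" for y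
  obtain S where S: "open S" "closure \<Omega> \<subseteq> S" "smooth_on S u" using u_smooth by blast
  have \<Omega>S: "\<Omega> \<subseteq> S" using S(2) closure_subset by blast
  note Du = smooth_on_grad[OF S(3)]
  have "continuous_on (closure \<Omega>) u"
    using Du(1) S(2) by (meson continuous_at_imp_continuous_on has_derivative_continuous subsetD)
  then have v_cont: "continuous_on UNIV v"
    unfolding v_def[abs_def] using \<Omega>_open u_bdry by (intro continuous_zero_extension) auto
  have v\<Omega>: "{x. v x > 0} = \<Omega>" using u_pos by (auto simp: v_def)
  then have v_pos: "v x > 0 \<longleftrightarrow> x \<in> \<Omega>" for x by blast
  have v_der: "(v has_derivative (\<lambda>h. grad u x \<bullet> h)) (at x)" if "v x > 0" for x
  proof (rule has_derivative_transform_within_open[OF Du(1) \<Omega>_open])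
    show "x \<in> S" "x \<in> \<Omega>" using that v_pos \<Omega>S by auto
  qed (simp add: v_def)
  have hom: "F (t *\<^sub>R x) = \<bar>t\<bar> * F x" for t x using F_hom by blast
  have bnd: "a * norm z \<le> F z \<and> F z \<le> c * norm z" for z using F_bounds by blast
  have F_cont: "continuous_on UNIV F" using F_convex by (intro convex_on_continuous) auto
  note K = polar_body_props[OF ac(1) bnd]
  \<comment> \<open>Evenness of \<open>F\<close> supplies the sign that arises because the
    translation estimate goes from \<open>y + e *\<^sub>R z\<close> back to
    \<open>y\<close>.\<close>
  have K4: "- (z \<bullet> \<xi>) \<le> F \<xi>" if "z \<in> polar_body F" for z \<xi>
    using K(4)[OF that, of "- \<xi>"] F_even by simp
  have V_diff: "V differentiable (at x)" and V_div: "divergence V x = - (real DIM('a) * g (v x))" if "v x > 0" for x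
    using u_eq that dim by (auto simp: v_pos V_def[abs_def] v_def n_def field_simps)
  have V_grad: "V x \<bullet> grad u x = DIM('a) * F (grad u x) ^ DIM('a)" for x
    unfolding V_def n_def using dim by (intro euler_homogeneous F_C1 hom) simp
  have le: "root (DIM('a) - 1) (real DIM('a) ^ DIM('a) * measure lebesgue (polar_body F))
        * integral \<Omega> (\<lambda>x. integral {0..v x} g)
      \<le> integral \<Omega> (\<lambda>x. g (v x)) powr (1 / real (DIM('a) - 1) + 1) / (1 / real (DIM('a) - 1) + 1)"
    using superlevel_potential_inequality[OF dim v_cont _ v_der _ F_cont _ K(1-3) K4 V_diff V_div V_grad g_cont]
      \<Omega>_bdd continuous_on_subset[OF Du(2) \<Omega>S] F_nonneg g_nonneg by (simp add: v\<Omega>)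
  have "integral \<Omega> (\<lambda>x. integral {0..v x} g) = integral \<Omega> (\<lambda>x. integral {0..u x} g)"
    "integral \<Omega> (\<lambda>x. g (v x)) = integral \<Omega> (\<lambda>x. g (u x))"
    by (intro Henstock_Kurzweil_Integration.integral_cong; simp add: v_def)+
  with le show ?thesis
    using dim unfolding n_def by (intro constant_identity[where p = "DIM('a) - 1"]) auto
qed

end
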